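(* Assume $m\ge 10n\log n$ and let $\alpha\in(\alpha_0,\infty)$ be the solution to $\frac{m}{9n\log n}=n^{f(\alpha)}$. Then the expected number of inversions of the general secretary ranking algorithm described below, run with $h=\alpha\ln(n^{g(\alpha)})$, is $\tilde O(n^{1.5-0.5g(\alpha)})$.
   Context: Secretary ranking problem: $n$ elements with distinct values from a totally ordered set arrive online in uniformly random order; at time $t$ the algorithm knows only comparisons among the elements arrived so far and irrevocably assigns the arriving element a free position in $[m]$; an inversion is a pair of elements whose positions are in the opposite order to their true order. Define $f(\alpha)=\frac{\alpha\ln 2-1}{1-2\alpha\ln(2e/\alpha)}$ and $g(\alpha)=\frac{1}{1-2\alpha\ln(2e/\alpha)}$ on $(\alpha_0,\infty)$, where $\alpha_0\approx 4.910$ solves $1-2\alpha_0\ln(2e/\alpha_0)=0$. Dense Ranking algorithm on $w$ positions: maintain free positions $R$ (initially all $w$); for the $s$-th element $b_s$ given to it, let $r_s$ be the number of earlier elements given to it that are smaller than $b_s$, sample $x_s$ uniformly from $[r_s\frac{w}{s},(r_s+1)\frac{w}{s}]$, set $\tilde r=\lceil x_s\rceil$ and place $b_s$ at the free position nearest to $\tilde r$. General algorithm with height $h$: build a complete binary search tree of height $h$; associate a single position with each internal node and a block of $w=m/2^h-1$ consecutive positions with each leaf, so that the order of positions agrees with the left-to-right order of the tree (left subtree, then node, then right subtree). Each arriving element is inserted into the tree as in a binary search tree; if it reaches an empty internal node it is placed at that node's position; otherwise it reaches a leaf and is placed by a separate instance of Dense Ranking running on that leaf's block; if that block has no free position, it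 is placed arbitrarily. $\tilde O$ hides polylogarithmic factors in $n$; expectation is over the arrival order and the algorithm's randomness. *)

theory Defs
  imports
    "HOL-Probability.Probability"
    "HOL-Combinatorics.Multiset_Permutations"
    "HOL-Library.Monad_Syntax"
begin

section \<open>The exponents\<close>

text \<open>On \<open>(0, \<infinity>)\<close> the equation \<open>1 - 2 \<alpha> ln (2e/\<alpha>) = 0\<close> has a second root below 2; the
  intended one, \<open>4.9102...\<close>, is the only root beyond 2.\<close>

definition alpha0 :: real where
  "alpha0 = (THE a. a > 2 \<and> 1 - 2 * a * ln (2 * exp 1 / a) = 0)"

definition f_exp :: "real \<Rightarrow> real" where
  "f_exp a = (a * ln 2 - 1) / (1 - 2 * a * ln (2 * exp 1 / a))"

definition g_exp :: "real \<Rightarrow> real" where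
  "g_exp a = 1 / (1 - 2 * a * ln (2 * exp 1 / a))"

lemma alpha0_ex1: "\<exists>!a::real. a > 2 \<and> 1 - 2 * a * ln (2 * exp 1 / a) = 0"
proof -
  define F where "F = (\<lambda>a::real. 1 - 2 * a * (ln 2 + 1 - ln a))"
  have F: "1 - 2 * a * ln (2 * exp 1 / a) = F a" if "a > 2" for a :: real
    using that by (simp add: F_def ln_div ln_mult)
  have der: "(F has_real_derivative 2 * (ln a - ln 2)) (at a)" if "a \<ge> 2" for a
    unfolding F_def using that
    by (auto intro!: derivative_eq_intros simp: algebra_simps)
  have mono: "F a < F c" if "2 \<le> a" "a < c" for a c
  proof (rule DERIV_pos_imp_increasing_open[OF \<open>a < c\<close>])
    fix x assume "a < x" "x < c"
    with that show "\<exists>y. (F has_real_derivative y) (at x) \<and> 0 < y"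
      by (intro exI[of _ "2 * (ln x - ln 2)"] conjI der) auto
  next
    show "continuous_on {a..c} F"
      using that by (intro continuous_at_imp_continuous_on ballI DERIV_isCont[OF der]) auto
  qed
  have "\<exists>x\<ge>2. x \<le> 2 * exp 1 \<and> F x = 0"
  proof (rule IVT')
    show "F 2 \<le> 0" by (simp add: F_def)
    show "0 \<le> F (2 * exp 1)" by (simp add: F_def ln_mult)
    show "(2::real) \<le> 2 * exp 1" by simp
    show "continuous_on {2..2 * exp 1} F"
      by (intro continuous_at_imp_continuous_on ballI DERIV_isCont[OF der]) auto
  qed
  then obtain x where x: "x \<ge> 2" "F x = 0" by auto
  have "F 2 \<noteq> 0" by (simp add: F_def)
  with x have "x > 2" by (cases "x = 2") auto
  show ?thesis
  proof (rule ex1I[of _ x])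
    show "x > 2 \<and> 1 - 2 * x * ln (2 * exp 1 / x) = 0" using \<open>x > 2\<close> x F by simp
    fix y :: real assume "y > 2 \<and> 1 - 2 * y * ln (2 * exp 1 / y) = 0"
    then have "y > 2" "F y = 0" using F[of y] by linarith+
    with \<open>x > 2\<close> x show "y = x" using mono[of x y] mono[of y x] by linarith
  qed
qed

section \<open>Choices the algorithm leaves open\<close>

text \<open>The algorithm does not specify how ties for the nearest free position are broken, nor where
  an element goes if its block is full.  Both are delegated to a (possibly randomised) rule, which
  receives the comparisons among all elements arrived so far (the current one included), the
  positions assigned so far, and the set of admissible positions.\<close>

type_synonym choice_rule = "nat list \<Rightarrow> nat list \<Rightarrow> nat set \<Rightarrow> nat pmf"

definition choice_rule_ok :: "choice_rule \<Rightarrow> bool" where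
  "choice_rule_ok ch \<longleftrightarrow>
     (\<forall>cmp ps S. finite S \<longrightarrow> S \<noteq> {} \<longrightarrow> set_pmf (ch cmp ps S) \<subseteq> S)"

text \<open>For distinct elements, the relative ranks on arrival carry exactly the information of all
  pairwise comparisons.\<close>

definition comparisons :: "'a::linorder list \<Rightarrow> nat list" where
  "comparisons xs = map (\<lambda>i. card {j. j < i \<and> xs ! j < xs ! i}) [0..<length xs]"

section \<open>Dense Ranking\<close>

text \<open>The law of \<open>\<lceil>x\<rceil>\<close> for \<open>x\<close> uniform on \<open>[r w/s, (r+1) w/s]\<close>.  It is used only for
  \<open>w, s > 0\<close>, where the argument of \<open>Abs_pmf\<close> is indeed a discrete probability measure.\<close>

definition dense_target :: "nat \<Rightarrow> nat \<Rightarrow> nat \<Rightarrow> int pmf" where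
  "dense_target w s r = Abs_pmf (distr
     (uniform_measure lborel {real r * (real w / real s) .. (real r + 1) * (real w / real s)})
     (count_space UNIV) ceiling)"

lemma measure_pmf_dense_target:
  assumes "w > 0" "s > 0"
  shows "measure_pmf (dense_target w s r) = distr
     (uniform_measure lborel {real r * (real w / real s) .. (real r + 1) * (real w / real s)})
     (count_space UNIV) ceiling" (is "_ = ?M")
proof -
  have lt: "real r * (real w / real s) < (real r + 1) * (real w / real s)"
    using assms by (intro mult_strict_right_mono) auto
  interpret U: prob_space
    "uniform_measure lborel {real r * (real w / real s) .. (real r + 1) * (real w / real s)}"
    using lt assms by (intro prob_space_uniform_measure) auto
  interpret M: prob_space ?M
    by (rule U.prob_space_distr) simp
  have "AE x in ?M. measure ?M {x} \<noteq> 0"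
    by (subst M.AE_support_countable) (auto intro!: exI[of _ UNIV])
  then show ?thesis
    unfolding dense_target_def
    by (intro Abs_pmf_inverse CollectI conjI) (simp_all only: M.prob_space_axioms sets_distr sets_count_space Pow_UNIV)
qed

definition nearest :: "nat set \<Rightarrow> int \<Rightarrow> nat set" where
  "nearest R z = {p \<in> R. \<forall>q\<in>R. \<bar>int p - z\<bar> \<le> \<bar>int q - z\<bar>}"

text \<open>One placement by the Dense Ranking instance on the block \<open>{k+1..k+w}\<close> with free positions
  \<open>R\<close>; \<open>bs\<close> lists the elements given to this instance before \<open>b\<close>.  The target is relative to
  the block and is shifted by \<open>k\<close>.\<close>

definition dense_ranking ::
    "(nat set \<Rightarrow> nat pmf) \<Rightarrow> nat \<Rightarrow> nat \<Rightarrow> nat set \<Rightarrow> 'a::linorder list \<Rightarrow> 'a \<Rightarrow> nat pmf" where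
  "dense_ranking pick w k R bs b = do {
     z \<leftarrow> dense_target w (length bs + 1) (card {y \<in> set bs. y < b});
     pick (nearest R (int k + z))
   }"

section \<open>The general algorithm\<close>

text \<open>\<open>Block k bs\<close> is a leaf owning the block of positions \<open>{k+1..k+w}\<close>; \<open>bs\<close> are the elements
  it has been given, in order of arrival.  \<open>Node l p c r\<close> is an internal node with position \<open>p\<close>
  and content \<open>c\<close>.\<close>

datatype 'a rank_tree =
    Block nat "'a list"
  | Node "'a rank_tree" nat "'a option" "'a rank_tree"

text \<open>\<open>build w h k\<close> is the empty complete tree of height \<open>h\<close> laid out from position \<open>k + 1\<close> on;
  it occupies \<open>2^h (w + 1) - 1\<close> positions.\<close>

primrec build :: "nat \<Rightarrow> nat \<Rightarrow> nat \<Rightarrow> 'a rank_tree" where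
  "build w 0 k = Block k []"
| "build w (Suc h) k =
     Node (build w h k) (k + 2 ^ h * (w + 1)) None (build w h (k + 2 ^ h * (w + 1)))"

primrec layout :: "nat \<Rightarrow> 'a rank_tree \<Rightarrow> nat list" where
  "layout w (Block k bs) = [Suc k..<Suc (k + w)]"
| "layout w (Node l p c r) = layout w l @ [p] @ layout w r"

lemma layout_build: "layout w (build w h k) = [Suc k..<k + 2 ^ h * (w + 1)]"
proof (induction h arbitrary: k)
  case (Suc h)
  define d where "d = 2 ^ h * (w + 1)"
  have dd: "2 ^ Suc h * (w + 1) = 2 * d" by (simp add: d_def)
  have "d > 0" by (simp add: d_def)
  have "[Suc k..<k + 2 * d] = [Suc k..<k + d] @ [k + d..<k + 2 * d]"
    using \<open>d > 0\<close> upt_add_eq_append[of "Suc k" "k + d" d] by (simp add: mult_2 add.assoc)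
  also have "[k + d..<k + 2 * d] = (k + d) # [Suc (k + d)..<k + 2 * d]"
    using \<open>d > 0\<close> by (intro upt_conv_Cons) simp
  finally show ?case
    unfolding build.simps layout.simps dd d_def[symmetric] Suc by (simp add: mult_2 add.assoc)
qed simp

datatype 'a destination = At_Node nat | At_Leaf nat "'a list"

fun descend :: "'a::linorder \<Rightarrow> 'a rank_tree \<Rightarrow> 'a rank_tree \<times> 'a destination" where
  "descend x (Block k bs) = (Block k (bs @ [x]), At_Leaf k bs)"
| "descend x (Node l p None r) = (Node l p (Some x) r, At_Node p)"
| "descend x (Node l p (Some y) r) =
     (if x < y then (case descend x l of (l', d) \<Rightarrow> (Node l' p (Some y) r, d))
      else (case descend x r of (r', d) \<Rightarrow> (Node l p (Some y) r', d)))"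

text \<open>\<open>xs\<close> are the elements that arrived before \<open>x\<close> and \<open>ps\<close> their positions.  An arbitrary
  placement may have used a position belonging to another part of the tree; hence a position counts
  as free only if it is unused altogether, and an element whose node's position is gone is placed
  arbitrarily as well.\<close>

definition place ::
    "choice_rule \<Rightarrow> nat \<Rightarrow> nat \<Rightarrow> 'a::linorder list \<Rightarrow> nat list \<Rightarrow> 'a \<Rightarrow> 'a destination \<Rightarrow> nat pmf"
where
  "place ch m w xs ps x d =
     (let pick = ch (comparisons (xs @ [x])) ps;
          arbitrary_free = pick ({1..m} - set ps)
      in case d of
           At_Node p \<Rightarrow> if p \<in> set ps then arbitrary_free else return_pmf p
         | At_Leaf k bs \<Rightarrow>
             (let R = {k+1..k+w} - set ps
              in if R = {} then arbitrary_free else dense_ranking pick w k R bs x))"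

primrec run ::
    "choice_rule \<Rightarrow> nat \<Rightarrow> nat \<Rightarrow> 'a::linorder list \<Rightarrow> 'a rank_tree \<Rightarrow> 'a list \<Rightarrow> nat list
      \<Rightarrow> nat list pmf"
where
  "run ch m w [] t xs ps = return_pmf ps"
| "run ch m w (y # ys) t xs ps = (case descend y t of (t', d) \<Rightarrow> do {
     p \<leftarrow> place ch m w xs ps y d;
     run ch m w ys t' (xs @ [y]) (ps @ [p])
   })"

text \<open>The distribution of the list of positions assigned to the elements of \<open>xs\<close>, which arrive in
  this order.  The block size \<open>m/2^h - 1\<close> is rounded down.\<close>

definition general_ranking ::
    "choice_rule \<Rightarrow> nat \<Rightarrow> nat \<Rightarrow> 'a::linorder list \<Rightarrow> nat list pmf" where
  "general_ranking ch m h xs =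
     (let w = m div 2 ^ h - 1 in run ch m w xs (build w h 0) [] [])"

definition inversions :: "'a::linorder list \<Rightarrow> nat list \<Rightarrow> nat" where
  "inversions xs ps =
     card {(i, j). i < length xs \<and> j < length xs \<and> xs ! i < xs ! j \<and> ps ! i > ps ! j}"

definition expected_inversions ::
    "choice_rule \<Rightarrow> nat \<Rightarrow> nat \<Rightarrow> 'a::linorder set \<Rightarrow> real" where
  "expected_inversions ch m h V = measure_pmf.expectation
     (do {
        xs \<leftarrow> pmf_of_set (permutations_of_set V);
        ps \<leftarrow> general_ranking ch m h xs;
        return_pmf (inversions xs ps)
      }) real"

text \<open>The height \<open>\<alpha> ln (n^g(\<alpha>))\<close>, rounded down.  If \<open>2^h > m\<close>, there are not enough positions for
  the internal nodes of a tree of height \<open>h\<close> (the prescribed block size \<open>m/2^h - 1\<close> is negative);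
  in this degenerate case, which occurs only for very large \<open>m\<close>, the largest \<open>h\<close> with
  \<open>2^h \<le> m\<close> is used instead.\<close>

definition tree_height :: "nat \<Rightarrow> nat \<Rightarrow> real \<Rightarrow> nat" where
  "tree_height n m a =
     min (nat \<lfloor>a * ln (real n powr g_exp a)\<rfloor>) (nat \<lfloor>log 2 (real m)\<rfloor>)"

end

theory Submission
  imports Defs
begin

text \<open>Since the arrival order is uniform, the rank of a new element among its predecessors is uniform and
  independent of everything that the algorithm has done so far.  In particular the targets of a
  Dense Ranking instance are uniform on its block.  As long as no leaf receives more than
  \<open>M = \<lfloor>w/7\<rfloor>\<close> elements, all inversions are between elements of the same leaf.

  With \<open>\<alpha> - 1\<close> as exponent \<open>s\<close>, the expected sum of the \<open>s\<close>-th powers of the leaf sizes is at most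
  \<open>n^s (2/(s+1))^h\<close>, and \<open>\<alpha>\<close> is chosen such that the resulting probability of an overflow times \<open>n^2\<close>
  is the claimed bound.  (If \<open>g > 1\<close>, the exponent \<open>2e - 1\<close> shows in the same way that with sufficient
  probability no element reaches a leaf at all.)

  Without overflow, occupied runs have logarithmic length, so an element is placed close to its
  target.  The relative rank of an element in its leaf is a martingale (a Polya urn), so its position
  differs from its current rank by \<open>O(1/sqrt k)\<close> of the block in quadratic mean, \<open>k\<close> being the number
  of elements of the leaf.  A new element of uniform rank therefore creates about \<open>sqrt M\<close> inversions,
  \<open>n sqrt M\<close> in total.\<close>

text \<open>The obstacle is the choice rule: it may depend on all comparisons and positions so far,
  so the set of free positions has no tractable law. Only two facts about a step are used: the rank
  of the new element is uniform given the whole past, and its position is some free position nearest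
  to the target. Bounds are therefore taken over all nearest positions at once, and every estimate
  is a one-step drift inequality for a sum over the leaves. The 7 in \<open>M\<close>: a filled run
  of length l has weight 8^l. It must pay e^l for the union over intervals and (1 + 7 l/w)^M \<le>
  e^l for the normalisation, and e^2 \<le> 8. The exponent s = \<alpha> - 1: with h about \<alpha> g
  ln n and leaf capacity about n^(1-g), the moment bound for an overflow, times n^2, is n to the
  power 2 + g s - \<alpha> g ln((s+1)/2). This is minimal at s + 1 = \<alpha>, with value 2 - g + g
  \<alpha> ln(2e/\<alpha>), which is 3/2 - g/2 by the definition of g. As n sqrt M has the same
  exponent, overflow and inversions within leaves are balanced.\<close>

lemma expectation_bind_finite:
  fixes f :: "'b \<Rightarrow> real"
  assumes "finite (set_pmf M)" "\<And>x. x \<in> set_pmf M \<Longrightarrow> finite (set_pmf (N x))"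
  shows "measure_pmf.expectation (bind_pmf M N) f =
    measure_pmf.expectation M (\<lambda>x. measure_pmf.expectation (N x) f)"
  using assms by (subst pmf_expectation_bind[of "set_pmf M"])
    (auto simp: integral_measure_pmf[of "set_pmf M"])

lemma expectation_mono_finite:
  fixes f g :: "'b \<Rightarrow> real"
  assumes "finite (set_pmf M)" "\<And>x. x \<in> set_pmf M \<Longrightarrow> f x \<le> g x"
  shows "measure_pmf.expectation M f \<le> measure_pmf.expectation M g"
  using assms by (intro integral_mono_AE integrable_measure_pmf_finite) (auto simp: AE_measure_pmf_iff)

lemma expectation_cong_pmf:
  fixes f g :: "'b \<Rightarrow> real"
  assumes "\<And>x. x \<in> set_pmf M \<Longrightarrow> f x = g x"
  shows "measure_pmf.expectation M f = measure_pmf.expectation M g"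
  using assms by (intro integral_cong_AE) (auto simp: AE_measure_pmf_iff)

lemma expectation_add_finite:
  fixes f g :: "'b \<Rightarrow> real"
  assumes "finite (set_pmf M)"
  shows "measure_pmf.expectation M (\<lambda>x. f x + g x) = measure_pmf.expectation M f + measure_pmf.expectation M g"
  using assms by (intro Bochner_Integration.integral_add integrable_measure_pmf_finite)

lemma expectation_sum_finite:
  fixes f :: "'a \<Rightarrow> 'b \<Rightarrow> real"
  assumes "finite (set_pmf M)"
  shows "measure_pmf.expectation M (\<lambda>x. \<Sum>i\<in>I. f i x) = (\<Sum>i\<in>I. measure_pmf.expectation M (f i))"
  using assms by (intro Bochner_Integration.integral_sum integrable_measure_pmf_finite)

section \<open>The target of Dense Ranking\<close>

text \<open>\<open>cl\<close> clamps to \<open>[a, b]\<close>, so the part of the sampling interval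
  inside \<open>{a<..b}\<close> has length at most a difference of two values of \<open>cl\<close>.
  In this form the bounds for consecutive ranks telescope.\<close>

lemma prob_dense_target_le:
  fixes a b :: int
  assumes "w > 0" "s > 0" "a \<le> b"
  defines "cl \<equiv> (\<lambda>x::real. max (real_of_int a) (min (real_of_int b) x))"
  shows "measure_pmf.prob (dense_target w s r) {a<..b} \<le>
    (cl ((real r + 1) * (real w / real s)) - cl (real r * (real w / real s))) / (real w / real s)"
proof -
  define c d where "c = real r * (real w / real s)" and "d = (real r + 1) * (real w / real s)"
  have ws: "real w / real s > 0" using assms by simp
  have cd: "c < d" "d - c = real w / real s"
    using ws unfolding c_def d_def distrib_right by linarith+
  have clmono: "cl x \<le> cl y" if "x \<le> y" for x y
    using that unfolding cl_def by auto
  have vim: "ceiling -` {a<..b} = {real_of_int a<..real_of_int b}"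
    by (auto simp: less_ceiling_iff ceiling_le_iff)
  have em: "emeasure lborel {c..d} = ennreal (d - c)" using cd by simp
  have "measure_pmf.prob (dense_target w s r) {a<..b} =
      measure (distr (uniform_measure lborel {c..d}) (count_space UNIV) ceiling) {a<..b}"
    using assms by (simp add: measure_pmf_dense_target c_def d_def)
  also have "\<dots> = measure (uniform_measure lborel {c..d}) {real_of_int a<..real_of_int b}"
    by (subst measure_distr) (auto simp: vim)
  also have "\<dots> = measure lborel ({c..d} \<inter> {real_of_int a<..real_of_int b}) / measure lborel {c..d}"
    using em cd assms by (subst measure_uniform_measure) auto
  also have "\<dots> \<le> measure lborel {cl c..cl d} / measure lborel {c..d}"
  proof (intro divide_right_mono measure_mono_fmeasurable)
    show "{c..d} \<inter> {real_of_int a<..real_of_int b} \<subseteq> {cl c..cl d}"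
    proof
      fix x assume x: "x \<in> {c..d} \<inter> {real_of_int a<..real_of_int b}"
      then have "cl x = x" unfolding cl_def by auto
      with x clmono[of c x] clmono[of x d] show "x \<in> {cl c..cl d}" by auto
    qed
    show "{cl c..cl d} \<in> fmeasurable lborel"
      by (intro fmeasurableI) (auto simp: emeasure_lborel_Icc_eq)
  qed auto
  also have "\<dots> = (cl d - cl c) / (real w / real s)"
    using cd clmono[of c d] by simp
  finally show ?thesis unfolding c_def d_def .
qed

text \<open>A value of positive probability needs \<open>(z - 1, z]\<close> to meet the sampling
  interval in positive length, so both inequalities are strict. In particular the null event that
  the sample is 0 does not produce the target 0.\<close>

lemma set_dense_target:
  assumes "w > 0" "s > 0" "z \<in> set_pmf (dense_target w s r)"
  shows "real r * (real w / real s) < z" "real_of_int z - 1 < (real r + 1) * (real w / real s)"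
proof -
  define c d where "c = real r * (real w / real s)" and "d = (real r + 1) * (real w / real s)"
  have ws: "real w / real s > 0" using assms by simp
  have cd: "c < d" using ws unfolding c_def d_def distrib_right by linarith
  have "measure_pmf.prob (dense_target w s r) {z - 1<..z} > 0"
  proof -
    have "{z - 1<..z} = {z}" by auto
    then show ?thesis using assms(3) by (simp add: measure_pmf_single pmf_positive)
  qed
  moreover note prob_dense_target_le[OF assms(1,2), of "z - 1" z r]
  ultimately have "(max (real_of_int (z-1)) (min (real_of_int z) d) - max (real_of_int (z-1)) (min (real_of_int z) c)) / (real w / real s) > 0"
    unfolding c_def d_def by (simp del: zero_less_divide_iff)
  then have "max (real_of_int (z-1)) (min (real_of_int z) d) > max (real_of_int (z-1)) (min (real_of_int z) c)"
    using ws by (metis diff_gt_0_iff_gt not_less_iff_gr_or_eq zero_less_divide_iff)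
  then have "c < z" "z - 1 < d" by (auto simp: max_def min_def split: if_splits)
  then show "real r * (real w / real s) < z" "real_of_int z - 1 < (real r + 1) * (real w / real s)"
    unfolding c_def d_def by auto
qed

lemma set_dense_target_range:
  assumes "w > 0" "r < s" "z \<in> set_pmf (dense_target w s r)"
  shows "1 \<le> z" "z \<le> int w"
proof -
  have s: "s > 0" using assms by simp
  note * = set_dense_target[OF assms(1) s assms(3)]
  have "0 \<le> real r * (real w / real s)" by simp
  with *(1) show "1 \<le> z" by linarith
  have "(real r + 1) * (real w / real s) \<le> real s * (real w / real s)"
    using assms by (intro mult_right_mono) auto
  also have "\<dots> = real w" using s by simp
  finally show "z \<le> int w" using *(2) by linarith
qed

lemma finite_set_dense_target:
  assumes "w > 0" "r < s"
  shows "finite (set_pmf (dense_target w s r))"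
  by (rule finite_subset[of _ "{1..int w}"]) (use set_dense_target_range[OF assms] in auto)

text \<open>The sampling intervals of the ranks \<open>0..K\<close> tile \<open>[0, w]\<close>, so
  under a uniform rank the target is uniform on the block.\<close>

lemma sum_prob_dense_target_le:
  fixes a b :: int
  assumes "w > 0" "a \<le> b"
  shows "(\<Sum>q\<le>K. measure_pmf.prob (dense_target w (Suc K) q) {a<..b}) \<le> (real K + 1) * (real_of_int (b - a) / real w)"
proof -
  define cl where "cl = (\<lambda>x::real. max (real_of_int a) (min (real_of_int b) x))"
  define v where "v = real w / real (Suc K)"
  have v: "v > 0" using assms by (simp add: v_def)
  have "(\<Sum>q\<le>K. measure_pmf.prob (dense_target w (Suc K) q) {a<..b}) \<le>
      (\<Sum>q\<le>K. (cl (real (Suc q) * v) - cl (real q * v)) / v)"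
    using prob_dense_target_le[OF assms(1) _ assms(2), of "Suc K"]
    unfolding cl_def v_def by (intro sum_mono) (simp add: add_ac)
  also have "\<dots> = (\<Sum>q<Suc K. cl (real (Suc q) * v) - cl (real q * v)) / v"
    by (simp add: sum_divide_distrib lessThan_Suc_atMost)
  also have "\<dots> = (cl (real (Suc K) * v) - cl (real 0 * v)) / v"
    by (subst sum_lessThan_telescope) simp
  also have "\<dots> \<le> real_of_int (b - a) / v"
    using v assms(2) unfolding cl_def by (intro divide_right_mono) (auto simp: max_def min_def)
  also have "\<dots> = (real K + 1) * (real_of_int (b - a) / real w)"
    by (simp add: v_def field_simps)
  finally show ?thesis .
qed

section \<open>The arrival process as a Markov chain\<close>

definition grow :: "'a::linorder list \<Rightarrow> 'a rank_tree \<Rightarrow> 'a rank_tree" where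
  "grow xs t = fold (\<lambda>x t. fst (descend x t)) xs t"

lemma grow_simps [simp]:
  "grow [] t = t"
  "grow (x # xs) t = grow xs (fst (descend x t))"
  "grow (xs @ ys) t = grow ys (grow xs t)"
  by (auto simp: grow_def)

text \<open>\<open>run\<close> recurses from the first arrival, whereas the Markov chain needs the
  last one split off.\<close>

lemma run_snoc:
  assumes "us = xs @ ys"
  shows "run ch m w (ys @ [y]) t xs ps = do {
     qs \<leftarrow> run ch m w ys t xs ps;
     p \<leftarrow> place ch m w us qs y (snd (descend y (grow ys t)));
     return_pmf (qs @ [p]) }"
  using assms
proof (induction ys arbitrary: t xs ps)
  case Nil
  then show ?case
    by (cases "descend y t") (simp only: append.simps run.simps split_conv bind_return_pmf grow_simps snd_conv append_Nil2)
next
  case (Cons z ys)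
  obtain t' d where td: "descend z t = (t', d)" by fastforce
  have us: "us = (xs @ [z]) @ ys" using Cons.prems by simp
  show ?case
    unfolding append.simps run.simps td split_conv bind_assoc_pmf Cons.IH[OF us] grow_simps fst_conv ..
qed

lemma set_descend [simp]: "set_rank_tree (fst (descend x t)) = insert x (set_rank_tree t)"
proof (induction t)
  case (Block k bs)
  show ?case by simp
next
  case (Node l p c r)
  show ?case
  proof (cases c)
    case (Some y)
    then show ?thesis using Node by (auto simp: case_prod_unfold)
  qed auto
qed

lemma set_destination_descend: "set_destination (snd (descend x t)) \<subseteq> set_rank_tree t"
proof (induction t)
  case (Node l p c r)
  then show ?case
    by (cases c) (auto simp: case_prod_unfold)
qed simp

lemma set_grow [simp]: "set_rank_tree (grow xs t) = set xs \<union> set_rank_tree t"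
  by (induction xs arbitrary: t) auto

lemma set_build [simp]: "set_rank_tree (build w h k) = {}"
  by (induction h arbitrary: k) auto

lemma map_build [simp]: "map_rank_tree f (build w h k) = build w h k"
  by (induction h arbitrary: k) auto

section \<open>Invariance of the algorithm under order-preserving relabelling\<close>

lemma strict_mono_on_less_iff:
  fixes f :: "'a::linorder \<Rightarrow> 'b::linorder"
  assumes "strict_mono_on A f" "x \<in> A" "y \<in> A"
  shows "f x < f y \<longleftrightarrow> x < y"
  using assms strict_mono_on_less by blast

lemma descend_map:
  fixes f :: "'a::linorder \<Rightarrow> 'b::linorder"
  assumes "strict_mono_on A f" "x \<in> A" "set_rank_tree t \<subseteq> A"
  shows "descend (f x) (map_rank_tree f t) =
    map_prod (map_rank_tree f) (map_destination f) (descend x t)"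
  using assms(2,3)
proof (induction x t rule: descend.induct)
  case (3 x l p y r)
  then show ?case
    using strict_mono_on_less_iff[OF assms(1), of x y] by (auto simp: case_prod_unfold map_prod_def)
qed auto

lemma comparisons_map:
  fixes f :: "'a::linorder \<Rightarrow> 'b::linorder"
  assumes "strict_mono_on (set xs) f"
  shows "comparisons (map f xs) = comparisons xs"
  unfolding comparisons_def length_map
proof (rule map_cong[OF refl])
  fix i assume "i \<in> set [0..<length xs]"
  then have i: "i < length xs" by simp
  then have "{j. j < i \<and> map f xs ! j < map f xs ! i} = {j. j < i \<and> xs ! j < xs ! i}"
    using strict_mono_on_less_iff[OF assms] by auto
  then show "card {j. j < i \<and> map f xs ! j < map f xs ! i} = card {j. j < i \<and> xs ! j < xs ! i}"
    by simp
qed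

lemma card_less_image:
  fixes f :: "'a::linorder \<Rightarrow> 'b::linorder"
  assumes "strict_mono_on A f" "B \<subseteq> A" "x \<in> A"
  shows "card {y \<in> f ` B. y < f x} = card {y \<in> B. y < x}"
proof -
  have "{y \<in> f ` B. y < f x} = f ` {y \<in> B. y < x}"
    using assms strict_mono_on_less_iff[OF assms(1)] by auto
  moreover have "inj_on f {y \<in> B. y < x}"
    using strict_mono_on_imp_inj_on[OF assms(1)] assms(2) by (auto intro: inj_on_subset)
  ultimately show ?thesis by (simp add: card_image)
qed

lemma place_map:
  fixes f :: "'a::linorder \<Rightarrow> 'b::linorder"
  assumes "strict_mono_on A f" "insert x (set xs) \<subseteq> A" "set_destination d \<subseteq> A"
  shows "place ch m w (map f xs) ps (f x) (map_destination f d) = place ch m w xs ps x d"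
proof -
  have "comparisons (map f xs @ [f x]) = comparisons (xs @ [x])"
    using comparisons_map[of "xs @ [x]" f] assms(1,2) by (auto intro: monotone_on_subset)
  then show ?thesis
    using assms card_less_image[OF assms(1), of _ x]
    by (cases d) (auto simp: place_def Let_def dense_ranking_def)
qed

lemma run_map:
  fixes f :: "'a::linorder \<Rightarrow> 'b::linorder"
  assumes "strict_mono_on A f" "set ys \<subseteq> A" "set xs \<subseteq> A" "set_rank_tree t \<subseteq> A"
  shows "run ch m w (map f ys) (map_rank_tree f t) (map f xs) ps = run ch m w ys t xs ps"
  using assms(2-)
proof (induction ys arbitrary: t xs ps)
  case (Cons y ys)
  obtain t' d where td: "descend y t = (t', d)" by fastforce
  have t': "set_rank_tree t' \<subseteq> A"
    using set_descend[of y t] Cons.prems td by auto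
  have d: "set_destination d \<subseteq> A"
    using set_destination_descend[of y t] Cons.prems td by auto
  have "run ch m w (map f ys) (map_rank_tree f t') (map f xs @ [f y]) qs = run ch m w ys t' (xs @ [y]) qs" for qs
    using Cons.IH[of "xs @ [y]" t' qs] Cons.prems t' by simp
  moreover have "place ch m w (map f xs) ps (f y) (map_destination f d) = place ch m w xs ps y d"
    using Cons.prems d by (intro place_map[OF assms(1)]) auto
  ultimately show ?case
    using descend_map[OF assms(1), of y t] Cons.prems td by simp
qed auto

lemma general_ranking_map:
  fixes f :: "'a::linorder \<Rightarrow> 'b::linorder"
  assumes "strict_mono_on (set xs) f"
  shows "general_ranking ch m h (map f xs) = general_ranking ch m h xs"
  using run_map[OF assms, of xs "[]" "build (m div 2 ^ h - 1) h 0" ch m _ "[]"]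
  by (simp add: general_ranking_def Let_def)

lemma inversions_map:
  fixes f :: "'a::linorder \<Rightarrow> 'b::linorder"
  assumes "strict_mono_on (set xs) f"
  shows "inversions (map f xs) ps = inversions xs ps"
  unfolding inversions_def
  by (rule arg_cong[where f = card]) (auto simp: strict_mono_on_less_iff[OF assms])

section \<open>Random arrival orders and the rank of the newest arrival\<close>

definition joint :: "choice_rule \<Rightarrow> nat \<Rightarrow> nat \<Rightarrow> nat \<Rightarrow> (nat list \<times> nat list) pmf" where
  "joint ch m h t = do {
     xs \<leftarrow> pmf_of_set (permutations_of_set {0..<t});
     ps \<leftarrow> general_ranking ch m h xs;
     return_pmf (xs, ps) }"

text \<open>Relabelling by the increasing enumeration of \<open>V\<close>: the algorithm and the
  number of inversions see only the order of the elements.\<close>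

lemma expected_inversions_joint:
  fixes V :: "'a::linorder set"
  assumes "finite V" "card V = n"
  shows "expected_inversions ch m h V =
    measure_pmf.expectation (joint ch m h n) (\<lambda>(xs, ps). real (inversions xs ps))"
proof -
  define f where "f = (!) (sorted_list_of_set V)"
  have len: "length (sorted_list_of_set V) = n" using assms by simp
  have mono: "strict_mono_on {0..<n} f"
    unfolding f_def using assms len
    by (intro strict_mono_onI) (auto intro: sorted_wrt_nth_less[OF strict_sorted_list_of_set])
  have img: "V = f ` {0..<n}"
    using assms(1) len nth_image[of n "sorted_list_of_set V"] unfolding f_def
    by (simp add: atLeast0LessThan)
  have inj: "inj_on f {0..<n}" by (rule strict_mono_on_imp_inj_on[OF mono])
  have inj': "inj_on (map f) (permutations_of_set {0..<n})"
  proof (rule inj_on_subset[OF inj_on_mapI])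
    show "inj_on f (\<Union> (set ` permutations_of_set {0..<n}))"
      by (rule inj_on_subset[OF inj]) (auto simp: permutations_of_set_def)
  qed simp
  have P: "pmf_of_set (permutations_of_set V) = map_pmf (map f) (pmf_of_set (permutations_of_set {0..<n}))"
    unfolding img permutations_of_set_image_inj[OF inj]
    by (rule map_pmf_of_set_inj[symmetric]) (use inj' in auto)
  have "do {
        xs \<leftarrow> pmf_of_set (permutations_of_set V);
        ps \<leftarrow> general_ranking ch m h xs;
        return_pmf (inversions xs ps) } = do {
        xs \<leftarrow> pmf_of_set (permutations_of_set {0..<n});
        ps \<leftarrow> general_ranking ch m h (map f xs);
        return_pmf (inversions (map f xs) ps) }"
    unfolding P bind_map_pmf by simp
  also have "\<dots> = do {
        xs \<leftarrow> pmf_of_set (permutations_of_set {0..<n});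
        ps \<leftarrow> general_ranking ch m h xs;
        return_pmf (inversions xs ps) }"
  proof (rule bind_pmf_cong[OF refl])
    fix xs assume "xs \<in> set_pmf (pmf_of_set (permutations_of_set {0..<n}))"
    then have "set xs = {0..<n}" by (auto dest: permutations_of_setD)
    then have "strict_mono_on (set xs) f" using mono by simp
    then show "general_ranking ch m h (map f xs) \<bind> (\<lambda>ps. return_pmf (inversions (map f xs) ps)) =
       general_ranking ch m h xs \<bind> (\<lambda>ps. return_pmf (inversions xs ps))"
      by (simp add: general_ranking_map inversions_map)
  qed
  also have "\<dots> = map_pmf (\<lambda>(xs, ps). inversions xs ps) (joint ch m h n)"
    by (simp add: joint_def map_bind_pmf)
  finally show ?thesis
    unfolding expected_inversions_def by (simp add: case_prod_unfold)
qed

text \<open>The order embedding that skips exactly \<open>r\<close>. In \<open>joint\<close> an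
  element is represented by its rank among the arrivals so far, so an arrival of rank
  \<open>r\<close> renumbers all earlier ones by this map.\<close>

definition shift :: "nat \<Rightarrow> nat \<Rightarrow> nat" where
  "shift r x = (if x < r then x else Suc x)"

lemma strict_mono_on_shift: "strict_mono_on A (shift r)"
  by (auto intro!: strict_mono_onI simp: shift_def)

lemma shift_image:
  assumes "r \<le> t"
  shows "shift r ` {0..<t} = {0..<Suc t} - {r}"
proof -
  have *: "x \<in> shift r ` {0..<t}" if "x < Suc t" "x \<noteq> r" for x
    using that assms by (intro image_eqI[of _ _ "if x < r then x else x - 1"]) (auto simp: shift_def)
  have "{0..<Suc t} - {r} \<subseteq> shift r ` {0..<t}"
    by (intro subsetI *) simp_all
  moreover have "shift r ` {0..<t} \<subseteq> {0..<Suc t} - {r}" by (auto simp: shift_def)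
  ultimately show ?thesis by blast
qed

text \<open>The relative rank of the last arrival is uniform and independent of the relative order
  of the others. All use of the random arrival order in the step analysis goes through this
  fact.\<close>

lemma random_permutation_snoc:
  "pmf_of_set (permutations_of_set {0..<Suc t}) = do {
     xs \<leftarrow> pmf_of_set (permutations_of_set {0..<t});
     r \<leftarrow> pmf_of_set {0..t};
     return_pmf (map (shift r) xs @ [r]) }"
proof -
  have rev: "map_pmf rev (pmf_of_set (permutations_of_set A)) = pmf_of_set (permutations_of_set A)"
    if "finite A" for A :: "nat set"
    using that by (intro map_pmf_of_set_bij_betw) (auto simp: bij_betw_def)
  have sh: "pmf_of_set (permutations_of_set ({0..<Suc t} - {r})) =
      map_pmf (map (shift r)) (pmf_of_set (permutations_of_set {0..<t}))" if "r \<in> {0..t}" for r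
  proof -
    have inj: "inj (shift r)" by (auto simp: inj_def shift_def split: if_splits)
    have "map (shift r) ` permutations_of_set {0..<t} = permutations_of_set ({0..<Suc t} - {r})"
      using that shift_image[of r t] by (subst permutations_of_set_image_inj[symmetric])
        (auto intro: inj_on_subset[OF inj])
    then show ?thesis
      by (subst map_pmf_of_set_inj) (auto intro: inj_on_subset[OF inj_mapI[OF inj]])
  qed
  \<comment> \<open>\<open>random_permutation_of_set\<close> splits off the first element, so the
    uniform permutation is reversed before and after.\<close>
  have "pmf_of_set (permutations_of_set {0..<Suc t}) = map_pmf rev (do {
     r \<leftarrow> pmf_of_set {0..<Suc t};
     xs \<leftarrow> pmf_of_set (permutations_of_set ({0..<Suc t} - {r}));
     return_pmf (r # xs) })"
    by (subst random_permutation_of_set[symmetric]) (simp_all add: rev)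
  also have "\<dots> = do {
     r \<leftarrow> pmf_of_set {0..t};
     xs \<leftarrow> pmf_of_set (permutations_of_set ({0..<Suc t} - {r}));
     return_pmf (rev (r # xs)) }"
    by (simp add: map_bind_pmf atLeastLessThanSuc_atLeastAtMost)
  also have "\<dots> = do {
     r \<leftarrow> pmf_of_set {0..t};
     xs \<leftarrow> pmf_of_set (permutations_of_set {0..<t});
     return_pmf (map (shift r) (rev xs) @ [r]) }"
  proof (rule bind_pmf_cong[OF refl])
    fix r assume "r \<in> set_pmf (pmf_of_set {0..t})"
    then have "r \<in> {0..t}" by simp
    then show "do {
        xs \<leftarrow> pmf_of_set (permutations_of_set ({0..<Suc t} - {r}));
        return_pmf (rev (r # xs)) } = do {
        xs \<leftarrow> pmf_of_set (permutations_of_set {0..<t});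
        return_pmf (map (shift r) (rev xs) @ [r]) }"
      by (simp only: sh bind_map_pmf rev_map rev.simps)
  qed
  also have "\<dots> = do {
     r \<leftarrow> pmf_of_set {0..t};
     xs \<leftarrow> map_pmf rev (pmf_of_set (permutations_of_set {0..<t}));
     return_pmf (map (shift r) xs @ [r]) }"
    by (simp add: bind_map_pmf)
  also have "\<dots> = do {
     xs \<leftarrow> pmf_of_set (permutations_of_set {0..<t});
     r \<leftarrow> pmf_of_set {0..t};
     return_pmf (map (shift r) xs @ [r]) }"
    unfolding rev[OF finite_atLeastLessThan] by (rule bind_commute_pmf)
  finally show ?thesis .
qed

lemma grow_map:
  fixes f :: "'a::linorder \<Rightarrow> 'b::linorder"
  assumes "strict_mono_on UNIV f"
  shows "grow (map f xs) (map_rank_tree f t) = map_rank_tree f (grow xs t)"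
  by (induction xs arbitrary: t)
    (auto simp: descend_map[OF assms] fst_map_prod)

text \<open>The rank \<open>r\<close> may be drawn after the positions \<open>ps\<close>, because
  these depend only on the relative order of the earlier arrivals. Hence it is uniform given
  everything the algorithm has done.\<close>

lemma joint_Suc:
  fixes m h :: nat
  defines "w \<equiv> m div 2 ^ h - 1"
  shows "joint ch m h (Suc t) = do {
     (xs, ps) \<leftarrow> joint ch m h t;
     r \<leftarrow> pmf_of_set {0..t};
     p \<leftarrow> place ch m w (map (shift r) xs) ps r
           (snd (descend r (map_rank_tree (shift r) (grow xs (build w h 0)))));
     return_pmf (map (shift r) xs @ [r], ps @ [p]) }"
proof -
  have *: "general_ranking ch m h (map (shift r) xs @ [r]) = do {
      ps \<leftarrow> general_ranking ch m h xs;
      p \<leftarrow> place ch m w (map (shift r) xs) ps r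
           (snd (descend r (map_rank_tree (shift r) (grow xs (build w h 0)))));
      return_pmf (ps @ [p]) }" for r xs
  proof -
    have "general_ranking ch m h (map (shift r) xs @ [r]) = do {
      ps \<leftarrow> general_ranking ch m h (map (shift r) xs);
      p \<leftarrow> place ch m w (map (shift r) xs) ps r
           (snd (descend r (grow (map (shift r) xs) (build w h 0))));
      return_pmf (ps @ [p]) }"
      by (simp add: general_ranking_def run_snoc[OF append_Nil[symmetric]] Let_def w_def)
    then show ?thesis
      using grow_map[OF strict_mono_on_shift, of r xs "build w h 0"]
        general_ranking_map[OF strict_mono_on_shift] by simp
  qed
  have "joint ch m h (Suc t) = do {
     xs \<leftarrow> pmf_of_set (permutations_of_set {0..<t});
     r \<leftarrow> pmf_of_set {0..t};
     ps \<leftarrow> general_ranking ch m h xs;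
     p \<leftarrow> place ch m w (map (shift r) xs) ps r
           (snd (descend r (map_rank_tree (shift r) (grow xs (build w h 0)))));
     return_pmf (map (shift r) xs @ [r], ps @ [p]) }"
    unfolding joint_def random_permutation_snoc bind_assoc_pmf bind_return_pmf * ..
  also have "\<dots> = do {
     xs \<leftarrow> pmf_of_set (permutations_of_set {0..<t});
     ps \<leftarrow> general_ranking ch m h xs;
     r \<leftarrow> pmf_of_set {0..t};
     p \<leftarrow> place ch m w (map (shift r) xs) ps r
           (snd (descend r (map_rank_tree (shift r) (grow xs (build w h 0)))));
     return_pmf (map (shift r) xs @ [r], ps @ [p]) }"
    by (rule bind_pmf_cong[OF refl]) (rule bind_commute_pmf)
  finally show ?thesis
    unfolding joint_def bind_assoc_pmf bind_return_pmf split_conv .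
qed

section \<open>Position trees\<close>

definition ins_at :: "nat \<Rightarrow> 'b \<Rightarrow> 'b list \<Rightarrow> 'b list" where
  "ins_at q p c = take q c @ p # drop q c"

lemma length_ins_at [simp]: "length (ins_at q p c) = Suc (length c)"
  by (simp add: ins_at_def)

lemma set_ins_at [simp]: "set (ins_at q p c) = insert p (set c)"
proof -
  have "set c = set (take q c) \<union> set (drop q c)"
    by (metis append_take_drop_id set_append)
  then show ?thesis by (auto simp: ins_at_def)
qed

lemma distinct_ins_at [simp]: "distinct (ins_at q p c) \<longleftrightarrow> p \<notin> set c \<and> distinct c"
proof -
  have "distinct (ins_at q p c) \<longleftrightarrow> distinct (p # take q c @ drop q c)"
    by (auto simp: ins_at_def simp del: append_take_drop_id)
  then show ?thesis by simp
qed

text \<open>A tree in which each leaf records the offset of its block and the positions of its elements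
  in increasing order of the elements, and each internal node its position and whether it is
  occupied.  It forgets the elements themselves: a new element enters through its rank, that is,
  the gap between consecutive elements into which it falls.\<close>

datatype ptree = PB nat "nat list" | PN ptree nat bool ptree

datatype gap_dest = DN nat | DL nat nat "nat list"

text \<open>Subtrees of an unoccupied node are empty in a well-formed tree, so 0 is the correct
  count there; it also leaves exactly one gap leading to that node.\<close>

primrec psize :: "ptree \<Rightarrow> nat" where
  "psize (PB k c) = length c"
| "psize (PN l q f r) = (if f then psize l + 1 + psize r else 0)"

text \<open>The gap number is the number of smaller elements. With exactly \<open>psize l\<close> of
  them the new element still precedes the element of the node, hence \<open>\<le>\<close>.\<close>

primrec upd :: "nat \<Rightarrow> ptree \<Rightarrow> nat \<Rightarrow> ptree" where
  "upd p (PB k c) = (\<lambda>g. PB k (ins_at g p c))"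
| "upd p (PN l q f r) = (\<lambda>g. if \<not> f then PN l q True r
     else if g \<le> psize l then PN (upd p l g) q True r
     else PN l q True (upd p r (g - psize l - 1)))"

primrec pdest :: "ptree \<Rightarrow> nat \<Rightarrow> gap_dest" where
  "pdest (PB k c) = (\<lambda>g. DL k g c)"
| "pdest (PN l q f r) = (\<lambda>g. if \<not> f then DN q
     else if g \<le> psize l then pdest l g else pdest r (g - psize l - 1))"

primrec flat :: "ptree \<Rightarrow> nat list" where
  "flat (PB k c) = c"
| "flat (PN l q f r) = flat l @ (if f then [q] else []) @ flat r"

primrec leafsum :: "(nat \<Rightarrow> nat list \<Rightarrow> real) \<Rightarrow> ptree \<Rightarrow> real" where
  "leafsum \<phi> (PB k c) = \<phi> k c"
| "leafsum \<phi> (PN l q f r) = leafsum \<phi> l + leafsum \<phi> r"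

text \<open>Only leaves all of whose ancestors are occupied can receive the next element.\<close>

primrec openleafsum :: "(nat \<Rightarrow> nat list \<Rightarrow> real) \<Rightarrow> ptree \<Rightarrow> real" where
  "openleafsum \<phi> (PB k c) = \<phi> k c"
| "openleafsum \<phi> (PN l q f r) = (if f then openleafsum \<phi> l + openleafsum \<phi> r else 0)"

primrec leafall :: "(nat \<Rightarrow> nat list \<Rightarrow> bool) \<Rightarrow> ptree \<Rightarrow> bool" where
  "leafall P (PB k c) = P k c"
| "leafall P (PN l q f r) = (leafall P l \<and> leafall P r)"

fun pwf :: "nat \<Rightarrow> nat \<Rightarrow> nat \<Rightarrow> ptree \<Rightarrow> bool" where
  "pwf w 0 k (PB k' c) \<longleftrightarrow> k' = k \<and> set c \<subseteq> {k+1..k+w} \<and> distinct c"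
| "pwf w (Suc h) k (PN l q f r) \<longleftrightarrow> pwf w h k l \<and> q = k + 2 ^ h * (w + 1) \<and> pwf w h q r \<and>
     (\<not> f \<longrightarrow> flat l = [] \<and> flat r = [])"
| "pwf _ _ _ _ \<longleftrightarrow> False"

lemma pwf_set_flat: "pwf w h k T \<Longrightarrow> set (flat T) \<subseteq> {k<..<k + 2 ^ h * (w + 1)}"
proof (induction w h k T rule: pwf.induct)
  case (2 w h k l q f r)
  define d where "d = 2 ^ h * (w + 1)"
  have "d > 0" by (simp add: d_def)
  have "set (flat l) \<subseteq> {k<..<k+d}" "q = k + d" "set (flat r) \<subseteq> {q<..<q+d}"
    using 2 by (auto simp: d_def)
  moreover have "2 ^ Suc h * (w + 1) = 2 * d" by (simp add: d_def)
  ultimately show ?case using \<open>d > 0\<close> by (cases f) fastforce+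
qed auto

lemma psize_eq_length_flat: "pwf w h k T \<Longrightarrow> psize T = length (flat T)"
  by (induction w h k T rule: pwf.induct) auto

lemma leafall_mono: "leafall P T \<Longrightarrow> (\<And>k c. P k c \<Longrightarrow> Q k c) \<Longrightarrow> leafall Q T"
  by (induction T) auto

text \<open>Leaves only grow, so a leaf property that is inherited by the shorter content can never
  be restored once it is violated.\<close>

lemma leafall_upd:
  assumes "leafall P (upd p T g)" "\<And>k q p c. P k (ins_at q p c) \<Longrightarrow> P k c"
  shows "leafall P T"
  using assms(1) by (induction T arbitrary: g) (auto split: if_splits intro: assms(2))

lemma flat_upd:
  assumes "pwf w h k T" "g \<le> psize T" "\<And>p'. pdest T g = DN p' \<Longrightarrow> p = p'"
  shows "flat (upd p T g) = ins_at g p (flat T)"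
  using assms
proof (induction w h k T arbitrary: g rule: pwf.induct)
  case (2 w h k l q f r)
  have sl: "psize l = length (flat l)" using 2 by (auto simp: psize_eq_length_flat)
  show ?case
  proof (cases "f \<and> \<not> g \<le> psize l")
    case True
    then obtain g' where g': "g = psize l + 1 + g'"
      by (metis le_add_diff_inverse not_less_eq_eq Suc_eq_plus1)
    have "flat (upd p r g') = ins_at g' p (flat r)"
      using 2 True g' by auto
    then show ?thesis using True sl by (simp add: g' ins_at_def)
  qed (use 2 sl in \<open>auto simp: ins_at_def\<close>)
qed auto

lemma pwf_upd:
  assumes "pwf w h k T" "g \<le> psize T" "\<And>k' q c. pdest T g = DL k' q c \<Longrightarrow> p \<in> {k'+1..k'+w} - set c"
  shows "pwf w h k (upd p T g)"
  using assms
  by (induction w h k T arbitrary: g rule: pwf.induct) auto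

lemma pdest_DN:
  assumes "pwf w h k T" "pdest T g = DN p"
  shows "p \<notin> set (flat T) \<and> p \<in> {k<..<k + 2 ^ h * (w + 1)}"
  using assms
proof (induction w h k T arbitrary: g rule: pwf.induct)
  case (2 w h k l q f r)
  define d where "d = 2 ^ h * (w + 1)"
  have "d > 0" and dd: "2 ^ Suc h * (w + 1) = 2 * d" by (simp_all add: d_def)
  have q: "q = k + d" and l: "set (flat l) \<subseteq> {k<..<k+d}" and r: "set (flat r) \<subseteq> {q<..<q+d}"
    using 2 pwf_set_flat[of w h k l] pwf_set_flat[of w h q r] by (auto simp: d_def)
  show ?case
  proof (cases f)
    case True
    show ?thesis
    proof (cases "g \<le> psize l")
      case left: True
      then have "p \<notin> set (flat l) \<and> p \<in> {k<..<k+d}" using 2 True by (auto simp: d_def)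
      then show ?thesis unfolding dd using q r by force
    next
      case False
      then have "p \<notin> set (flat r) \<and> p \<in> {q<..<q+d}" using 2 True by (auto simp: d_def)
      then show ?thesis unfolding dd using q l by force
    qed
  next
    case False
    then show ?thesis unfolding dd using 2 q \<open>d > 0\<close> by auto
  qed
qed auto

text \<open>Blocks and node positions of a well-formed tree are disjoint, so what is occupied inside
  a block is exactly the content of its leaf.\<close>

lemma pdest_DL:
  assumes "pwf w h k T" "pdest T g = DL k' q c" "g \<le> psize T"
  shows "k \<le> k' \<and> k' + w < k + 2 ^ h * (w + 1) \<and> {k'+1..k'+w} \<inter> set (flat T) = set c
    \<and> q \<le> length c \<and> distinct c"
  using assms
proof (induction w h k T arbitrary: g rule: pwf.induct)
  case (2 w h k l p f r)
  define d where "d = 2 ^ h * (w + 1)"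
  have "d > 0" and dd: "2 ^ Suc h * (w + 1) = 2 * d" by (simp_all add: d_def)
  have p: "p = k + d" and l: "set (flat l) \<subseteq> {k<..<k+d}" and r: "set (flat r) \<subseteq> {p<..<p+d}"
    using 2 pwf_set_flat[of w h k l] pwf_set_flat[of w h p r] by (auto simp: d_def)
  have f: f using 2 by (auto split: if_splits)
  show ?case
  proof (cases "g \<le> psize l")
    case True
    then have "k \<le> k' \<and> k' + w < k + d \<and> {k'+1..k'+w} \<inter> set (flat l) = set c
        \<and> q \<le> length c \<and> distinct c" using 2 f by (auto simp: d_def)
    moreover have "{k'+1..k'+w} \<inter> (set (flat r) \<union> {p}) = {}" if "k' + w < k + d"
      using that p r by force
    ultimately show ?thesis unfolding dd using f by auto
  next
    case False
    have "pwf w h p r" "pdest r (g - psize l - 1) = DL k' q c" "g - psize l - 1 \<le> psize r"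
      using 2(3-5) False f by auto
    then have "p \<le> k' \<and> k' + w < p + d \<and> {k'+1..k'+w} \<inter> set (flat r) = set c
        \<and> q \<le> length c \<and> distinct c" unfolding d_def by (rule 2(2))
    moreover have "{k'+1..k'+w} \<inter> (set (flat l) \<union> {p}) = {}" if "p \<le> k'"
      using that p l by force
    ultimately show ?thesis unfolding dd using f p by auto
  qed
qed auto

lemma leafall_pdest:
  assumes "leafall P T" "pdest T g = DL k q c"
  shows "P k c"
  using assms by (induction T arbitrary: g) (auto split: if_splits)

lemma leafsum_upd:
  "leafsum \<phi> (upd p T g) = leafsum \<phi> T +
     (case pdest T g of DN _ \<Rightarrow> 0 | DL k q c \<Rightarrow> \<phi> k (ins_at q p c) - \<phi> k c)"
  by (induction T arbitrary: g) auto

lemma sum_split_atMost: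
  fixes F :: "nat \<Rightarrow> real"
  shows "(\<Sum>g\<le>a + 1 + b. F g) = (\<Sum>g\<le>a. F g) + (\<Sum>g\<le>b. F (a + 1 + g))"
proof -
  have "{..a+1+b} = {..a} \<union> {a+1..a+1+b}" by auto
  then have "(\<Sum>g\<le>a + 1 + b. F g) = (\<Sum>g\<le>a. F g) + (\<Sum>g\<in>{a+1..a+1+b}. F g)"
    by (simp add: sum.union_disjoint)
  also have "(\<Sum>g\<in>{a+1..a+1+b}. F g) = (\<Sum>g\<le>b. F (a + 1 + g))"
    by (rule sum.reindex_bij_witness[of _ "\<lambda>i. a + 1 + i" "\<lambda>i. i - (a + 1)"]) auto
  finally show ?thesis .
qed

text \<open>The \<open>psize T + 1\<close> gaps are divided among the reachable empty nodes, one
  each, and the reachable leaves, a leaf with content \<open>c\<close> owning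
  \<open>length c + 1\<close> of them. Thus a uniform rank remains uniform within the leaf it
  reaches.\<close>

lemma sum_pdest:
  "(\<Sum>g\<le>psize T. case pdest T g of DN _ \<Rightarrow> 0 | DL k q c \<Rightarrow> \<psi> k q c) =
     openleafsum (\<lambda>k c. \<Sum>q\<le>length c. \<psi> k q c) T"
proof (induction T)
  case (PN l q f r)
  show ?case
  proof (cases f)
    case True
    then show ?thesis
      unfolding psize.simps if_P[OF True] by (subst sum_split_atMost) (simp add: PN)
  qed auto
qed auto

lemma openleafsum_mono:
  assumes "leafall P T" "\<And>k c. P k c \<Longrightarrow> \<phi> k c \<le> \<psi> k c"
  shows "openleafsum \<phi> T \<le> openleafsum \<psi> T"
  using assms(1) by (induction T) (auto intro!: add_mono assms(2))

lemma openleafsum_le_leafsum: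
  assumes "leafall P T" "\<And>k c. P k c \<Longrightarrow> 0 \<le> \<phi> k c"
  shows "openleafsum \<phi> T \<le> leafsum \<phi> T" "0 \<le> leafsum \<phi> T"
proof -
  have "openleafsum \<phi> T \<le> leafsum \<phi> T \<and> 0 \<le> leafsum \<phi> T"
    using assms(1) by (induction T) (auto intro: assms(2) add_mono)
  then show "openleafsum \<phi> T \<le> leafsum \<phi> T" "0 \<le> leafsum \<phi> T" by auto
qed

lemma openleafsum_gaps: "openleafsum (\<lambda>k c. real (length c) + 1) T \<le> real (psize T) + 1"
  by (induction T) auto

lemma openleafsum_add: "openleafsum (\<lambda>k c. \<phi> k c + \<psi> k c) T = openleafsum \<phi> T + openleafsum \<psi> T"
  by (induction T) auto

lemma openleafsum_cmult: "openleafsum (\<lambda>k c. a * \<phi> k c) T = a * openleafsum \<phi> T"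
  by (induction T) (auto simp: algebra_simps)

section \<open>Inversions of a list\<close>

primrec inv_list :: "nat list \<Rightarrow> nat" where
  "inv_list [] = 0"
| "inv_list (x # xs) = length (filter (\<lambda>y. y < x) xs) + inv_list xs"

lemma inv_list_append:
  "inv_list (a @ b) = inv_list a + inv_list b + (\<Sum>x\<leftarrow>a. length (filter (\<lambda>y. y < x) b))"
  by (induction a) auto

lemma inv_list_ins_at:
  "inv_list (ins_at q p c) = inv_list c + length (filter (\<lambda>x. p < x) (take q c))
     + length (filter (\<lambda>x. x < p) (drop q c))"
proof -
  have "inv_list (a @ p # d) = inv_list (a @ d) + length (filter (\<lambda>x. p < x) a)
     + length (filter (\<lambda>x. x < p) d)" for a d
    by (induction a) auto
  from this[of "take q c" "drop q c"] show ?thesis by (simp add: ins_at_def)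
qed

lemma inv_list_append_less:
  assumes "\<And>x y. x \<in> set a \<Longrightarrow> y \<in> set b \<Longrightarrow> x < y"
  shows "inv_list (a @ b) = inv_list a + inv_list b"
proof -
  have "filter (\<lambda>y. y < x) b = []" if "x \<in> set a" for x
    using assms that by (force simp: filter_empty_conv)
  then have "(\<Sum>x\<leftarrow>a. length (filter (\<lambda>y. y < x) b)) = 0"
    by (simp add: sum_list_eq_0_iff)
  then show ?thesis by (simp add: inv_list_append)
qed

lemma inv_list_flat:
  assumes "pwf w h k T"
  shows "real (inv_list (flat T)) = leafsum (\<lambda>k c. real (inv_list c)) T"
  using assms
proof (induction w h k T rule: pwf.induct)
  case (2 w h k l q f r)
  have l: "set (flat l) \<subseteq> {k<..<q}" and r: "set (flat r) \<subseteq> {q<..<q + 2 ^ h * (w + 1)}"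
    using 2 pwf_set_flat[of w h k l] pwf_set_flat[of w h q r] by auto
  have "inv_list (q # flat r) = inv_list (flat r)"
    using inv_list_append_less[of "[q]" "flat r"] r by force
  moreover have "inv_list (flat l @ q # flat r) = inv_list (flat l) + inv_list (q # flat r)"
    using l r by (intro inv_list_append_less) force
  ultimately show ?case using 2 by (cases f) auto
qed auto

lemma card_inversions_eq_inv_list:
  "card {(i, j). i < j \<and> j < length c \<and> c ! i > c ! j} = inv_list c"
proof (induction c)
  case (Cons x c)
  let ?I = "\<lambda>c. {(i, j). i < j \<and> j < length c \<and> c ! i > c ! j}"
  have fin: "finite (?I c)"
    by (rule finite_subset[of _ "{..<length c} \<times> {..<length c}"]) auto
  have "?I (x # c) = (\<lambda>j. (0, Suc j)) ` {j. j < length c \<and> c ! j < x} \<union> map_prod Suc Suc ` ?I c"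
    (is "_ = ?A \<union> ?B")
  proof (intro equalityI subsetI)
    fix z assume z: "z \<in> ?I (x # c)"
    obtain i j where ij: "z = (i, j)" by fastforce
    with z obtain j' where j': "j = Suc j'" by (cases j) auto
    show "z \<in> ?A \<union> ?B"
    proof (cases i)
      case (Suc i')
      then have "(i', j') \<in> ?I c" using z ij j' by auto
      then show ?thesis using ij j' Suc by force
    qed (use z ij j' in auto)
  qed auto
  moreover have "?A \<inter> ?B = {}" by auto
  moreover have "card ?A = length (filter (\<lambda>y. y < x) c)"
    by (subst card_image) (auto simp: inj_on_def length_filter_conv_card)
  moreover have "card ?B = inv_list c"
    by (subst card_image) (auto simp: inj_on_def Cons)
  ultimately show ?case using fin by (simp add: card_Un_disjoint)
qed auto

definition pos_of :: "'a list \<Rightarrow> nat list \<Rightarrow> 'a \<Rightarrow> nat" where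
  "pos_of xs ps x = the (map_of (zip xs ps) x)"

lemma pos_of_nth:
  assumes "distinct xs" "length ps = length xs" "i < length xs"
  shows "pos_of xs ps (xs ! i) = ps ! i"
  using assms by (simp add: pos_of_def map_of_zip_nth)

lemma inversions_eq_inv_list:
  assumes "distinct xs" "set xs = {0..<t}" "length ps = length xs"
  shows "inversions xs ps = inv_list (map (pos_of xs ps) [0..<t])"
proof -
  have len: "length xs = t" using assms distinct_card[of xs] by simp
  let ?I = "{(i, j). i < length xs \<and> j < length xs \<and> xs ! i < xs ! j \<and> ps ! i > ps ! j}"
  let ?J = "{(i, j). i < j \<and> j < t \<and> pos_of xs ps i > pos_of xs ps j}"
  have "bij_betw (\<lambda>(i, j). (xs ! i, xs ! j)) ?I ?J"
  proof (rule bij_betw_imageI)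
    show "inj_on (\<lambda>(i, j). (xs ! i, xs ! j)) ?I"
      using assms(1) by (auto simp: inj_on_def nth_eq_iff_index_eq)
    show "(\<lambda>(i, j). (xs ! i, xs ! j)) ` ?I = ?J"
    proof (intro equalityI subsetI)
      fix z assume "z \<in> ?J"
      then obtain a b where z: "z = (a, b)" "a < b" "b < t" "pos_of xs ps a > pos_of xs ps b" by auto
      then have "a \<in> set xs" "b \<in> set xs" using assms(2) by auto
      then obtain i j where "i < length xs" "xs ! i = a" "j < length xs" "xs ! j = b"
        by (auto simp: in_set_conv_nth)
      then show "z \<in> (\<lambda>(i, j). (xs ! i, xs ! j)) ` ?I"
        using z pos_of_nth[OF assms(1,3)] by (intro image_eqI[of _ _ "(i, j)"]) auto
    next
      fix z assume "z \<in> (\<lambda>(i, j). (xs ! i, xs ! j)) ` ?I"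
      then obtain i j where "z = (xs ! i, xs ! j)" "i < length xs" "j < length xs"
        "xs ! i < xs ! j" "ps ! i > ps ! j" by auto
      moreover from this have "xs ! j \<in> set xs" by simp
      ultimately show "z \<in> ?J"
        using pos_of_nth[OF assms(1,3)] assms(2) by simp
    qed
  qed
  then have "inversions xs ps = card ?J"
    unfolding inversions_def by (rule bij_betw_same_card)
  also have "?J = {(i, j). i < j \<and> j < length (map (pos_of xs ps) [0..<t]) \<and>
      map (pos_of xs ps) [0..<t] ! i > map (pos_of xs ps) [0..<t] ! j}"
    by auto
  also have "card \<dots> = inv_list (map (pos_of xs ps) [0..<t])"
    by (rule card_inversions_eq_inv_list)
  finally show ?thesis .
qed

section \<open>From search trees to position trees\<close>

primrec profile :: "('a::linorder \<Rightarrow> nat) \<Rightarrow> 'a rank_tree \<Rightarrow> ptree" where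
  "profile pos (Block k bs) = PB k (map pos (sorted_list_of_set (set bs)))"
| "profile pos (Node l q c r) = PN (profile pos l) q (c \<noteq> None) (profile pos r)"

primrec bst :: "'a::linorder rank_tree \<Rightarrow> bool" where
  "bst (Block k bs) \<longleftrightarrow> distinct bs"
| "bst (Node l q c r) \<longleftrightarrow> bst l \<and> bst r \<and> (case c of
      None \<Rightarrow> set_rank_tree l = {} \<and> set_rank_tree r = {}
    | Some y \<Rightarrow> (\<forall>x\<in>set_rank_tree l. x < y) \<and> (\<forall>x\<in>set_rank_tree r. y < x))"

lemma finite_set_rank_tree [simp]: "finite (set_rank_tree t)"
proof (induction t)
  case (Node l q c r)
  then show ?case by (cases c) auto
qed auto

lemma bst_descend:
  assumes "bst t" "x \<notin> set_rank_tree t"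
  shows "bst (fst (descend x t))"
  using assms
proof (induction t)
  case (Node l q c r)
  show ?case
  proof (cases c)
    case (Some y)
    then show ?thesis using Node by (auto simp: case_prod_unfold)
  qed (use Node in auto)
qed auto

lemma bst_build: "bst (build w h k)"
  by (induction h arbitrary: k) auto

lemma bst_grow:
  assumes "bst t" "distinct xs" "set xs \<inter> set_rank_tree t = {}"
  shows "bst (grow xs t)"
  using assms by (induction xs arbitrary: t) (auto simp: bst_descend)

lemma psize_profile:
  assumes "bst t"
  shows "psize (profile pos t) = card (set_rank_tree t)"
  using assms
proof (induction t)
  case (Node l q c r)
  show ?case
  proof (cases c)
    case (Some y)
    then have "set_rank_tree l \<inter> insert y (set_rank_tree r) = {}" "y \<notin> set_rank_tree r"
      using Node.prems less_asym by fastforce+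
    then have "card (set_rank_tree l \<union> insert y (set_rank_tree r)) =
        card (set_rank_tree l) + Suc (card (set_rank_tree r))"
      by (subst card_Un_disjoint) auto
    then show ?thesis using Node Some by (simp add: insert_commute Un_commute)
  qed (use Node in auto)
qed auto

lemma insort_eq_ins_at:
  fixes x :: "'a::linorder"
  assumes "sorted xs" "distinct xs" "x \<notin> set xs"
  shows "insort x xs = ins_at (card {y \<in> set xs. y < x}) x xs"
  using assms
proof (induction xs)
  case (Cons a xs)
  show ?case
  proof (cases "a < x")
    case True
    have "{y \<in> set (a # xs). y < x} = insert a {y \<in> set xs. y < x}" using True by auto
    then have "card {y \<in> set (a # xs). y < x} = Suc (card {y \<in> set xs. y < x})"
      using Cons by simp
    then show ?thesis using True Cons by (simp add: ins_at_def not_le)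
  next
    case False
    then have "x < a" using Cons by auto
    then have "{y \<in> set (a # xs). y < x} = {}" using Cons by auto
    then have "card {y \<in> set (a # xs). y < x} = 0" by (metis card.empty)
    then show ?thesis using \<open>x < a\<close> by (simp only: ins_at_def) (simp add: less_imp_le)
  qed
qed (auto simp: ins_at_def)

lemma sorted_list_of_set_insert_ins_at:
  fixes x :: "'a::linorder"
  assumes "finite S" "x \<notin> S"
  shows "sorted_list_of_set (insert x S) = ins_at (card {y \<in> S. y < x}) x (sorted_list_of_set S)"
  using assms insort_eq_ins_at[of "sorted_list_of_set S" x] by simp

lemma map_ins_at: "map f (ins_at q x xs) = ins_at q (f x) (map f xs)"
  by (simp add: ins_at_def take_map drop_map)

lemma card_less_node:
  fixes x y :: "'a::linorder"
  assumes "\<forall>z\<in>A. z < y" "\<forall>z\<in>B. y < z" "finite A" "finite B"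
  shows "x < y \<Longrightarrow> card {z \<in> A \<union> {y} \<union> B. z < x} = card {z \<in> A. z < x}"
    and "y < x \<Longrightarrow> card {z \<in> A \<union> {y} \<union> B. z < x} = card A + 1 + card {z \<in> B. z < x}"
proof -
  assume "x < y"
  then have "{z \<in> A \<union> {y} \<union> B. z < x} = {z \<in> A. z < x}" using assms by auto
  then show "card {z \<in> A \<union> {y} \<union> B. z < x} = card {z \<in> A. z < x}" by simp
next
  assume "y < x"
  then have *: "{z \<in> A \<union> {y} \<union> B. z < x} = A \<union> insert y {z \<in> B. z < x}" using assms by auto
  have "A \<inter> insert y {z \<in> B. z < x} = {}" "y \<notin> {z \<in> B. z < x}"
    using assms(1,2) less_asym by fastforce+
  then show "card {z \<in> A \<union> {y} \<union> B. z < x} = card A + 1 + card {z \<in> B. z < x}"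
    unfolding * using assms by (subst card_Un_disjoint) auto
qed

definition dest_match :: "('a::linorder \<Rightarrow> nat) \<Rightarrow> 'a \<Rightarrow> 'a destination \<Rightarrow> gap_dest \<Rightarrow> bool" where
  "dest_match pos x d g = (case d of
      At_Node p \<Rightarrow> g = DN p
    | At_Leaf k bs \<Rightarrow> distinct bs \<and>
        g = DL k (card {y \<in> set bs. y < x}) (map pos (sorted_list_of_set (set bs))))"

text \<open>The simulation step: the route of \<open>x\<close> through a search tree is determined
  by the rank of \<open>x\<close> among the stored elements, so the position tree can follow it
  without knowing the elements.\<close>

lemma profile_descend:
  assumes "bst t" "x \<notin> set_rank_tree t"
  shows "profile pos (fst (descend x t)) = upd (pos x) (profile pos t) (card {y \<in> set_rank_tree t. y < x}) \<and>
    dest_match pos x (snd (descend x t)) (pdest (profile pos t) (card {y \<in> set_rank_tree t. y < x}))"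
  using assms
proof (induction t)
  case (Block k bs)
  then have "x \<notin> set bs" by simp
  from sorted_list_of_set_insert_ins_at[OF finite_set this]
  have "sorted_list_of_set (set (bs @ [x])) =
      ins_at (card {y \<in> set bs. y < x}) x (sorted_list_of_set (set bs))" by simp
  then have "profile pos (fst (descend x (Block k bs))) =
      upd (pos x) (profile pos (Block k bs)) (card {y \<in> set bs. y < x})"
    by (simp only: descend.simps fst_conv profile.simps upd.simps map_ins_at)
  then show ?case using Block by (simp add: dest_match_def)
next
  case (Node l q c r)
  show ?case
  proof (cases c)
    case (Some y)
    have lr: "\<forall>z\<in>set_rank_tree l. z < y" "\<forall>z\<in>set_rank_tree r. y < z" "bst l" "bst r"
      using Node.prems Some by auto
    have set: "set_rank_tree (Node l q c r) = set_rank_tree l \<union> {y} \<union> set_rank_tree r"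
      using Some by auto
    note card = card_less_node[OF lr(1,2) finite_set_rank_tree finite_set_rank_tree, of x]
    have le: "card {z \<in> set_rank_tree l. z < x} \<le> psize (profile pos l)"
      unfolding psize_profile[OF lr(3)] by (intro card_mono) auto
    show ?thesis
    proof (cases "x < y")
      case True
      then show ?thesis
        unfolding set using Node Some lr card(1) le by (simp add: case_prod_unfold)
    next
      case False
      then have "y < x" using Node.prems Some by auto
      then show ?thesis
        unfolding set using Node Some lr card(2) False
        by (simp add: case_prod_unfold psize_profile)
    qed
  qed (use Node in \<open>auto simp: dest_match_def\<close>)
qed

lemma sorted_list_of_set_map:
  fixes f :: "'a::linorder \<Rightarrow> 'b::linorder"
  assumes "strict_mono f" "finite S"
  shows "sorted_list_of_set (f ` S) = map f (sorted_list_of_set S)"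
proof (rule sorted_distinct_set_unique)
  have "sorted_wrt (<) (sorted_list_of_set S)" by (rule strict_sorted_list_of_set)
  then have "sorted_wrt (<) (map f (sorted_list_of_set S))"
    using assms(1) by (auto simp: sorted_wrt_map strict_mono_less elim: sorted_wrt_mono_rel[rotated])
  then show "sorted (map f (sorted_list_of_set S))" "distinct (map f (sorted_list_of_set S))"
    by (auto simp: strict_sorted_iff)
qed (use assms in auto)

lemma profile_map:
  fixes f :: "'a::linorder \<Rightarrow> 'b::linorder"
  assumes "strict_mono f"
  shows "profile pos (map_rank_tree f t) = profile (pos \<circ> f) t"
  by (induction t) (simp_all add: sorted_list_of_set_map[OF assms])

lemma profile_cong:
  assumes "\<And>x. x \<in> set_rank_tree t \<Longrightarrow> pos x = pos' x"
  shows "profile pos t = profile pos' t"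
  using assms by (induction t) auto

definition prof :: "nat \<Rightarrow> nat \<Rightarrow> nat list \<times> nat list \<Rightarrow> ptree" where
  "prof w h \<sigma> = profile (pos_of (fst \<sigma>) (snd \<sigma>)) (grow (fst \<sigma>) (build w h 0))"

lemma pos_of_snoc:
  assumes "length ps = length xs" "x \<notin> set xs"
  shows "pos_of (xs @ [x]) (ps @ [p]) x = p"
    and "y \<in> set xs \<Longrightarrow> pos_of (xs @ [x]) (ps @ [p]) y = pos_of xs ps y"
proof -
  have zip: "zip (xs @ [x]) (ps @ [p]) = zip xs ps @ [(x, p)]" using assms by simp
  have None: "map_of (zip xs ps) x = None" using assms by simp
  show "pos_of (xs @ [x]) (ps @ [p]) x = p"
    by (simp only: pos_of_def zip map_of_append map_add_def None option.case) simp
  assume "y \<in> set xs"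
  then obtain v where "map_of (zip xs ps) y = Some v" using assms
    by (metis map_of_zip_is_Some)
  moreover have "y \<noteq> x" using assms \<open>y \<in> set xs\<close> by auto
  ultimately show "pos_of (xs @ [x]) (ps @ [p]) y = pos_of xs ps y"
    using assms by (simp add: pos_of_def map_add_def)
qed

lemma pos_of_map:
  assumes "length ps = length xs" "inj f"
  shows "pos_of (map f xs) ps (f x) = pos_of xs ps x"
  using assms unfolding pos_of_def
  by (induction ps xs rule: list_induct2) (auto simp: inj_eq)

locale chain_state =
  fixes xs ps :: "nat list" and t :: nat
  assumes set_xs: "set xs = {0..<t}" and dist: "distinct xs" and len: "length ps = length xs"
begin

lemma length_xs: "length xs = t"
  using distinct_card[OF dist] set_xs by simp

lemma bst: "bst (grow xs (build w h 0))"
  by (rule bst_grow) (auto simp: bst_build dist)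

lemma psize_prof: "psize (prof w h (xs, ps)) = t"
  by (simp add: prof_def psize_profile[OF bst] set_xs)

lemma strict_mono_shift: "strict_mono (shift r)"
  using strict_mono_on_shift[of UNIV r] by simp

lemma shift_ne: "shift r x \<noteq> r"
  by (simp add: shift_def)

lemma shifted_tree:
  fixes w h :: nat
  assumes "r \<le> t"
  defines "T \<equiv> map_rank_tree (shift r) (grow xs (build w h 0))"
  shows "r \<notin> set_rank_tree T" "card {y \<in> set_rank_tree T. y < r} = r" "bst T"
    and "T = grow (map (shift r) xs) (build w h 0)"
proof -
  show T: "T = grow (map (shift r) xs) (build w h 0)"
    unfolding T_def using grow_map[OF strict_mono_on_shift, of r xs "build w h 0"] by simp
  have setT: "set_rank_tree T = {0..<Suc t} - {r}"
    unfolding T_def rank_tree.set_map using shift_image[OF assms(1)] set_xs by simp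
  show "r \<notin> set_rank_tree T" unfolding setT by simp
  have "{y \<in> set_rank_tree T. y < r} = {0..<r}" unfolding setT using assms(1) by force
  then show "card {y \<in> set_rank_tree T. y < r} = r" by simp
  show "bst T"
    unfolding T using dist strict_mono_imp_inj_on[OF strict_mono_shift, of r]
    by (intro bst_grow bst_build) (auto simp: distinct_map inj_on_def)
qed

lemma pos_of_shift:
  "pos_of (map (shift r) xs) ps (shift r x) = pos_of xs ps x"
  by (intro pos_of_map len strict_mono_imp_inj_on strict_mono_shift)

lemma prof_shift:
  "profile (pos_of (map (shift r) xs) ps) (map_rank_tree (shift r) (grow xs (build w h 0))) = prof w h (xs, ps)"
  unfolding profile_map[OF strict_mono_shift] prof_def
  by (simp add: comp_def pos_of_shift)

lemma r_notin: "r \<notin> set (map (shift r) xs)"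
  using shift_ne[of r] by (auto simp: image_iff) metis

lemma prof_step:
  assumes "r \<le> t"
  shows "prof w h (map (shift r) xs @ [r], ps @ [p]) = upd p (prof w h (xs, ps)) r"
proof -
  define T where "T = map_rank_tree (shift r) (grow xs (build w h 0))"
  define pos where "pos = pos_of (map (shift r) xs @ [r]) (ps @ [p])"
  note T = shifted_tree[OF assms, of w h, folded T_def]
  have "prof w h (map (shift r) xs @ [r], ps @ [p]) = profile pos (fst (descend r T))"
    by (simp add: prof_def pos_def T(4))
  also have "\<dots> = upd (pos r) (profile pos T) r"
    using profile_descend[OF T(3,1), of pos] T(2) by simp
  also have "pos r = p"
    unfolding pos_def using r_notin len by (intro pos_of_snoc) auto
  also have "profile pos T = profile (pos_of (map (shift r) xs) ps) T"
  proof (rule profile_cong)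
    fix x assume "x \<in> set_rank_tree T"
    then have "x \<in> set (map (shift r) xs)" unfolding T_def rank_tree.set_map by simp
    then show "pos x = pos_of (map (shift r) xs) ps x"
      unfolding pos_def using r_notin len by (intro pos_of_snoc) auto
  qed
  also have "\<dots> = prof w h (xs, ps)" unfolding T_def by (rule prof_shift)
  finally show ?thesis .
qed

lemma positions_step:
  assumes "r \<le> t"
  shows "map (pos_of (map (shift r) xs @ [r]) (ps @ [p])) [0..<Suc t] =
    ins_at r p (map (pos_of xs ps) [0..<t])"
proof -
  define pos where "pos = pos_of (map (shift r) xs @ [r]) (ps @ [p])"
  have *: "pos (shift r x) = pos_of xs ps x" if "x < t" for x
  proof -
    have "shift r x \<in> set (map (shift r) xs)" using that set_xs by simp
    then have "pos (shift r x) = pos_of (map (shift r) xs) ps (shift r x)"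
      unfolding pos_def using r_notin len by (intro pos_of_snoc) auto
    then show ?thesis by (simp add: pos_of_shift)
  qed
  have r: "pos r = p"
    unfolding pos_def using r_notin len by (intro pos_of_snoc) auto
  show ?thesis unfolding pos_def[symmetric]
  proof (rule nth_equalityI)
    fix i assume "i < length (map pos [0..<Suc t])"
    then have i: "i < Suc t" by simp
    consider "i < r" | "i = r" | j where "i = Suc j" "r \<le> j"
      by (metis less_imp_Suc_add linorder_neqE_nat le_add1)
    then show "map pos [0..<Suc t] ! i = ins_at r p (map (pos_of xs ps) [0..<t]) ! i"
    proof cases
      case 1
      then show ?thesis using *[of i] assms by (simp add: shift_def ins_at_def nth_append del: upt_Suc)
    next
      case 2
      then show ?thesis using r assms by (simp add: ins_at_def nth_append del: upt_Suc)
    next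
      case 3
      then have "j < t" using i by simp
      then show ?thesis using *[of j] 3 assms i
        by (simp add: shift_def ins_at_def nth_append Suc_diff_le del: upt_Suc)
    qed
  qed simp
qed

lemma set_positions: "set (map (pos_of xs ps) [0..<t]) = set ps"
proof -
  have "map (pos_of xs ps) xs = ps"
    using len by (intro nth_equalityI) (auto simp: pos_of_nth dist)
  then have "set ps = pos_of xs ps ` {0..<t}" using set_xs by (metis set_map)
  then show ?thesis by simp
qed

end

section \<open>One step of the chain\<close>

lemma nearest_nonempty:
  assumes "finite R" "R \<noteq> {}"
  shows "nearest R z \<noteq> {}" "finite (nearest R z)"
proof -
  obtain p where "p \<in> R" "\<forall>q\<in>R. \<bar>int p - z\<bar> \<le> \<bar>int q - z\<bar>"
    using ex_min_if_finite[of "(\<lambda>p. \<bar>int p - z\<bar>) ` R"] assms by fastforce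
  then show "nearest R z \<noteq> {}" unfolding nearest_def by blast
  show "finite (nearest R z)" using assms by (simp add: nearest_def)
qed

text \<open>All that the analysis keeps of a Dense Ranking step: the exact law of the target,
  followed by an unknown, possibly random, selection among the nearest free positions.\<close>

definition dr_law :: "nat \<Rightarrow> nat \<Rightarrow> nat \<Rightarrow> nat list \<Rightarrow> nat pmf \<Rightarrow> bool" where
  "dr_law w k q c P \<longleftrightarrow> (\<exists>pick. (\<forall>S. finite S \<longrightarrow> S \<noteq> {} \<longrightarrow> set_pmf (pick S) \<subseteq> S) \<and>
    P = bind_pmf (dense_target w (Suc (length c)) q)
      (\<lambda>z. pick (nearest ({k+1..k+w} - set c) (int k + z))))"

lemma block_not_full:
  assumes "length c < w"
  shows "{k+1..k+w} - set c \<noteq> {}"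
proof
  assume "{k+1..k+w} - set c = {}"
  then have "card {k+1..k+w} \<le> card (set c)" by (intro card_mono) auto
  also have "\<dots> \<le> length c" by (rule card_length)
  finally show False using assms by simp
qed

text \<open>The third part eliminates the unknown selection: a bound valid at every nearest free
  position may be integrated over the target alone.\<close>

lemma dr_law:
  assumes "dr_law w k q c P" "length c < w" "q \<le> length c"
  shows "set_pmf P \<subseteq> {k+1..k+w} - set c" "finite (set_pmf P)"
    and "\<And>F u :: _ \<Rightarrow> real. (\<And>z p. z \<in> set_pmf (dense_target w (Suc (length c)) q) \<Longrightarrow>
        p \<in> nearest ({k+1..k+w} - set c) (int k + z) \<Longrightarrow> F p \<le> u z) \<Longrightarrow>
      measure_pmf.expectation P F \<le> measure_pmf.expectation (dense_target w (Suc (length c)) q) u"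
proof -
  let ?R = "{k+1..k+w} - set c" and ?D = "dense_target w (Suc (length c)) q"
  obtain pick where pick: "\<And>S. finite S \<Longrightarrow> S \<noteq> {} \<Longrightarrow> set_pmf (pick S) \<subseteq> S"
    and P: "P = bind_pmf ?D (\<lambda>z. pick (nearest ?R (int k + z)))"
    using assms(1) unfolding dr_law_def by blast
  have ne: "nearest ?R z \<noteq> {}" "finite (nearest ?R z)" for z
    using nearest_nonempty[of ?R] block_not_full[OF assms(2)] by auto
  have sub: "set_pmf (pick (nearest ?R z)) \<subseteq> nearest ?R z" for z
    by (rule pick[OF ne(2,1)])
  have fin: "finite (set_pmf (pick (nearest ?R z)))" for z
    by (rule finite_subset[OF sub ne(2)])
  have finD: "finite (set_pmf ?D)"
    using assms by (intro finite_set_dense_target) auto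
  show sP: "set_pmf P \<subseteq> ?R"
    using sub unfolding P nearest_def by fastforce
  then show "finite (set_pmf P)" by (rule finite_subset) simp
  fix F u :: "_ \<Rightarrow> real"
  assume Fu: "\<And>z p. z \<in> set_pmf ?D \<Longrightarrow> p \<in> nearest ?R (int k + z) \<Longrightarrow> F p \<le> u z"
  have "measure_pmf.expectation P F =
      measure_pmf.expectation ?D (\<lambda>z. measure_pmf.expectation (pick (nearest ?R (int k + z))) F)"
    unfolding P by (rule expectation_bind_finite[OF finD fin])
  also have "\<dots> \<le> measure_pmf.expectation ?D u"
  proof (rule expectation_mono_finite[OF finD])
    fix z assume "z \<in> set_pmf ?D"
    then have "measure_pmf.expectation (pick (nearest ?R (int k + z))) F \<le>
        measure_pmf.expectation (pick (nearest ?R (int k + z))) (\<lambda>_. u z)"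
      using sub Fu by (intro expectation_mono_finite fin) blast
    then show "measure_pmf.expectation (pick (nearest ?R (int k + z))) F \<le> u z" by simp
  qed
  finally show "measure_pmf.expectation P F \<le> measure_pmf.expectation ?D u" .
qed

lemma leafall_upd_DL:
  assumes "leafall P (upd p T g)" "pdest T g = DL k q c"
  shows "P k (ins_at q p c)"
  using assms by (induction T arbitrary: g) (auto split: if_splits)

lemma pwf_build:
  "pwf w h k (profile pos (build w h k))" "flat (profile pos (build w h k)) = []"
proof -
  have fl: "flat (profile pos (build w h k)) = []" for h k by (induction h arbitrary: k) auto
  show "flat (profile pos (build w h k)) = []" by (rule fl)
  show "pwf w h k (profile pos (build w h k))"
    by (induction h arbitrary: k) (auto simp: fl)
qed

section \<open>The algorithm as a chain driven by uniform ranks\<close>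

locale general_algorithm =
  fixes ch :: choice_rule and m h w :: nat
  assumes ok: "choice_rule_ok ch"
    and w_def: "w = m div 2 ^ h - 1"
begin

abbreviation "J \<equiv> joint ch m h"
abbreviation "pr \<equiv> prof w h"

abbreviation leafsum_on ::
    "(nat \<Rightarrow> nat list \<Rightarrow> bool) \<Rightarrow> (nat \<Rightarrow> nat list \<Rightarrow> real) \<Rightarrow> nat list \<times> nat list \<Rightarrow> real" where
  "leafsum_on Q \<phi> \<sigma> \<equiv> (if leafall Q (pr \<sigma>) then leafsum \<phi> (pr \<sigma>) else 0)"

definition law :: "nat list \<times> nat list \<Rightarrow> nat \<Rightarrow> nat pmf" where
  "law \<sigma> r = place ch m w (map (shift r) (fst \<sigma>)) (snd \<sigma>) r
      (snd (descend r (map_rank_tree (shift r) (grow (fst \<sigma>) (build w h 0)))))"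

definition succ_state :: "nat list \<times> nat list \<Rightarrow> nat \<Rightarrow> nat \<Rightarrow> nat list \<times> nat list" where
  "succ_state \<sigma> r p = (map (shift r) (fst \<sigma>) @ [r], snd \<sigma> @ [p])"

lemma J_Suc: "J (Suc t) = do {
    \<sigma> \<leftarrow> J t; r \<leftarrow> pmf_of_set {0..t}; p \<leftarrow> law \<sigma> r; return_pmf (succ_state \<sigma> r p) }"
  unfolding joint_Suc w_def[symmetric] law_def succ_state_def case_prod_unfold ..

lemma set_J_Suc:
  assumes "\<sigma>' \<in> set_pmf (J (Suc t))"
  obtains \<sigma> r p where "\<sigma> \<in> set_pmf (J t)" "r \<le> t" "p \<in> set_pmf (law \<sigma> r)" "\<sigma>' = succ_state \<sigma> r p"
  using assms unfolding J_Suc by (auto simp: set_bind_pmf)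

lemma J_0: "J 0 = return_pmf ([], [])"
  by (simp add: joint_def general_ranking_def pmf_of_set_singleton bind_return_pmf)

lemma chain_state_J:
  assumes "\<sigma> \<in> set_pmf (J t)"
  shows "chain_state (fst \<sigma>) (snd \<sigma>) t"
  using assms
proof (induction t arbitrary: \<sigma>)
  case 0
  then show ?case by (simp add: J_0 chain_state_def)
next
  case (Suc t)
  obtain \<sigma>0 r p where s: "\<sigma>0 \<in> set_pmf (J t)" "r \<le> t" "\<sigma> = succ_state \<sigma>0 r p"
    using set_J_Suc[OF Suc.prems] by metis
  interpret chain_state "fst \<sigma>0" "snd \<sigma>0" t by (rule Suc.IH[OF s(1)])
  have "inj_on (shift r) (set (fst \<sigma>0))"
    by (rule inj_on_subset[OF strict_mono_imp_inj_on[OF strict_mono_shift] subset_UNIV])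
  moreover have "insert r (shift r ` {0..<t}) = {0..<Suc t}"
    unfolding shift_image[OF s(2)] using s(2) by auto
  moreover have "r \<notin> shift r ` {0..<t}" unfolding shift_image[OF s(2)] by simp
  ultimately show ?case
    unfolding s(3) succ_state_def chain_state_def using dist len set_xs by (simp add: distinct_map)
qed

text \<open>While fewer than \<open>m\<close> positions are in use a free one exists. For an empty
  set of admissible positions the choice rule is unconstrained and could have infinite
  support.\<close>

lemma finite_place:
  assumes "card (set ps) < m"
  shows "finite (set_pmf (place ch m w xs ps x d))"
proof -
  let ?pick = "ch (comparisons (xs @ [x])) ps"
  have pick: "finite (set_pmf (?pick S))" if "finite S" "S \<noteq> {}" for S
    using that ok unfolding choice_rule_ok_def by (meson finite_subset)
  have "{1..m} - set ps \<noteq> {}"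
  proof
    assume "{1..m} - set ps = {}"
    then have "card {1..m} \<le> card (set ps)" by (intro card_mono) auto
    then show False using assms by simp
  qed
  then have free: "finite (set_pmf (?pick ({1..m} - set ps)))" by (intro pick) auto
  show ?thesis
  proof (cases d)
    case (At_Node p)
    then show ?thesis using free by (auto simp: place_def Let_def)
  next
    case (At_Leaf k bs)
    have "finite (set_pmf (dense_ranking ?pick w k ({k+1..k+w} - set ps) bs x))"
      if ne: "{k+1..k+w} - set ps \<noteq> {}"
    proof -
      have "w > 0" using ne by (cases w) auto
      moreover have "card {y \<in> set bs. y < x} \<le> card (set bs)" by (intro card_mono) auto
      then have "card {y \<in> set bs. y < x} < length bs + 1" using card_length[of bs] by linarith
      ultimately have "finite (set_pmf (dense_target w (length bs + 1) (card {y \<in> set bs. y < x})))"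
        by (rule finite_set_dense_target)
      then show ?thesis
        unfolding dense_ranking_def using nearest_nonempty[of "{k+1..k+w} - set ps"] ne
        by (auto intro!: pick)
    qed
    then show ?thesis using free At_Leaf by (auto simp: place_def Let_def)
  qed
qed

lemma finite_law:
  assumes "\<sigma> \<in> set_pmf (J t)" "t < m"
  shows "finite (set_pmf (law \<sigma> r))"
proof -
  interpret chain_state "fst \<sigma>" "snd \<sigma>" t by (rule chain_state_J[OF assms(1)])
  have "card (set (snd \<sigma>)) < m"
    using card_length[of "snd \<sigma>"] len length_xs assms(2) by simp
  then show ?thesis unfolding law_def by (rule finite_place)
qed

lemma finite_J: "t \<le> m \<Longrightarrow> finite (set_pmf (J t))"
proof (induction t)
  case (Suc t)
  then show ?case
    unfolding J_Suc by (auto simp: set_bind_pmf intro!: finite_law)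
qed (simp add: J_0)

lemma expectation_J_Suc:
  fixes F :: "_ \<Rightarrow> real"
  assumes "t < m"
  shows "measure_pmf.expectation (J (Suc t)) F = measure_pmf.expectation (J t)
    (\<lambda>\<sigma>. (\<Sum>r\<le>t. measure_pmf.expectation (law \<sigma> r) (\<lambda>p. F (succ_state \<sigma> r p))) / (real t + 1))"
proof -
  have fin: "finite (set_pmf (J t))" using assms by (intro finite_J) simp
  let ?N = "\<lambda>\<sigma>. do { r \<leftarrow> pmf_of_set {0..t}; p \<leftarrow> law \<sigma> r; return_pmf (succ_state \<sigma> r p) }"
  have "measure_pmf.expectation (J (Suc t)) F =
      measure_pmf.expectation (J t) (\<lambda>\<sigma>. measure_pmf.expectation (?N \<sigma>) F)"
    unfolding J_Suc
    by (rule expectation_bind_finite[OF fin]) (auto simp: set_bind_pmf intro: finite_law[OF _ assms])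
  also have "\<dots> = measure_pmf.expectation (J t)
    (\<lambda>\<sigma>. (\<Sum>r\<le>t. measure_pmf.expectation (law \<sigma> r) (\<lambda>p. F (succ_state \<sigma> r p))) / (real t + 1))"
  proof (rule expectation_cong_pmf)
    fix \<sigma> assume \<sigma>: "\<sigma> \<in> set_pmf (J t)"
    have fl: "finite (set_pmf (law \<sigma> r))" for r by (rule finite_law[OF \<sigma> assms])
    have "measure_pmf.expectation (?N \<sigma>) F = measure_pmf.expectation (pmf_of_set {0..t})
        (\<lambda>r. measure_pmf.expectation (law \<sigma> r \<bind> (\<lambda>p. return_pmf (succ_state \<sigma> r p))) F)"
      by (rule expectation_bind_finite) (auto simp: set_bind_pmf fl)
    also have "\<dots> = measure_pmf.expectation (pmf_of_set {0..t})
        (\<lambda>r. measure_pmf.expectation (law \<sigma> r) (\<lambda>p. F (succ_state \<sigma> r p)))"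
      by (intro expectation_cong_pmf, subst expectation_bind_finite) (auto simp: fl)
    also have "\<dots> = (\<Sum>r\<le>t. measure_pmf.expectation (law \<sigma> r) (\<lambda>p. F (succ_state \<sigma> r p))) / (real t + 1)"
      by (subst integral_pmf_of_set) (auto simp: atLeast0AtMost add.commute)
    finally show "measure_pmf.expectation (?N \<sigma>) F = \<dots>" .
  qed
  finally show ?thesis .
qed

text \<open>If the positions in use, read in the order of the elements, are those recorded in the
  tree, no stray placement interferes: the position of an empty node is still available, and the
  free part of a block is determined by its leaf.\<close>

lemma law_cases:
  assumes "\<sigma> \<in> set_pmf (J t)" "r \<le> t" "pwf w h 0 (pr \<sigma>)"
    and "flat (pr \<sigma>) = map (pos_of (fst \<sigma>) (snd \<sigma>)) [0..<t]"
  shows "pdest (pr \<sigma>) r = DN p \<Longrightarrow> law \<sigma> r = return_pmf p"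
    and "pdest (pr \<sigma>) r = DL k q c \<Longrightarrow> length c < w \<Longrightarrow> dr_law w k q c (law \<sigma> r)"
proof -
  interpret chain_state "fst \<sigma>" "snd \<sigma>" t by (rule chain_state_J[OF assms(1)])
  define T where "T = map_rank_tree (shift r) (grow (fst \<sigma>) (build w h 0))"
  define pos where "pos = pos_of (map (shift r) (fst \<sigma>)) (snd \<sigma>)"
  note T = shifted_tree[OF assms(2), of w h, folded T_def]
  have prT: "profile pos T = pr \<sigma>"
    unfolding T_def pos_def using prof_shift[of r w h] by simp
  have dm: "dest_match pos r (snd (descend r T)) (pdest (pr \<sigma>) r)"
    using profile_descend[OF T(3,1), of pos] T(2) prT by simp
  have flat: "set (flat (pr \<sigma>)) = set (snd \<sigma>)" using assms(4) set_positions by simp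
  have law: "law \<sigma> r = place ch m w (map (shift r) (fst \<sigma>)) (snd \<sigma>) r (snd (descend r T))"
    by (simp add: law_def T_def)
  {
    assume "pdest (pr \<sigma>) r = DN p"
    then have "snd (descend r T) = At_Node p" "p \<notin> set (snd \<sigma>)"
      using dm pdest_DN[OF assms(3)] flat by (auto simp: dest_match_def split: destination.splits)
    then show "law \<sigma> r = return_pmf p" by (simp add: law place_def)
  next
    assume d: "pdest (pr \<sigma>) r = DL k q c" and "length c < w"
    then obtain bs where bs: "snd (descend r T) = At_Leaf k bs" "distinct bs"
      "q = card {y \<in> set bs. y < r}" "c = map pos (sorted_list_of_set (set bs))"
      using dm by (auto simp: dest_match_def split: destination.splits)
    have len: "length bs = length c" using bs(2,4) by (simp add: distinct_card)
    have "{k+1..k+w} \<inter> set (flat (pr \<sigma>)) = set c"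
      using pdest_DL[OF assms(3) d] assms(2) psize_prof[of w h] by simp
    then have R: "{k+1..k+w} - set (snd \<sigma>) = {k+1..k+w} - set c" using flat by blast
    have "law \<sigma> r = dense_ranking (ch (comparisons (map (shift r) (fst \<sigma>) @ [r])) (snd \<sigma>)) w k
        ({k+1..k+w} - set c) bs r"
      unfolding law place_def bs(1) Let_def destination.case R if_not_P[OF block_not_full[OF \<open>length c < w\<close>]] ..
    also have "\<dots> = bind_pmf (dense_target w (Suc (length c)) q)
      (\<lambda>z. ch (comparisons (map (shift r) (fst \<sigma>) @ [r])) (snd \<sigma>)
         (nearest ({k+1..k+w} - set c) (int k + z)))"
      by (simp add: dense_ranking_def len bs(3))
    finally show "dr_law w k q c (law \<sigma> r)"
      unfolding dr_law_def using ok unfolding choice_rule_ok_def by blast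
  }
qed

lemma pr_succ_state:
  assumes "\<sigma> \<in> set_pmf (J t)" "r \<le> t"
  shows "pr (succ_state \<sigma> r p) = upd p (pr \<sigma>) r"
proof -
  interpret chain_state "fst \<sigma>" "snd \<sigma>" t by (rule chain_state_J[OF assms(1)])
  show ?thesis using prof_step[OF assms(2), of w h p] by (simp add: succ_state_def)
qed

lemma psize_pr: "\<sigma> \<in> set_pmf (J t) \<Longrightarrow> psize (pr \<sigma>) = t"
  using chain_state.psize_prof[OF chain_state_J] by simp

text \<open>Leaf sizes never decrease, so a bound \<open>M \<le> w\<close> that holds now held at
  every earlier time. Each block therefore had a free position whenever it received an element, and
  no placement was arbitrary.\<close>

lemma invariant:
  assumes "M \<le> w" "\<sigma> \<in> set_pmf (J t)" "leafall (\<lambda>k c. length c \<le> M) (pr \<sigma>)"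
  shows "pwf w h 0 (pr \<sigma>) \<and> flat (pr \<sigma>) = map (pos_of (fst \<sigma>) (snd \<sigma>)) [0..<t]"
  using assms(2,3)
proof (induction t arbitrary: \<sigma>)
  case 0
  then have "\<sigma> = ([], [])" by (simp add: J_0)
  then show ?case by (simp add: prof_def pwf_build)
next
  case (Suc t)
  obtain \<sigma>0 r p where s: "\<sigma>0 \<in> set_pmf (J t)" "r \<le> t" "p \<in> set_pmf (law \<sigma>0 r)" "\<sigma> = succ_state \<sigma>0 r p"
    using set_J_Suc[OF Suc.prems(1)] by metis
  interpret chain_state "fst \<sigma>0" "snd \<sigma>0" t by (rule chain_state_J[OF s(1)])
  have T: "pr \<sigma> = upd p (pr \<sigma>0) r" using pr_succ_state[OF s(1,2)] s(4) by simp
  have "leafall (\<lambda>k c. length c \<le> M) (pr \<sigma>0)"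
    using Suc.prems(2) unfolding T by (rule leafall_upd) simp
  with Suc.IH[OF s(1)] have IH: "pwf w h 0 (pr \<sigma>0)"
    "flat (pr \<sigma>0) = map (pos_of (fst \<sigma>0) (snd \<sigma>0)) [0..<t]" by auto
  note law = law_cases[OF s(1,2) IH]
  have DN: "p = p'" if "pdest (pr \<sigma>0) r = DN p'" for p'
    using law(1)[OF that] s(3) by simp
  have DL: "p \<in> {k+1..k+w} - set c" if "pdest (pr \<sigma>0) r = DL k q c" for k q c
  proof -
    have "length c < w"
      using leafall_upd_DL[OF Suc.prems(2)[unfolded T] that] assms(1) by simp
    moreover have "q \<le> length c"
      using pdest_DL[OF IH(1) that] s(2) psize_pr[OF s(1)] by simp
    ultimately show ?thesis using dr_law(1)[OF law(2)[OF that]] s(3) by blast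
  qed
  have r: "r \<le> psize (pr \<sigma>0)" using s(2) psize_pr[OF s(1)] by simp
  have "pwf w h 0 (pr \<sigma>)" unfolding T by (rule pwf_upd[OF IH(1) r DL])
  moreover have "flat (pr \<sigma>) = ins_at r p (flat (pr \<sigma>0))"
    unfolding T by (rule flat_upd[OF IH(1) r DN])
  ultimately show ?case
    using positions_step[OF s(2), of p] IH(2) by (simp add: s(4) succ_state_def)
qed

lemma inversions_eq_leafsum:
  assumes "M \<le> w" "\<sigma> \<in> set_pmf (J t)" "leafall (\<lambda>k c. length c \<le> M) (pr \<sigma>)"
  shows "real (inversions (fst \<sigma>) (snd \<sigma>)) = leafsum (\<lambda>k c. real (inv_list c)) (pr \<sigma>)"
proof -
  interpret chain_state "fst \<sigma>" "snd \<sigma>" t by (rule chain_state_J[OF assms(2)])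
  show ?thesis
    using invariant[OF assms] inv_list_flat[of w h 0 "pr \<sigma>"]
      inversions_eq_inv_list[OF dist set_xs len] by simp
qed

text \<open>The quantities followed along the chain are sums over the leaves, set to 0 as soon as some
  leaf violates \<open>Q\<close>.  For such a quantity it suffices to study a single instance of Dense Ranking,
  the rank of the new element being uniform in every leaf that can still be reached.\<close>

lemma expectation_leafsum_step:
  assumes "t < m" "M < w"
    and Q_len: "\<And>k c. Q k c \<Longrightarrow> length c \<le> M"
    and Q_anti: "\<And>k q p c. Q k (ins_at q p c) \<Longrightarrow> Q k c"
    and nonneg: "\<And>k c. 0 \<le> \<phi> k c"
    and step: "\<And>k q c P. Q k c \<Longrightarrow> set c \<subseteq> {k+1..k+w} \<Longrightarrow> distinct c \<Longrightarrow> q \<le> length c \<Longrightarrow>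
      dr_law w k q c P \<Longrightarrow> measure_pmf.expectation P (\<lambda>p. \<phi> k (ins_at q p c)) \<le> \<phi> k c + \<beta> k q c"
  shows "measure_pmf.expectation (J (Suc t)) (\<lambda>\<sigma>. leafsum_on Q \<phi> \<sigma>)
    \<le> measure_pmf.expectation (J t) (\<lambda>\<sigma>. if leafall Q (pr \<sigma>) then leafsum \<phi> (pr \<sigma>) +
        openleafsum (\<lambda>k c. \<Sum>q\<le>length c. \<beta> k q c) (pr \<sigma>) / (real t + 1) else 0)"
  unfolding expectation_J_Suc[OF assms(1)]
proof (rule expectation_mono_finite)
  show "finite (set_pmf (J t))" using assms(1) by (intro finite_J) simp
  fix \<sigma> assume \<sigma>: "\<sigma> \<in> set_pmf (J t)"
  let ?T = "pr \<sigma>"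
  let ?F = "\<lambda>\<sigma>. leafsum_on Q \<phi> \<sigma>"
  have upd: "pr (succ_state \<sigma> r p) = upd p ?T r" if "r \<le> t" for r p
    by (rule pr_succ_state[OF \<sigma> that])
  show "(\<Sum>r\<le>t. measure_pmf.expectation (law \<sigma> r) (\<lambda>p. ?F (succ_state \<sigma> r p))) / (real t + 1)
    \<le> (if leafall Q ?T then leafsum \<phi> ?T +
        openleafsum (\<lambda>k c. \<Sum>q\<le>length c. \<beta> k q c) ?T / (real t + 1) else 0)"
  proof (cases "leafall Q ?T")
    case False
    have "measure_pmf.expectation (law \<sigma> r) (\<lambda>p. ?F (succ_state \<sigma> r p)) = 0" if "r \<le> t" for r
    proof -
      have "\<not> leafall Q (upd p ?T r)" for p
        using False leafall_upd[of Q p ?T r] Q_anti by blast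
      then show ?thesis using upd[OF that] by simp
    qed
    then show ?thesis using False by simp
  next
    case True
    have lenM: "leafall (\<lambda>k c. length c \<le> M) ?T"
      by (rule leafall_mono[OF True]) (rule Q_len)
    note inv = invariant[OF less_imp_le[OF assms(2)] \<sigma> lenM]
    have size: "psize ?T = t" by (rule psize_pr[OF \<sigma>])
    let ?\<beta> = "\<lambda>r. case pdest ?T r of DN _ \<Rightarrow> 0 | DL k q c \<Rightarrow> \<beta> k q c"
    have "measure_pmf.expectation (law \<sigma> r) (\<lambda>p. ?F (succ_state \<sigma> r p)) \<le> leafsum \<phi> ?T + ?\<beta> r"
      if r: "r \<le> t" for r
    proof -
      note law = law_cases[OF \<sigma> r inv[THEN conjunct1] inv[THEN conjunct2]]
      have fin: "finite (set_pmf (law \<sigma> r))" by (rule finite_law[OF \<sigma> assms(1)])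
      have nn: "0 \<le> leafsum \<phi> T'" for T'
        by (induction T') (auto simp: nonneg)
      \<comment> \<open>Ignoring a violation of \<open>Q\<close> in the next state only increases a
        nonnegative quantity, and leaves an increment that involves a single leaf.\<close>
      have "measure_pmf.expectation (law \<sigma> r) (\<lambda>p. ?F (succ_state \<sigma> r p)) \<le>
          measure_pmf.expectation (law \<sigma> r) (\<lambda>p. leafsum \<phi> (upd p ?T r))"
        using nn upd[OF r] by (intro expectation_mono_finite fin) auto
      also have "\<dots> \<le> leafsum \<phi> ?T + ?\<beta> r"
      proof (cases "pdest ?T r")
        case (DN p)
        then show ?thesis using law(1)[OF DN] by (simp add: leafsum_upd)
      next
        case (DL k q c)
        have Qc: "Q k c" by (rule leafall_pdest[OF True DL])
        have lw: "length c < w" using Q_len[OF Qc] assms(2) by simp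
        have d: "set c \<subseteq> {k+1..k+w}" "q \<le> length c" "distinct c"
          using pdest_DL[OF inv[THEN conjunct1] DL] r size by auto
        have "measure_pmf.expectation (law \<sigma> r) (\<lambda>p. leafsum \<phi> (upd p ?T r)) =
           measure_pmf.expectation (law \<sigma> r) (\<lambda>p. (leafsum \<phi> ?T - \<phi> k c) + \<phi> k (ins_at q p c))"
          by (intro expectation_cong_pmf) (simp add: leafsum_upd DL)
        also have "\<dots> = (leafsum \<phi> ?T - \<phi> k c) + measure_pmf.expectation (law \<sigma> r) (\<lambda>p. \<phi> k (ins_at q p c))"
          by (subst expectation_add_finite[OF fin]) simp
        also have "\<dots> \<le> leafsum \<phi> ?T + \<beta> k q c"
          using step[OF Qc d(1,3,2) law(2)[OF DL lw]] by simp
        finally show ?thesis by (simp add: DL)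
      qed
      finally show ?thesis .
    qed
    then have "(\<Sum>r\<le>t. measure_pmf.expectation (law \<sigma> r) (\<lambda>p. ?F (succ_state \<sigma> r p))) \<le>
        (\<Sum>r\<le>t. leafsum \<phi> ?T + ?\<beta> r)"
      by (intro sum_mono) simp
    also have "\<dots> = (real t + 1) * leafsum \<phi> ?T + openleafsum (\<lambda>k c. \<Sum>q\<le>length c. \<beta> k q c) ?T"
      using sum_pdest[of \<beta> ?T] unfolding size by (simp add: sum.distrib algebra_simps)
    finally have "(\<Sum>r\<le>t. measure_pmf.expectation (law \<sigma> r) (\<lambda>p. ?F (succ_state \<sigma> r p))) / (real t + 1) \<le>
        ((real t + 1) * leafsum \<phi> ?T + openleafsum (\<lambda>k c. \<Sum>q\<le>length c. \<beta> k q c) ?T) / (real t + 1)"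
      by (intro divide_right_mono) auto
    also have "\<dots> = leafsum \<phi> ?T + openleafsum (\<lambda>k c. \<Sum>q\<le>length c. \<beta> k q c) ?T / (real t + 1)"
      by (simp add: field_simps)
    finally show ?thesis using True by simp
  qed
qed

end

section \<open>Long occupied runs\<close>

definition norun :: "nat \<Rightarrow> nat \<Rightarrow> nat \<Rightarrow> nat list \<Rightarrow> bool" where
  "norun w L k c \<longleftrightarrow> (\<forall>a. a + L \<le> w \<longrightarrow> \<not> {k+a<..k+a+L} \<subseteq> set c)"

text \<open>Some window of \<open>L\<close> consecutive positions around the target lies in the
  block and contains a free position; a block of at most \<open>2 * L\<close> positions is covered
  by its size alone.\<close>

lemma nearest_dist:
  assumes "norun w L k c" "L \<ge> 1" "1 \<le> z" "z \<le> int w"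
    and p: "p \<in> nearest ({k+1..k+w} - set c) (int k + z)"
  shows "\<bar>int p - (int k + z)\<bar> \<le> 2 * int L"
proof (cases "w \<le> 2 * L")
  case True
  have "p \<in> {k+1..k+w}" using p by (auto simp: nearest_def)
  then show ?thesis using True assms by auto
next
  case False
  obtain z' where z': "z = int z'" using assms(3) by (metis nonneg_int_cases order_trans zero_le_one)
  \<comment> \<open>The window starts at the target if it fits into the block and ends there
    otherwise; \<open>2 * L < w\<close> keeps the second subtraction from truncating.\<close>
  define a where "a = (if z' + L \<le> w + 1 then z' - 1 else z' - L)"
  have a: "a + L \<le> w" "z' \<le> a + L" "a < z'"
    using False assms(2-4) by (auto simp: a_def z')
  then obtain p0 where p0: "p0 \<in> {k+a<..k+a+L}" "p0 \<notin> set c"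
    using assms(1) unfolding norun_def by blast
  then have "p0 \<in> {k+1..k+w} - set c" using a by auto
  then have "\<bar>int p - (int k + z)\<bar> \<le> \<bar>int p0 - (int k + z)\<bar>"
    using p by (auto simp: nearest_def)
  also have "\<dots> \<le> 2 * int L" using p0 a by (auto simp: z')
  finally show ?thesis .
qed

definition isolated :: "nat \<Rightarrow> nat \<Rightarrow> nat \<Rightarrow> nat \<Rightarrow> nat list \<Rightarrow> bool" where
  "isolated w k a b c \<longleftrightarrow> (a = 0 \<or> k + a \<notin> set c) \<and> (b = w \<or> k + b + 1 \<notin> set c)"

text \<open>As long as the two positions next to an interval are free, an element placed inside the
  interval also has its target there.  Hence the following weight, which grows by the factor 8 with
  each element placed in the interval and vanishes once a neighbouring position is taken, is a
  supermartingale.\<close>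

definition run_weight :: "nat \<Rightarrow> nat \<Rightarrow> nat \<Rightarrow> nat \<Rightarrow> nat list \<Rightarrow> real" where
  "run_weight w k a b c = (if isolated w k a b c
     then 8 ^ card (set c \<inter> {k+a<..k+b}) / (1 + 7 * real (b - a) / real w) ^ length c else 0)"

lemma run_weight_nonneg: "0 \<le> run_weight w k a b c"
  by (simp add: run_weight_def)

text \<open>The rank is still fixed here. Averaged over all ranks by
  \<open>sum_prob_dense_target_le\<close>, the last factor is at most the denominator
  \<open>1 + 7 * (b - a) / w\<close>, which is why the weight is normalised by powers of it.\<close>

lemma run_weight_step:
  assumes "dr_law w k q c P" "length c < w" "q \<le> length c" "a < b" "b \<le> w"
  shows "measure_pmf.expectation P (\<lambda>p. run_weight w k a b (ins_at q p c)) \<le>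
    run_weight w k a b c / (1 + 7 * real (b - a) / real w) *
      (1 + 7 * measure_pmf.prob (dense_target w (Suc (length c)) q) {int a<..int b})"
proof -
  let ?D = "dense_target w (Suc (length c)) q"
  define \<gamma> where "\<gamma> = 1 + 7 * real (b - a) / real w"
  have \<gamma>: "\<gamma> > 0" unfolding \<gamma>_def by (intro add_pos_nonneg) auto
  define u where "u = (\<lambda>z. run_weight w k a b c / \<gamma> * (1 + 7 * indicator {int a<..int b} z))"
  have finD: "finite (set_pmf ?D)" using assms(2,3) by (intro finite_set_dense_target) auto
  have "measure_pmf.expectation P (\<lambda>p. run_weight w k a b (ins_at q p c)) \<le> measure_pmf.expectation ?D u"
  proof (rule dr_law(3)[OF assms(1-3)])
    fix z p assume z: "z \<in> set_pmf ?D" and p: "p \<in> nearest ({k+1..k+w} - set c) (int k + z)"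
    have zr: "1 \<le> z" "z \<le> int w" using set_dense_target_range[OF _ _ z] assms(2,3) by auto
    have pR: "p \<in> {k+1..k+w} - set c" using p by (simp add: nearest_def)
    have near: "\<bar>int p - (int k + z)\<bar> \<le> \<bar>int p' - (int k + z)\<bar>" if "p' \<in> {k+1..k+w} - set c" for p'
      using p that by (auto simp: nearest_def)
    have nn: "0 \<le> u z" unfolding u_def using \<gamma> run_weight_nonneg by simp
    show "run_weight w k a b (ins_at q p c) \<le> u z"
    proof (cases "isolated w k a b (ins_at q p c)")
      case False
      then show ?thesis using nn by (simp add: run_weight_def)
    next
      case True
      then have iso: "isolated w k a b c" by (auto simp: isolated_def)
      let ?n = "card (set c \<inter> {k+a<..k+b})"
      have new: "run_weight w k a b (ins_at q p c) =
          8 ^ card (set (ins_at q p c) \<inter> {k+a<..k+b}) / \<gamma> ^ length c / \<gamma>"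
        using True by (simp add: run_weight_def \<gamma>_def)
      have old: "run_weight w k a b c = 8 ^ ?n / \<gamma> ^ length c"
        using iso by (simp add: run_weight_def \<gamma>_def)
      show ?thesis
      proof (cases "p \<in> {k+a<..k+b}")
        case False
        then have "set (ins_at q p c) \<inter> {k+a<..k+b} = set c \<inter> {k+a<..k+b}" by auto
        then show ?thesis unfolding new u_def old using \<gamma>
          by (auto simp: indicator_def intro!: divide_right_mono)
      next
        case p: True
        \<comment> \<open>Otherwise the free neighbour \<open>k + a\<close> would be strictly nearer
          to the target than \<open>p\<close>. If \<open>a = 0\<close> there is no such neighbour,
          but also no target that far left.\<close>
        have "\<not> z \<le> int a"
        proof
          assume "z \<le> int a"
          then have "k + a \<in> {k+1..k+w} - set c"
            using iso zr assms(4,5) by (auto simp: isolated_def)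
          from near[OF this] show False using p \<open>z \<le> int a\<close> by auto
        qed
        moreover have "\<not> int b < z"
        proof
          assume "int b < z"
          then have "k + b + 1 \<in> {k+1..k+w} - set c"
            using iso zr assms(4,5) by (auto simp: isolated_def)
          from near[OF this] show False using p \<open>int b < z\<close> by auto
        qed
        ultimately have zI: "z \<in> {int a<..int b}" by auto
        have "set (ins_at q p c) \<inter> {k+a<..k+b} = insert p (set c \<inter> {k+a<..k+b})" using p by auto
        then have "card (set (ins_at q p c) \<inter> {k+a<..k+b}) = Suc ?n" using pR by simp
        then show ?thesis unfolding new u_def old using zI by (simp add: mult.commute)
      qed
    qed
  qed
  also have "measure_pmf.expectation ?D u = run_weight w k a b c / \<gamma> *
      (1 + 7 * measure_pmf.prob ?D {int a<..int b})"
    unfolding u_def by (simp add: expectation_add_finite[OF finD])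
  finally show ?thesis by (simp add: \<gamma>_def)
qed

definition long_intervals :: "nat \<Rightarrow> nat \<Rightarrow> (nat \<times> nat) set" where
  "long_intervals w L = {(a, b). a < b \<and> b \<le> w \<and> L \<le> b - a}"

text \<open>The factors \<open>exp (- (b - a))\<close> pay for the union over all intervals: an
  empty block starts with at most \<open>(w + 1)^2 * exp (- L)\<close>.\<close>

definition run_potential :: "nat \<Rightarrow> nat \<Rightarrow> nat \<Rightarrow> nat list \<Rightarrow> real" where
  "run_potential w L k c =
     (\<Sum>(a, b)\<in>long_intervals w L. exp (- real (b - a)) * run_weight w k a b c)"

lemma long_intervals_subset: "long_intervals w L \<subseteq> {..w} \<times> {..w}"
  by (auto simp: long_intervals_def)

lemma finite_long_intervals: "finite (long_intervals w L)"
  by (rule finite_subset[OF long_intervals_subset]) simp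

lemma run_potential_nonneg: "0 \<le> run_potential w L k c"
  unfolding run_potential_def by (intro sum_nonneg) (auto simp: run_weight_nonneg)

lemma run_potential_empty: "run_potential w L k [] \<le> (real w + 1)\<^sup>2 * exp (- real L)"
proof -
  have "run_potential w L k [] \<le> (\<Sum>(a, b)\<in>long_intervals w L. exp (- real L))"
    unfolding run_potential_def
    by (intro sum_mono) (auto simp: run_weight_def isolated_def long_intervals_def)
  also have "\<dots> = real (card (long_intervals w L)) * exp (- real L)"
    by (simp add: case_prod_unfold)
  also have "card (long_intervals w L) \<le> card ({..w} \<times> {..w})"
    by (rule card_mono[OF _ long_intervals_subset]) simp
  then have "real (card (long_intervals w L)) \<le> real (card ({..w} \<times> {..w}))"
    by (rule of_nat_mono)
  then have "real (card (long_intervals w L)) \<le> (real w + 1)\<^sup>2"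
    by (simp add: power2_eq_square card_cartesian_product algebra_simps)
  finally show ?thesis by (simp add: mult_right_mono)
qed

lemma exp2_le_8: "exp 2 \<le> (8::real)"
proof -
  have "exp 2 = (exp 1 :: real)\<^sup>2" by (simp flip: exp_of_nat_mult add: exp_double)
  also have "\<dots> \<le> (272 / 100)\<^sup>2" using e_less_272 by (intro power_mono) auto
  also have "\<dots> \<le> 8" by (simp add: power2_eq_square)
  finally show ?thesis .
qed

text \<open>A maximal occupied run containing the given one is isolated and completely filled. Its
  single term already reaches 1: \<open>8 ^ l\<close> outweighs \<open>exp l\<close> from the
  potential and at most \<open>exp l\<close> from the normalisation.\<close>

lemma run_potential_ge_1:
  assumes "\<not> norun w L k c" "7 * length c \<le> w" "L \<ge> 1"
  shows "1 \<le> run_potential w L k c"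
proof -
  obtain a0 where a0: "a0 + L \<le> w" "{k+a0<..k+a0+L} \<subseteq> set c"
    using assms(1) unfolding norun_def by blast
  \<comment> \<open>The run is extended first to the left as far as possible, then to the right;
    extremality frees the adjacent positions unless the end of the block is reached.\<close>
  define a where "a = (LEAST a. {k+a<..k+a0+L} \<subseteq> set c)"
  have a: "{k+a<..k+a0+L} \<subseteq> set c" unfolding a_def using a0(2) by (rule LeastI)
  have a_le: "a \<le> a0" unfolding a_def using a0(2) by (rule Least_le)
  have a_free: "k + a \<notin> set c" if "a \<noteq> 0"
  proof
    assume "k + a \<in> set c"
    moreover have "{k+(a-1)<..k+a0+L} = insert (k+a) {k+a<..k+a0+L}" using that a_le by auto
    ultimately have "{k+(a-1)<..k+a0+L} \<subseteq> set c" using a by auto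
    then have "a \<le> a - 1" unfolding a_def by (rule Least_le)
    then show False using that by simp
  qed
  define B where "B = {b. b \<le> w \<and> {k+a<..k+b} \<subseteq> set c}"
  have finB: "finite B" and B0: "a0 + L \<in> B" unfolding B_def using a0 a by (auto simp: add.assoc)
  define b where "b = Max B"
  have b: "b \<in> B" and b_ge: "a0 + L \<le> b"
    unfolding b_def using finB B0 by (auto intro!: Max_in)
  have b_free: "k + b + 1 \<notin> set c" if "b \<noteq> w"
  proof
    assume "k + b + 1 \<in> set c"
    moreover have "{k+a<..k+(b+1)} = insert (k+b+1) {k+a<..k+b}" using b_ge a_le by auto
    ultimately have "b + 1 \<in> B" using b that by (auto simp: B_def)
    then show False using Max_ge[OF finB \<open>b + 1 \<in> B\<close>] by (simp add: b_def)
  qed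
  define l where "l = b - a"
  have ab: "(a, b) \<in> long_intervals w L"
    using a_le b_ge b assms(3) by (auto simp: long_intervals_def B_def)
  have "{k+a<..k+b} \<subseteq> set c" using b by (simp add: B_def)
  then have "set c \<inter> {k+a<..k+b} = {k+a<..k+b}" by auto
  then have card: "card (set c \<inter> {k+a<..k+b}) = l" by (simp add: l_def)
  have w: "w > 0" using a0(1) assms(3) by simp
  have iso: "isolated w k a b c" using a_free b_free by (auto simp: isolated_def)
  have "(1 + 7 * real l / real w) ^ length c \<le> exp (7 * real l / real w) ^ length c"
    by (intro power_mono exp_ge_add_one_self) auto
  also have "\<dots> = exp (real (length c) * (7 * real l / real w))"
    by (rule exp_of_nat_mult[symmetric])
  also have "\<dots> \<le> exp (real l)"
  proof -
    \<comment> \<open>The only place that needs the block to be filled to at most one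
      seventh.\<close>
    have "7 * real (length c) \<le> real w" using assms(2) by linarith
    then have "real l * (7 * real (length c)) \<le> real l * real w" by (intro mult_left_mono) auto
    then show ?thesis using w by (simp add: field_simps)
  qed
  finally have \<gamma>: "(1 + 7 * real l / real w) ^ length c \<le> exp (real l)" .
  have "1 \<le> (8 / exp 2 :: real) ^ l" using exp2_le_8 by (intro one_le_power) simp
  also have "\<dots> = exp (- real l) * (8 ^ l / exp (real l))"
    by (simp add: power_divide exp_minus field_simps flip: exp_of_nat_mult exp_add)
  also have "\<dots> \<le> exp (- real l) * (8 ^ l / (1 + 7 * real l / real w) ^ length c)"
    using \<gamma> w by (intro mult_left_mono divide_left_mono mult_pos_pos zero_less_power add_pos_nonneg) auto
  also have "\<dots> = exp (- real (b - a)) * run_weight w k a b c"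
    unfolding run_weight_def using iso card by (simp add: l_def)
  also have "\<dots> \<le> run_potential w L k c"
    unfolding run_potential_def
    using member_le_sum[OF ab, of "\<lambda>(a, b). exp (- real (b - a)) * run_weight w k a b c"]
    by (auto simp: run_weight_nonneg finite_long_intervals)
  finally show ?thesis .
qed

lemma leafsum_build: "leafsum \<phi> (profile pos (build w h k)) \<le> 2 ^ h * B" if "\<And>k. \<phi> k [] \<le> B"
proof (induction h arbitrary: k)
  case (Suc h)
  show ?case using Suc[of k] Suc[of "k + 2 ^ h * (w + 1)"] by (simp add: algebra_simps)
qed (simp add: that)

lemma leafsum_ge_leaf:
  assumes "\<not> leafall P T" "\<And>k c. 0 \<le> \<phi> k c" "leafall Q T" "\<And>k c. Q k c \<Longrightarrow> \<not> P k c \<Longrightarrow> x \<le> \<phi> k c"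
  shows "x \<le> leafsum \<phi> T"
  using assms(1,3)
proof (induction T)
  case (PN l q f r)
  have "0 \<le> leafsum \<phi> l" "0 \<le> leafsum \<phi> r"
    using openleafsum_le_leafsum(2)[of Q _ \<phi>] PN.prems assms(2) by auto
  then show ?case using PN by (auto intro: add_increasing add_increasing2)
qed (simp add: assms)

context general_algorithm
begin

definition short :: "nat \<Rightarrow> nat \<Rightarrow> nat list \<Rightarrow> bool" where
  "short M k c \<longleftrightarrow> length c \<le> M"

definition good :: "nat \<Rightarrow> nat \<Rightarrow> nat \<Rightarrow> nat list \<Rightarrow> bool" where
  "good M L k c \<longleftrightarrow> length c \<le> M \<and> norun w L k c"

text \<open>For a fixed rank \<open>q\<close> the drift \<open>\<beta>\<close> can be positive; only
  its sum over the \<open>length c + 1\<close> gaps of a leaf is nonpositive.\<close>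

lemma run_potential_supermartingale:
  assumes "t < m" "M < w"
  shows "measure_pmf.expectation (J (Suc t)) (\<lambda>\<sigma>. leafsum_on (short M) (run_potential w L) \<sigma>) \<le>
    measure_pmf.expectation (J t) (\<lambda>\<sigma>. leafsum_on (short M) (run_potential w L) \<sigma>)"
proof -
  define \<gamma> where "\<gamma> = (\<lambda>a b. 1 + 7 * real (b - a) / real w)"
  define W where "W = (\<lambda>k c a b. exp (- real (b - a)) * run_weight w k a b c)"
  define R where "R = (\<lambda>q (c :: nat list) a b. measure_pmf.prob (dense_target w (Suc (length c)) q) {int a<..int b})"
  define \<beta> where "\<beta> = (\<lambda>k q c. \<Sum>(a, b)\<in>long_intervals w L. W k c a b * ((1 + 7 * R q c a b) / \<gamma> a b - 1))"
  have \<gamma>: "\<gamma> a b > 0" for a b unfolding \<gamma>_def by (intro add_pos_nonneg) auto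
  have "measure_pmf.expectation (J (Suc t)) (\<lambda>\<sigma>. leafsum_on (short M) (run_potential w L) \<sigma>) \<le>
    measure_pmf.expectation (J t) (\<lambda>\<sigma>. if leafall (short M) (pr \<sigma>) then leafsum (run_potential w L) (pr \<sigma>)
       + openleafsum (\<lambda>k c. \<Sum>q\<le>length c. \<beta> k q c) (pr \<sigma>) / (real t + 1) else 0)"
  proof (rule expectation_leafsum_step[OF assms])
    fix k q c P assume c: "short M k c" "q \<le> length c" and P: "dr_law w k q c P"
    have lw: "length c < w" using c assms by (simp add: short_def)
    have fin: "finite (set_pmf P)" by (rule dr_law(2)[OF P lw c(2)])
    have "measure_pmf.expectation P (\<lambda>p. run_potential w L k (ins_at q p c)) =
       (\<Sum>(a, b)\<in>long_intervals w L. exp (- real (b - a)) * measure_pmf.expectation P (\<lambda>p. run_weight w k a b (ins_at q p c)))"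
      unfolding run_potential_def by (subst expectation_sum_finite[OF fin]) (simp add: case_prod_unfold)
    also have "\<dots> \<le> (\<Sum>(a, b)\<in>long_intervals w L. W k c a b + W k c a b * ((1 + 7 * R q c a b) / \<gamma> a b - 1))"
    proof (rule sum_mono, clarify)
      fix a b assume "(a, b) \<in> long_intervals w L"
      then have "a < b" "b \<le> w" by (auto simp: long_intervals_def)
      from run_weight_step[OF P lw c(2) this]
      have "exp (- real (b - a)) * measure_pmf.expectation P (\<lambda>p. run_weight w k a b (ins_at q p c)) \<le>
         exp (- real (b - a)) * (run_weight w k a b c / \<gamma> a b * (1 + 7 * R q c a b))"
        unfolding \<gamma>_def R_def by (intro mult_left_mono) auto
      also have "\<dots> = W k c a b + W k c a b * ((1 + 7 * R q c a b) / \<gamma> a b - 1)"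
        unfolding W_def by (simp add: algebra_simps add_divide_distrib)
      finally show "exp (- real (b - a)) * measure_pmf.expectation P (\<lambda>p. run_weight w k a b (ins_at q p c)) \<le>
        W k c a b + W k c a b * ((1 + 7 * R q c a b) / \<gamma> a b - 1)" .
    qed
    also have "\<dots> = run_potential w L k c + \<beta> k q c"
      by (simp add: run_potential_def \<beta>_def W_def case_prod_unfold sum.distrib)
    finally show "measure_pmf.expectation P (\<lambda>p. run_potential w L k (ins_at q p c)) \<le>
      run_potential w L k c + \<beta> k q c" .
  qed (auto simp: short_def run_potential_nonneg)
  also have "\<dots> \<le> measure_pmf.expectation (J t) (\<lambda>\<sigma>. leafsum_on (short M) (run_potential w L) \<sigma>)"
  proof (rule expectation_mono_finite)
    show "finite (set_pmf (J t))" using assms by (intro finite_J) simp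
    fix \<sigma>
    have "(\<Sum>q\<le>length c. \<beta> k q c) \<le> 0" for k c
    proof -
      have "(\<Sum>q\<le>length c. \<beta> k q c) = (\<Sum>(a, b)\<in>long_intervals w L.
          \<Sum>q\<le>length c. W k c a b * ((1 + 7 * R q c a b) / \<gamma> a b - 1))"
        unfolding \<beta>_def by (subst sum.swap) (simp add: case_prod_unfold)
      also have "\<dots> \<le> 0"
      proof (rule sum_nonpos, clarify)
        fix a b assume "(a, b) \<in> long_intervals w L"
        then have ab: "a < b" "b \<le> w" by (auto simp: long_intervals_def)
        have "(\<Sum>q\<le>length c. R q c a b) \<le> (real (length c) + 1) * (real_of_int (int b - int a) / real w)"
          unfolding R_def using ab by (intro sum_prob_dense_target_le) auto
        also have "real_of_int (int b - int a) = real (b - a)" using ab by (simp add: of_nat_diff)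
        finally have le: "(\<Sum>q\<le>length c. R q c a b) \<le> (real (length c) + 1) * (real (b - a) / real w)" .
        have "(\<Sum>q\<le>length c. 1 + 7 * R q c a b) = (real (length c) + 1) + 7 * (\<Sum>q\<le>length c. R q c a b)"
          by (simp add: sum.distrib sum_distrib_left)
        also have "\<dots> \<le> (real (length c) + 1) + 7 * ((real (length c) + 1) * (real (b - a) / real w))"
          using le by linarith
        also have "\<dots> = (real (length c) + 1) * \<gamma> a b"
          by (simp add: \<gamma>_def distrib_left)
        finally have "(\<Sum>q\<le>length c. 1 + 7 * R q c a b) \<le> (real (length c) + 1) * \<gamma> a b" .
        then have "(\<Sum>q\<le>length c. 1 + 7 * R q c a b) / \<gamma> a b \<le> real (length c) + 1"
          using \<gamma>[of a b] by (simp add: pos_divide_le_eq)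
        then have "(\<Sum>q\<le>length c. (1 + 7 * R q c a b) / \<gamma> a b - 1) \<le> 0"
          by (simp add: sum_subtractf sum_divide_distrib)
        then have "W k c a b * (\<Sum>q\<le>length c. (1 + 7 * R q c a b) / \<gamma> a b - 1) \<le> 0"
          unfolding W_def by (intro mult_nonneg_nonpos) (auto simp: run_weight_nonneg)
        then show "(\<Sum>q\<le>length c. W k c a b * ((1 + 7 * R q c a b) / \<gamma> a b - 1)) \<le> 0"
          by (simp add: sum_distrib_left)
      qed
      finally show ?thesis .
    qed
    then have "openleafsum (\<lambda>k c. \<Sum>q\<le>length c. \<beta> k q c) T \<le> 0" for T
      by (induction T) (auto intro: add_nonpos_nonpos)
    then show "(if leafall (short M) (pr \<sigma>) then leafsum (run_potential w L) (pr \<sigma>)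
       + openleafsum (\<lambda>k c. \<Sum>q\<le>length c. \<beta> k q c) (pr \<sigma>) / (real t + 1) else 0) \<le>
       (leafsum_on (short M) (run_potential w L) \<sigma>)"
      by (auto simp: divide_nonpos_pos)
  qed
  finally show ?thesis .
qed

text \<open>Markov's inequality for the potential, whose expectation never exceeds its value on
  \<open>2 ^ h\<close> empty leaves.\<close>

lemma prob_long_run:
  assumes "t \<le> m" "7 * M \<le> w" "1 \<le> M" "1 \<le> L"
  shows "measure_pmf.prob (J t) {\<sigma>. leafall (short M) (pr \<sigma>) \<and> \<not> leafall (good M L) (pr \<sigma>)} \<le>
    2 ^ h * ((real w + 1)\<^sup>2 * exp (- real L))"
proof -
  let ?F = "\<lambda>\<sigma>. leafsum_on (short M) (run_potential w L) \<sigma>"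
  have fin: "finite (set_pmf (J t))" by (rule finite_J[OF assms(1)])
  have "measure_pmf.prob (J t) {\<sigma>. leafall (short M) (pr \<sigma>) \<and> \<not> leafall (good M L) (pr \<sigma>)} =
      measure_pmf.expectation (J t) (indicator {\<sigma>. leafall (short M) (pr \<sigma>) \<and> \<not> leafall (good M L) (pr \<sigma>)})"
    by simp
  also have "\<dots> \<le> measure_pmf.expectation (J t) ?F"
  proof (rule expectation_mono_finite[OF fin])
    fix \<sigma>
    have "1 \<le> leafsum (run_potential w L) (pr \<sigma>)"
      if "leafall (short M) (pr \<sigma>)" "\<not> leafall (good M L) (pr \<sigma>)"
    proof (rule leafsum_ge_leaf[OF that(2) run_potential_nonneg that(1)])
      fix k c assume "short M k c" "\<not> good M L k c"
      then show "1 \<le> run_potential w L k c"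
        using assms by (intro run_potential_ge_1) (auto simp: short_def good_def)
    qed
    moreover have "0 \<le> leafsum (run_potential w L) T" for T
      by (induction T) (auto simp: run_potential_nonneg)
    ultimately show "indicator {\<sigma>. leafall (short M) (pr \<sigma>) \<and> \<not> leafall (good M L) (pr \<sigma>)} \<sigma> \<le> ?F \<sigma>"
      by (auto simp: indicator_def)
  qed
  also have "\<dots> \<le> measure_pmf.expectation (J 0) ?F"
    using assms(1)
  proof (induction t)
    case (Suc t)
    then show ?case using run_potential_supermartingale[of t M L] assms(2,3) by simp
  qed simp
  also have "\<dots> \<le> 2 ^ h * ((real w + 1)\<^sup>2 * exp (- real L))"
    unfolding J_0 by (simp add: prof_def leafsum_build[where \<phi> = "run_potential w L", OF run_potential_empty])
  finally show ?thesis .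
qed

end

section \<open>Deviation of positions from ranks\<close>

lemma nth_ins_at_shift:
  assumes "q \<le> length c" "i < length c"
  shows "ins_at q p c ! shift q i = c ! i"
  using assms by (auto simp: ins_at_def shift_def nth_append Suc_diff_le)

lemma nth_ins_at_same:
  assumes "q \<le> length c"
  shows "ins_at q p c ! q = p"
  using assms by (simp add: ins_at_def nth_append)

lemma sum_ins_at:
  fixes g :: "nat \<Rightarrow> nat \<Rightarrow> real"
  assumes "q \<le> length c"
  shows "(\<Sum>j<Suc (length c). g j (ins_at q p c ! j)) = (\<Sum>i<length c. g (shift q i) (c ! i)) + g q p"
proof -
  have inj: "inj_on (shift q) {0..<length c}" by (auto simp: inj_on_def shift_def split: if_splits)
  have "(\<Sum>j<Suc (length c). g j (ins_at q p c ! j)) =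
      (\<Sum>j\<in>{0..<Suc (length c)} - {q}. g j (ins_at q p c ! j)) + g q (ins_at q p c ! q)"
    using assms by (subst sum.remove[of _ q]) (auto simp: atLeast0LessThan)
  also have "(\<Sum>j\<in>{0..<Suc (length c)} - {q}. g j (ins_at q p c ! j)) =
      (\<Sum>i<length c. g (shift q i) (c ! i))"
    unfolding shift_image[OF assms, symmetric] sum.reindex[OF inj]
    by (auto simp: nth_ins_at_shift[OF assms] atLeast0LessThan intro!: sum.cong)
  finally show ?thesis by (simp add: nth_ins_at_same[OF assms])
qed

text \<open>Relative position minus relative rank of element \<open>i\<close> in a leaf with
  \<open>K\<close> elements. The fraction \<open>(i + 1) / (K + 1)\<close> is the share of gaps to
  its left, hence the probability that the next element of this leaf is inserted before it. This is
  the Polya urn rule, so the fraction is a martingale.\<close>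

definition reldev :: "nat \<Rightarrow> nat \<Rightarrow> nat \<Rightarrow> nat \<Rightarrow> nat \<Rightarrow> real" where
  "reldev w k K i p = (real p - real k) / real w - (real i + 1) / (real K + 1)"

definition sqdev :: "nat \<Rightarrow> nat \<Rightarrow> nat list \<Rightarrow> real" where
  "sqdev w k c = (\<Sum>i<length c. (reldev w k (length c) i (c ! i))\<^sup>2)"

lemma sqdev_nonneg: "0 \<le> sqdev w k c"
  unfolding sqdev_def by (intro sum_nonneg) auto

lemma sqdev_ins_at:
  assumes "q \<le> length c"
  shows "sqdev w k (ins_at q p c) =
    (\<Sum>i<length c. (reldev w k (Suc (length c)) (shift q i) (c ! i))\<^sup>2) + (reldev w k (Suc (length c)) q p)\<^sup>2"
  unfolding sqdev_def length_ins_at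
  by (rule sum_ins_at[OF assms, of "\<lambda>i p. (reldev w k (Suc (length c)) i p)\<^sup>2"])

text \<open>After the insertion the relative rank of an old element has, in expectation, not changed; only
  its variance is added.\<close>

lemma urn_variance:
  fixes u a N :: real
  assumes "N > 0"
  shows "a * (u - (a + 1) / (N + 1))\<^sup>2 + (N - a) * (u - a / (N + 1))\<^sup>2 \<le>
    N * (u - a / N)\<^sup>2 + N / (4 * (N + 1)\<^sup>2)"
proof -
  define x v where "x = u - a / (N + 1)" and "v = a / N"
  have a: "a = v * N" using assms by (simp add: v_def)
  have "a + v = v * (N + 1)" using a by (simp add: algebra_simps)
  then have "(a + v) / (N + 1) = v" using assms by simp
  then have e1: "u - a / N = x - v / (N + 1)"
    unfolding x_def v_def[symmetric] by (simp add: add_divide_distrib)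
  have e2: "u - (a + 1) / (N + 1) = x - 1 / (N + 1)"
    by (simp add: x_def add_divide_distrib)
  have "a * (u - (a + 1) / (N + 1))\<^sup>2 + (N - a) * (u - a / (N + 1))\<^sup>2 - N * (u - a / N)\<^sup>2 =
      v * N * (x - 1 / (N + 1))\<^sup>2 + (N - v * N) * x\<^sup>2 - N * (x - v / (N + 1))\<^sup>2"
    unfolding e1 e2 x_def[symmetric] by (simp only: a)
  also have "\<dots> = N * (v - v\<^sup>2) * (1 / (N + 1))\<^sup>2"
  proof -
    have "v * N * (x - d)\<^sup>2 + (N - v * N) * x\<^sup>2 - N * (x - v * d)\<^sup>2 = N * (v - v\<^sup>2) * d\<^sup>2" for d
      by (simp add: power2_eq_square algebra_simps)
    from this[of "1 / (N + 1)"] show ?thesis by simp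
  qed
  also have "\<dots> \<le> N * (1 / 4) * (1 / (N + 1))\<^sup>2"
  proof -
    have "0 \<le> (v - 1 / 2)\<^sup>2" by simp
    then have "v - v\<^sup>2 \<le> 1 / 4" by (simp add: power2_eq_square algebra_simps)
    then show ?thesis using assms by (intro mult_right_mono mult_left_mono) auto
  qed
  also have "\<dots> = N / (4 * (N + 1)\<^sup>2)" by (simp add: power_divide)
  finally show ?thesis by simp
qed

text \<open>Of the \<open>K + 1\<close> equally likely gaps exactly the \<open>i + 1\<close> gaps
  \<open>q \<le> i\<close> raise the rank of the element, so this is \<open>urn_variance\<close>
  with \<open>a = i + 1\<close> and \<open>N = K + 1\<close>.\<close>

lemma sum_reldev_shift:
  assumes "i < K"
  shows "(\<Sum>q\<le>K. (reldev w k (Suc K) (shift q i) p)\<^sup>2) \<le>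
    (real K + 1) * (reldev w k K i p)\<^sup>2 + (real K + 1) / (4 * (real K + 2)\<^sup>2)"
proof -
  define u where "u = (real p - real k) / real w"
  have split: "{..K} = {..i} \<union> {i<..K}" using assms by auto
  have "(\<Sum>q\<le>K. (reldev w k (Suc K) (shift q i) p)\<^sup>2) =
      (\<Sum>q\<le>i. (reldev w k (Suc K) (shift q i) p)\<^sup>2) + (\<Sum>q\<in>{i<..K}. (reldev w k (Suc K) (shift q i) p)\<^sup>2)"
    unfolding split by (rule sum.union_disjoint) auto
  also have "(\<Sum>q\<le>i. (reldev w k (Suc K) (shift q i) p)\<^sup>2) = (\<Sum>q\<le>i. (u - (real i + 2) / (real K + 2))\<^sup>2)"
    by (intro sum.cong) (auto simp: shift_def reldev_def u_def add_ac)
  also have "(\<Sum>q\<in>{i<..K}. (reldev w k (Suc K) (shift q i) p)\<^sup>2) = (\<Sum>q\<in>{i<..K}. (u - (real i + 1) / (real K + 2))\<^sup>2)"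
    by (intro sum.cong) (auto simp: shift_def reldev_def u_def add_ac)
  also have "(\<Sum>q\<le>i. (u - (real i + 2) / (real K + 2))\<^sup>2) + (\<Sum>q\<in>{i<..K}. (u - (real i + 1) / (real K + 2))\<^sup>2) =
      (real i + 1) * (u - ((real i + 1) + 1) / ((real K + 1) + 1))\<^sup>2 +
      ((real K + 1) - (real i + 1)) * (u - (real i + 1) / ((real K + 1) + 1))\<^sup>2"
    using assms by (simp add: of_nat_diff add_ac)
  also have "\<dots> \<le> (real K + 1) * (u - (real i + 1) / (real K + 1))\<^sup>2 + (real K + 1) / (4 * ((real K + 1) + 1)\<^sup>2)"
    by (rule urn_variance) simp
  finally show ?thesis by (simp add: reldev_def u_def add_ac)
qed

text \<open>With \<open>N = length c + 1\<close> the new relative rank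
  \<open>(q + 1) / (N + 1)\<close> lies in the rescaled sampling interval
  \<open>[q / N, (q + 1) / N]\<close>. The ceiling adds at most \<open>1 / w\<close> and the search
  for a free position \<open>2 * L / w\<close>, and \<open>N \<le> w\<close>.\<close>

lemma reldev_new:
  assumes "norun w L k c" "L \<ge> 1" "length c < w" "q \<le> length c"
    and z: "z \<in> set_pmf (dense_target w (Suc (length c)) q)"
    and p: "p \<in> nearest ({k+1..k+w} - set c) (int k + z)"
  shows "(reldev w k (Suc (length c)) q p)\<^sup>2 \<le> (2 * (1 + real L) / (real (length c) + 1))\<^sup>2"
proof -
  define N where "N = real (length c) + 1"
  have N: "N \<ge> 1" "N \<le> real w" "real q + 1 \<le> N" using assms(3,4) by (auto simp: N_def)
  have zr: "1 \<le> z" "z \<le> int w" using set_dense_target_range[OF _ _ z] assms(3,4) by auto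
  have "\<bar>int p - (int k + z)\<bar> \<le> 2 * int L"
    by (rule nearest_dist[OF assms(1,2) zr p])
  then have d: "\<bar>real p - real k - real_of_int z\<bar> \<le> 2 * real L" by linarith
  have z1: "real q * (real w / N) < z" and z2: "real_of_int z - 1 < (real q + 1) * (real w / N)"
    using set_dense_target[OF _ _ z] assms(3) by (auto simp: N_def add.commute)
  have u: "\<bar>(real p - real k) / real w - real_of_int z / real w\<bar> \<le> 2 * real L / N"
  proof -
    have "\<bar>(real p - real k) / real w - real_of_int z / real w\<bar> = \<bar>real p - real k - real_of_int z\<bar> / real w"
      by (simp flip: diff_divide_distrib)
    also have "\<dots> \<le> 2 * real L / N" using d N by (intro frac_le) auto
    finally show ?thesis .
  qed
  have l: "real q / N \<le> real_of_int z / real w"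
    using z1 N by (simp add: field_simps)
  have r: "real_of_int z / real w \<le> (real q + 1) / N + 1 / N"
  proof -
    have "real_of_int z / real w \<le> (real q + 1) / N + 1 / real w"
      using z2 N by (simp add: field_simps)
    also have "1 / real w \<le> 1 / N" using N by (intro frac_le) auto
    finally show ?thesis by simp
  qed
  have m1: "real q / N \<le> (real q + 1) / (N + 1)" and m2: "(real q + 1) / (N + 1) \<le> (real q + 1) / N"
    using N by (auto simp: field_simps)
  have "0 \<le> 1 / N" using N by simp
  have "(real q + 1) / N = real q / N + 1 / N" by (simp add: add_divide_distrib)
  then have "\<bar>real_of_int z / real w - (real q + 1) / (N + 1)\<bar> \<le> 1 / N + 1 / N"
    using l r m1 m2 \<open>0 \<le> 1 / N\<close> by linarith
  then have "\<bar>(real p - real k) / real w - (real q + 1) / (N + 1)\<bar> \<le> 2 * real L / N + (1 / N + 1 / N)"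
    using u by linarith
  also have "\<dots> = 2 * (1 + real L) / N" by (simp add: add_divide_distrib distrib_left)
  finally have "\<bar>reldev w k (Suc (length c)) q p\<bar> \<le> 2 * (1 + real L) / (real (length c) + 1)"
    by (simp add: reldev_def N_def add_ac)
  then show ?thesis by (metis abs_ge_zero power2_abs power_mono)
qed

context general_algorithm
begin

lemma good_anti: "good M L k (ins_at q p c) \<Longrightarrow> good M L k c"
  by (auto simp: good_def norun_def)

text \<open>The factor is the number of gaps of the leaf, which is proportional to the chance that
  it receives the next element. With it the sum over the leaves is the quantity that controls the
  expected number of new inversions.\<close>

definition weighted_sqdev :: "nat \<Rightarrow> nat list \<Rightarrow> real" where
  "weighted_sqdev k c = (real (length c) + 1) * sqdev w k c"

lemma weighted_sqdev_nonneg: "0 \<le> weighted_sqdev k c"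
  by (simp add: weighted_sqdev_def sqdev_nonneg)

text \<open>When a leaf of size \<open>K\<close> grows, its factor \<open>K + 1\<close> becomes
  \<open>K + 2\<close>; a reachable leaf grows with probability \<open>(K + 1) / (t + 1)\<close>,
  which yields the relative increase \<open>1 / (t + 1)\<close>. In the constant 9, the share 8
  comes from the deviation of the new element and 1 from the urn variance of the old ones.\<close>

lemma weighted_sqdev_step:
  assumes "t < m" "M < w" "L \<ge> 1"
  defines "Z \<equiv> \<lambda>\<sigma>. leafsum_on (good M L) weighted_sqdev \<sigma>"
  shows "measure_pmf.expectation (J (Suc t)) Z \<le>
    (1 + 1 / (real t + 1)) * measure_pmf.expectation (J t) Z + 9 * (1 + real L)\<^sup>2"
proof -
  define D where "D = (\<lambda>c :: nat list. (2 * (1 + real L) / (real (length c) + 1))\<^sup>2)"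
  define old where "old = (\<lambda>k q c. \<Sum>i<length c. (reldev w k (Suc (length c)) (shift q i) (c ! i))\<^sup>2)"
  define \<beta> where "\<beta> = (\<lambda>k q c. (real (length c) + 2) * (old k q c + D c) - weighted_sqdev k c)"
  define C where "C = 9 * (1 + real L)\<^sup>2"
  have fin: "finite (set_pmf (J t))" using assms(1) by (intro finite_J) simp
  have "measure_pmf.expectation (J (Suc t)) Z \<le>
    measure_pmf.expectation (J t) (\<lambda>\<sigma>. if leafall (good M L) (pr \<sigma>) then leafsum weighted_sqdev (pr \<sigma>)
       + openleafsum (\<lambda>k c. \<Sum>q\<le>length c. \<beta> k q c) (pr \<sigma>) / (real t + 1) else 0)"
    unfolding Z_def
  proof (rule expectation_leafsum_step[OF assms(1,2)])
    fix k q c P assume c: "good M L k c" "q \<le> length c" and P: "dr_law w k q c P"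
    have lw: "length c < w" using c assms(2) by (simp add: good_def)
    have "measure_pmf.expectation P (\<lambda>p. weighted_sqdev k (ins_at q p c)) \<le>
        measure_pmf.expectation (dense_target w (Suc (length c)) q) (\<lambda>z. weighted_sqdev k c + \<beta> k q c)"
    proof (rule dr_law(3)[OF P lw c(2)])
      fix z p assume z: "z \<in> set_pmf (dense_target w (Suc (length c)) q)"
        and p: "p \<in> nearest ({k+1..k+w} - set c) (int k + z)"
      have "(reldev w k (Suc (length c)) q p)\<^sup>2 \<le> D c"
        unfolding D_def using c(1) by (intro reldev_new[OF _ assms(3) lw c(2) z p]) (simp add: good_def)
      then show "weighted_sqdev k (ins_at q p c) \<le> weighted_sqdev k c + \<beta> k q c"
        unfolding weighted_sqdev_def \<beta>_def sqdev_ins_at[OF c(2)] old_def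
        by (simp add: add_ac)
    qed
    then show "measure_pmf.expectation P (\<lambda>p. weighted_sqdev k (ins_at q p c)) \<le> weighted_sqdev k c + \<beta> k q c"
      by simp
  qed (simp add: good_def, erule good_anti, rule weighted_sqdev_nonneg)
  also have "\<dots> \<le> measure_pmf.expectation (J t) (\<lambda>\<sigma>. (1 + 1 / (real t + 1)) * Z \<sigma> + C)"
  proof (rule expectation_mono_finite[OF fin])
    fix \<sigma> assume \<sigma>: "\<sigma> \<in> set_pmf (J t)"
    have leaf: "(\<Sum>q\<le>length c. \<beta> k q c) \<le> weighted_sqdev k c + C * (real (length c) + 1)" for k c
    proof -
      define K where "K = real (length c)"
      have K: "K \<ge> 0" by (simp add: K_def)
      have "(\<Sum>q\<le>length c. old k q c) =
          (\<Sum>i<length c. \<Sum>q\<le>length c. (reldev w k (Suc (length c)) (shift q i) (c ! i))\<^sup>2)"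
        unfolding old_def by (rule sum.swap)
      also have "\<dots> \<le> (\<Sum>i<length c. (K + 1) * (reldev w k (length c) i (c ! i))\<^sup>2 + (K + 1) / (4 * (K + 2)\<^sup>2))"
        unfolding K_def by (intro sum_mono sum_reldev_shift) simp
      also have "\<dots> = (K + 1) * sqdev w k c + K * ((K + 1) / (4 * (K + 2)\<^sup>2))"
        by (simp add: sum.distrib sqdev_def sum_distrib_left K_def)
      finally have o: "(\<Sum>q\<le>length c. old k q c) \<le> (K + 1) * sqdev w k c + K * ((K + 1) / (4 * (K + 2)\<^sup>2))" .
      have e1: "(K + 2) * (K * ((K + 1) / (4 * (K + 2)\<^sup>2))) \<le> (K + 1)"
      proof -
        have "(K + 2) * (K * ((K + 1) / (4 * (K + 2)\<^sup>2))) = (K + 1) * (K / (4 * (K + 2)))"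
        proof -
          define y where "y = K + 2"
          have "y > 0" using K by (simp add: y_def)
          then show ?thesis unfolding y_def[symmetric] by (simp add: power2_eq_square)
        qed
        also have "\<dots> \<le> (K + 1) * 1" using K by (intro mult_left_mono) (auto simp: field_simps)
        finally show ?thesis by simp
      qed
      have e2: "(K + 2) * ((K + 1) * D c) \<le> 8 * (1 + real L)\<^sup>2 * (K + 1)"
      proof -
        have "(K + 2) * ((K + 1) * D c) = 4 * (1 + real L)\<^sup>2 * ((K + 2) / (K + 1))"
        proof -
          have "s * (y * (2 * B / y)\<^sup>2) = 4 * B\<^sup>2 * (s / y)" if "y > 0" for s y B :: real
            using that by (simp add: power2_eq_square)
          from this[of "K + 1" "K + 2" "1 + real L"] show ?thesis
            using K by (simp add: D_def K_def)
        qed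
        also have "\<dots> \<le> 4 * (1 + real L)\<^sup>2 * (2 * (K + 1))"
          using K by (intro mult_left_mono) (auto simp: field_simps)
        also have "\<dots> = 8 * (1 + real L)\<^sup>2 * (K + 1)" by algebra
        finally show ?thesis .
      qed
      have e3: "K + 1 \<le> (1 + real L)\<^sup>2 * (K + 1)"
      proof -
        have "1 * (K + 1) \<le> (1 + real L)\<^sup>2 * (K + 1)"
          using K by (intro mult_right_mono) (auto simp: one_le_power)
        then show ?thesis by simp
      qed
      have "(\<Sum>q\<le>length c. \<beta> k q c) = (K + 2) * ((\<Sum>q\<le>length c. old k q c) + (K + 1) * D c) - (K + 1) * ((K + 1) * sqdev w k c)"
        unfolding \<beta>_def weighted_sqdev_def K_def
        by (simp add: sum_subtractf sum.distrib sum_distrib_left[symmetric] add_ac)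
      also have "\<dots> \<le> (K + 2) * (((K + 1) * sqdev w k c + K * ((K + 1) / (4 * (K + 2)\<^sup>2))) + (K + 1) * D c) - (K + 1) * ((K + 1) * sqdev w k c)"
        using o K by (intro diff_right_mono mult_left_mono add_right_mono) auto
      also have "\<dots> = (K + 1) * sqdev w k c + (K + 2) * (K * ((K + 1) / (4 * (K + 2)\<^sup>2))) + (K + 2) * ((K + 1) * D c)"
      proof -
        have "(K + 2) * (((K + 1) * S + X) + Y) - (K + 1) * ((K + 1) * S) =
            (K + 1) * S + (K + 2) * X + (K + 2) * Y" for S X Y :: real
          by (simp add: algebra_simps)
        then show ?thesis .
      qed
      also have "\<dots> \<le> (K + 1) * sqdev w k c + C * (K + 1)"
        using e1 e2 e3 unfolding C_def by (simp add: distrib_right)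
      finally show ?thesis by (simp add: weighted_sqdev_def K_def)
    qed
    have "openleafsum (\<lambda>k c. \<Sum>q\<le>length c. \<beta> k q c) (pr \<sigma>) \<le> leafsum weighted_sqdev (pr \<sigma>) + C * (real t + 1)"
      if "leafall (good M L) (pr \<sigma>)"
    proof -
      have "openleafsum (\<lambda>k c. \<Sum>q\<le>length c. \<beta> k q c) (pr \<sigma>) \<le>
          openleafsum weighted_sqdev (pr \<sigma>) + C * openleafsum (\<lambda>k c. real (length c) + 1) (pr \<sigma>)"
        using openleafsum_mono[OF that leaf] by (simp add: openleafsum_add openleafsum_cmult)
      also have "\<dots> \<le> leafsum weighted_sqdev (pr \<sigma>) + C * (real t + 1)"
        using openleafsum_le_leafsum(1)[OF that weighted_sqdev_nonneg] openleafsum_gaps[of "pr \<sigma>"]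
        unfolding psize_pr[OF \<sigma>] by (intro add_mono mult_left_mono) (auto simp: C_def)
      finally show ?thesis .
    qed
    then have "openleafsum (\<lambda>k c. \<Sum>q\<le>length c. \<beta> k q c) (pr \<sigma>) / (real t + 1) \<le>
        (leafsum weighted_sqdev (pr \<sigma>) + C * (real t + 1)) / (real t + 1)"
      if "leafall (good M L) (pr \<sigma>)"
      using that by (intro divide_right_mono) auto
    moreover have "0 \<le> C" by (simp add: C_def)
    ultimately show "(if leafall (good M L) (pr \<sigma>) then leafsum weighted_sqdev (pr \<sigma>)
       + openleafsum (\<lambda>k c. \<Sum>q\<le>length c. \<beta> k q c) (pr \<sigma>) / (real t + 1) else 0) \<le>
       (1 + 1 / (real t + 1)) * Z \<sigma> + C"
      unfolding Z_def by (auto simp: add_divide_distrib distrib_right)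
  qed
  also have "\<dots> = (1 + 1 / (real t + 1)) * measure_pmf.expectation (J t) Z + C"
    by (simp add: expectation_add_finite[OF fin])
  finally show ?thesis by (simp add: C_def)
qed

text \<open>Divided by \<open>t + 1\<close>, the recurrence becomes a harmonic sum. Accordingly
  \<open>(t + 1) * ln (t + 1)\<close> is a supersolution, by
  \<open>ln x \<le> x - 1\<close>.\<close>

lemma weighted_sqdev_bound:
  assumes "t \<le> m" "M < w" "L \<ge> 1"
  shows "measure_pmf.expectation (J t) (\<lambda>\<sigma>. leafsum_on (good M L) weighted_sqdev \<sigma>)
    \<le> 9 * (1 + real L)\<^sup>2 * ((real t + 1) * ln (real t + 1))"
  using assms(1)
proof (induction t)
  case 0
  have "leafsum weighted_sqdev (profile pos (build w h 0)) \<le> 2 ^ h * 0" for pos :: "nat \<Rightarrow> nat"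
    by (rule leafsum_build) (simp add: weighted_sqdev_def sqdev_def)
  then show ?case by (simp add: J_0 prof_def)
next
  case (Suc t)
  define C where "C = 9 * (1 + real L)\<^sup>2"
  define Z where "Z = measure_pmf.expectation (J t) (\<lambda>\<sigma>. leafsum_on (good M L) weighted_sqdev \<sigma>)"
  have C: "C \<ge> 0" by (simp add: C_def)
  have "measure_pmf.expectation (J (Suc t)) (\<lambda>\<sigma>. leafsum_on (good M L) weighted_sqdev \<sigma>)
      \<le> (1 + 1 / (real t + 1)) * Z + C"
    unfolding Z_def C_def using Suc.prems assms(2,3) by (intro weighted_sqdev_step) auto
  also have "\<dots> \<le> (1 + 1 / (real t + 1)) * (C * ((real t + 1) * ln (real t + 1))) + C"
    using Suc unfolding Z_def C_def by (intro add_right_mono mult_left_mono) auto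
  also have "\<dots> = C * ((real t + 2) * ln (real t + 1) + 1)"
    by (simp add: field_simps)
  also have "\<dots> \<le> C * ((real t + 2) * ln (real t + 2))"
  proof (rule mult_left_mono[OF _ C])
    have "ln ((real t + 1) / (real t + 2)) \<le> (real t + 1) / (real t + 2) - 1"
      by (intro ln_le_minus_one) auto
    then have "ln (real t + 1) - ln (real t + 2) \<le> - (1 / (real t + 2))"
      by (simp add: ln_div field_simps)
    then have "(real t + 2) * (ln (real t + 1) - ln (real t + 2)) \<le> (real t + 2) * (- (1 / (real t + 2)))"
      by (intro mult_left_mono) auto
    then show "(real t + 2) * ln (real t + 1) + 1 \<le> (real t + 2) * ln (real t + 2)"
      by (simp add: right_diff_distrib)
  qed
  finally show ?case by (simp add: C_def add_ac)
qed

end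

section \<open>Inversions within the blocks\<close>

lemma card_between_le:
  fixes Y :: real
  shows "real (card {q. q \<le> K \<and> i < q \<and> real q < Y}) \<le> \<bar>Y - real i\<bar>"
proof -
  let ?n = "nat \<lfloor>\<bar>Y - real i\<bar>\<rfloor>"
  have "{q. q \<le> K \<and> i < q \<and> real q < Y} \<subseteq> {i<..i + ?n}"
  proof
    fix q assume q: "q \<in> {q. q \<le> K \<and> i < q \<and> real q < Y}"
    then have "real (q - i) \<le> \<bar>Y - real i\<bar>" by (simp add: of_nat_diff)
    then have "q - i \<le> ?n" by (simp add: le_nat_floor)
    then show "q \<in> {i<..i + ?n}" using q by auto
  qed
  then have "card {q. q \<le> K \<and> i < q \<and> real q < Y} \<le> card {i<..i + ?n}"
    by (intro card_mono) auto
  then have "card {q. q \<le> K \<and> i < q \<and> real q < Y} \<le> ?n" by simp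
  then have "real (card {q. q \<le> K \<and> i < q \<and> real q < Y}) \<le> real ?n" by (rule of_nat_mono)
  also have "\<dots> \<le> \<bar>Y - real i\<bar>" by (rule of_nat_floor) simp
  finally show ?thesis .
qed

lemma card_between_le':
  fixes Y :: real
  shows "real (card {q. q \<le> K \<and> q \<le> i \<and> Y - 1 < real q}) \<le> \<bar>Y - real i\<bar> + 2"
proof -
  let ?n = "nat \<lfloor>\<bar>Y - real i\<bar> + 1\<rfloor>"
  have "{q. q \<le> K \<and> q \<le> i \<and> Y - 1 < real q} \<subseteq> {i - ?n..i}"
  proof
    fix q assume q: "q \<in> {q. q \<le> K \<and> q \<le> i \<and> Y - 1 < real q}"
    then have "q \<le> i" "Y - 1 < real q" by auto
    then have "real (i - q) \<le> \<bar>Y - real i\<bar> + 1" by (simp add: of_nat_diff)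
    then have "i - q \<le> ?n" by (rule le_nat_floor)
    then show "q \<in> {i - ?n..i}" using q by auto
  qed
  then have "card {q. q \<le> K \<and> q \<le> i \<and> Y - 1 < real q} \<le> card {i - ?n..i}"
    by (intro card_mono) auto
  also have "\<dots> \<le> ?n + 1" by simp
  finally have "real (card {q. q \<le> K \<and> q \<le> i \<and> Y - 1 < real q}) \<le> real (?n + 1)" by (rule of_nat_mono)
  also have "\<dots> \<le> (\<bar>Y - real i\<bar> + 1) + 1"
    using of_nat_floor[of "\<bar>Y - real i\<bar> + 1"] by simp
  finally show ?thesis by simp
qed

lemma sum_card_swap:
  assumes "finite A" "finite B"
  shows "(\<Sum>q\<in>A. card {i \<in> B. P q i}) = (\<Sum>i\<in>B. card {q \<in> A. P q i})"
proof -
  have "card {i \<in> B. P q i} = (\<Sum>i\<in>B. of_bool (P q i))" for q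
    using assms by (simp add: Int_def)
  moreover have "card {q \<in> A. P q i} = (\<Sum>q\<in>A. of_bool (P q i))" for i
    using assms by (simp add: Int_def)
  ultimately show ?thesis by (simp only: sum.swap[of _ A])
qed

lemma card_positions_between:
  fixes l u :: int
  assumes "distinct c"
  shows "int (card {i. i < length c \<and> l \<le> int (c ! i) \<and> int (c ! i) < u}) \<le> max 0 (u - l)"
proof -
  have "inj_on (\<lambda>i. int (c ! i)) {i. i < length c \<and> l \<le> int (c ! i) \<and> int (c ! i) < u}"
    using assms by (auto simp: inj_on_def nth_eq_iff_index_eq)
  then have "card {i. i < length c \<and> l \<le> int (c ! i) \<and> int (c ! i) < u} \<le> card {l..<u}"
    by (rule card_inj_on_le) auto
  then show ?thesis by simp
qed

text \<open>The scale on which the sampling interval of rank \<open>q\<close> is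
  \<open>[q, q + 1]\<close>; on it, positions can be compared with ranks directly.\<close>

definition scaled_pos :: "nat \<Rightarrow> nat \<Rightarrow> nat list \<Rightarrow> nat \<Rightarrow> real" where
  "scaled_pos w k c i = (real (length c) + 1) * ((real (c ! i) - real k) / real w)"

definition new_inv_bound :: "nat \<Rightarrow> nat \<Rightarrow> nat \<Rightarrow> nat \<Rightarrow> nat list \<Rightarrow> real" where
  "new_inv_bound w L k q c =
     real (card {i \<in> {..<length c}. i < q \<and> real q < scaled_pos w k c i}) +
     real (card {i \<in> {..<length c}. q \<le> i \<and> scaled_pos w k c i - 1 < real q}) + 4 * real L"

text \<open>Inversions of the new element with respect to its target depend on its rank only through the
  displayed conditions; moving it from the target to its position affects at most \<open>2 L\<close> elements on
  either side.\<close>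

lemma inv_list_ins_at_le:
  assumes "norun w L k c" "L \<ge> 1" "length c < w" "q \<le> length c" "distinct c"
    and z: "z \<in> set_pmf (dense_target w (Suc (length c)) q)"
    and p: "p \<in> nearest ({k+1..k+w} - set c) (int k + z)"
  shows "real (inv_list (ins_at q p c)) \<le> real (inv_list c) + new_inv_bound w L k q c"
proof -
  define N where "N = real (length c) + 1"
  have N: "N > 0" by (simp add: N_def)
  have w: "real w > 0" using assms(3) by simp
  have zr: "1 \<le> z" "z \<le> int w" using set_dense_target_range[OF _ _ z] assms(3,4) by auto
  have d: "\<bar>int p - (int k + z)\<bar> \<le> 2 * int L"
    by (rule nearest_dist[OF assms(1,2) zr p])
  have z1: "real q * (real w / N) < z" and z2: "real_of_int z - 1 < (real q + 1) * (real w / N)"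
    using set_dense_target[OF _ _ z] assms(3) by (auto simp: N_def add.commute)
  have pc: "p \<notin> set c" using p by (auto simp: nearest_def)
  let ?B = "\<lambda>l u. {i. i < length c \<and> l \<le> int (c ! i) \<and> int (c ! i) < u}"
  have fin: "finite (?B l u)" for l u by (rule finite_subset[of _ "{..<length c}"]) auto
  have left: "length (filter (\<lambda>x. p < x) (take q c)) \<le>
      card {i \<in> {..<length c}. i < q \<and> real q < scaled_pos w k c i} + 2 * L"
  proof -
    have "length (filter (\<lambda>x. p < x) (take q c)) = card {i. i < q \<and> p < c ! i}"
      unfolding length_filter_conv_card using assms(4) by (auto intro!: arg_cong[where f = card])
    also have "\<dots> \<le> card ({i \<in> {..<length c}. i < q \<and> real q < scaled_pos w k c i} \<union>
        ?B (int p + 1) (int k + z + 1))"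
    proof (intro card_mono subsetI)
      fix i assume i: "i \<in> {i. i < q \<and> p < c ! i}"
      show "i \<in> {i \<in> {..<length c}. i < q \<and> real q < scaled_pos w k c i} \<union>
        ?B (int p + 1) (int k + z + 1)"
      proof (cases "int (c ! i) < int k + z + 1")
        case False
        then have "real_of_int z \<le> real (c ! i) - real k" by linarith
        then have "real q * (real w / N) < real (c ! i) - real k" using z1 by linarith
        then have "real q < N * ((real (c ! i) - real k) / real w)"
          using N w by (simp add: field_simps)
        then show ?thesis using i assms(4) by (simp add: scaled_pos_def N_def)
      qed (use i assms(4) in auto)
    qed (use fin in auto)
    also have "\<dots> \<le> card {i \<in> {..<length c}. i < q \<and> real q < scaled_pos w k c i} +
        card (?B (int p + 1) (int k + z + 1))"
      by (rule card_Un_le)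
    also have "card (?B (int p + 1) (int k + z + 1)) \<le> 2 * L"
      using card_positions_between[OF assms(5), of "int p + 1" "int k + z + 1"] d by linarith
    finally show ?thesis by simp
  qed
  have right: "length (filter (\<lambda>x. x < p) (drop q c)) \<le>
      card {i \<in> {..<length c}. q \<le> i \<and> scaled_pos w k c i - 1 < real q} + 2 * L"
  proof -
    have "length (filter (\<lambda>x. x < p) (drop q c)) = card ((+) q ` {j. j < length (drop q c) \<and> drop q c ! j < p})"
      unfolding length_filter_conv_card by (rule card_image[symmetric]) simp
    also have "\<dots> \<le> card ({i \<in> {..<length c}. q \<le> i \<and> scaled_pos w k c i - 1 < real q} \<union>
        ?B (int k + z) (int p))"
    proof (intro card_mono subsetI)
      fix i assume "i \<in> (+) q ` {j. j < length (drop q c) \<and> drop q c ! j < p}"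
      then have i: "q \<le> i" "i < length c" "c ! i < p" by auto
      show "i \<in> {i \<in> {..<length c}. q \<le> i \<and> scaled_pos w k c i - 1 < real q} \<union>
        ?B (int k + z) (int p)"
      proof (cases "int k + z \<le> int (c ! i)")
        case False
        then have "real (c ! i) - real k \<le> real_of_int z - 1" by linarith
        then have "real (c ! i) - real k < (real q + 1) * (real w / N)" using z2 by linarith
        then have "N * ((real (c ! i) - real k) / real w) < real q + 1"
          using N w by (simp add: field_simps)
        then show ?thesis using i by (simp add: scaled_pos_def N_def)
      qed (use i in auto)
    qed (use fin in auto)
    also have "\<dots> \<le> card {i \<in> {..<length c}. q \<le> i \<and> scaled_pos w k c i - 1 < real q} +
        card (?B (int k + z) (int p))"
      by (rule card_Un_le)
    also have "card (?B (int k + z) (int p)) \<le> 2 * L"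
      using card_positions_between[OF assms(5), of "int k + z" "int p"] d by linarith
    finally show ?thesis by simp
  qed
  show ?thesis
    unfolding inv_list_ins_at new_inv_bound_def using left right by linarith
qed

text \<open>Instead of old elements for each rank \<open>q\<close>, the ranks \<open>q\<close>
  between \<open>i\<close> and the scaled position \<open>Y i\<close> are counted for each old
  element: about \<open>2 * \<bar>Y i - i\<bar>\<close>, hence
  \<open>2 * (K + 1) * \<bar>\<delta> i\<bar>\<close>. The parameter \<open>lam\<close> trades this
  linear deviation for its square.\<close>

lemma sum_new_inv_bound:
  fixes lam :: real
  assumes "lam > 0" "length c \<le> M"
  shows "(\<Sum>q\<le>length c. new_inv_bound w L k q c) \<le>
    lam * ((real (length c) + 1) * sqdev w k c) + (real M / lam + 4 + 4 * real L) * (real (length c) + 1)"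
proof -
  define K where "K = real (length c)"
  define Y where "Y = scaled_pos w k c"
  define \<delta> where "\<delta> = (\<lambda>i. reldev w k (length c) i (c ! i))"
  have Y: "\<bar>Y i - real i\<bar> \<le> (K + 1) * \<bar>\<delta> i\<bar> + 1" for i
  proof -
    have "(K + 1) * \<delta> i = Y i - (real i + 1)"
      by (simp add: \<delta>_def reldev_def Y_def scaled_pos_def K_def right_diff_distrib)
    then have "Y i - real i = (K + 1) * \<delta> i + 1" by simp
    moreover have "\<bar>(K + 1) * \<delta> i\<bar> = (K + 1) * \<bar>\<delta> i\<bar>" by (simp add: abs_mult K_def)
    ultimately show ?thesis by linarith
  qed
  have "(\<Sum>q\<le>length c. new_inv_bound w L k q c) =
      real (\<Sum>q\<in>{..length c}. card {i \<in> {..<length c}. i < q \<and> real q < Y i}) +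
      real (\<Sum>q\<in>{..length c}. card {i \<in> {..<length c}. q \<le> i \<and> Y i - 1 < real q}) + (K + 1) * (4 * real L)"
    by (simp add: new_inv_bound_def sum.distrib Y_def K_def add.commute)
  also have "\<dots> = (\<Sum>i<length c. real (card {q \<in> {..length c}. i < q \<and> real q < Y i}) +
      real (card {q \<in> {..length c}. q \<le> i \<and> Y i - 1 < real q})) + (K + 1) * (4 * real L)"
    by (subst (1 2) sum_card_swap) (simp_all add: sum.distrib)
  also have "\<dots> \<le> (\<Sum>i<length c. (K + 1) * (lam * (\<delta> i)\<^sup>2) + ((K + 1) / lam + 4)) + (K + 1) * (4 * real L)"
  proof (intro add_right_mono sum_mono)
    fix i
    have "real (card {q \<in> {..length c}. i < q \<and> real q < Y i}) +
      real (card {q \<in> {..length c}. q \<le> i \<and> Y i - 1 < real q}) \<le> 2 * \<bar>Y i - real i\<bar> + 2"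
      using card_between_le[of "length c" i "Y i"] card_between_le'[of "length c" i "Y i"] by simp
    also have "\<dots> \<le> (K + 1) * (2 * \<bar>\<delta> i\<bar>) + 4" using Y[of i] by simp
    also have "\<dots> \<le> (K + 1) * (lam * (\<delta> i)\<^sup>2 + 1 / lam) + 4"
    proof -
      \<comment> \<open>The weighted inequality \<open>2 * \<bar>\<delta> i\<bar> \<le> lam *
        (\<delta> i)\<^sup>2 + 1 / lam\<close>.\<close>
      have "0 \<le> (lam * \<bar>\<delta> i\<bar> - 1)\<^sup>2 / lam" using assms(1) by simp
      also have "\<dots> = lam * (\<delta> i)\<^sup>2 + 1 / lam - 2 * \<bar>\<delta> i\<bar>"
        using assms(1) by (simp add: field_simps power2_eq_square)
      finally show ?thesis by (intro add_right_mono mult_left_mono) (auto simp: K_def)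
    qed
    finally show "real (card {q \<in> {..length c}. i < q \<and> real q < Y i}) +
      real (card {q \<in> {..length c}. q \<le> i \<and> Y i - 1 < real q}) \<le>
      (K + 1) * (lam * (\<delta> i)\<^sup>2) + ((K + 1) / lam + 4)"
      by (simp add: distrib_left)
  qed
  also have "\<dots> = lam * ((K + 1) * sqdev w k c) + K * ((K + 1) / lam + 4) + (K + 1) * (4 * real L)"
    by (simp add: sum.distrib sqdev_def \<delta>_def K_def sum_distrib_left mult_ac)
  also have "K * ((K + 1) / lam + 4) \<le> (real M / lam + 4) * (K + 1)"
  proof -
    have "K * (K + 1) / lam \<le> real M * (K + 1) / lam"
      using assms by (intro divide_right_mono mult_right_mono) (auto simp: K_def)
    then show ?thesis by (simp add: distrib_left distrib_right add_divide_distrib K_def)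
  qed
  finally show ?thesis by (simp add: K_def algebra_simps)
qed

context general_algorithm
begin

lemma inversions_step:
  fixes lam :: real
  assumes "t < m" "M < w" "L \<ge> 1" "lam > 0"
  shows "measure_pmf.expectation (J (Suc t)) (\<lambda>\<sigma>. leafsum_on (good M L) (\<lambda>k c. real (inv_list c)) \<sigma>) \<le>
    measure_pmf.expectation (J t) (\<lambda>\<sigma>. leafsum_on (good M L) (\<lambda>k c. real (inv_list c)) \<sigma>) +
    lam * measure_pmf.expectation (J t) (\<lambda>\<sigma>. leafsum_on (good M L) weighted_sqdev \<sigma>) / (real t + 1) + (real M / lam + 4 + 4 * real L)"
proof -
  define C where "C = real M / lam + 4 + 4 * real L"
  define Z where "Z = (\<lambda>\<sigma>. leafsum_on (good M L) weighted_sqdev \<sigma>)"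
  define I where "I = (\<lambda>\<sigma>. leafsum_on (good M L) (\<lambda>k c. real (inv_list c)) \<sigma>)"
  have C: "C \<ge> 0" using assms(4) by (simp add: C_def)
  have fin: "finite (set_pmf (J t))" using assms(1) by (intro finite_J) simp
  have "measure_pmf.expectation (J (Suc t)) I \<le>
    measure_pmf.expectation (J t) (\<lambda>\<sigma>. if leafall (good M L) (pr \<sigma>) then leafsum (\<lambda>k c. real (inv_list c)) (pr \<sigma>)
       + openleafsum (\<lambda>k c. \<Sum>q\<le>length c. new_inv_bound w L k q c) (pr \<sigma>) / (real t + 1) else 0)"
    unfolding I_def
  proof (rule expectation_leafsum_step[OF assms(1,2)])
    fix k q c P assume c: "good M L k c" "q \<le> length c" "distinct c" and P: "dr_law w k q c P"
    have lw: "length c < w" using c assms(2) by (simp add: good_def)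
    have "measure_pmf.expectation P (\<lambda>p. real (inv_list (ins_at q p c))) \<le>
        measure_pmf.expectation (dense_target w (Suc (length c)) q) (\<lambda>z. real (inv_list c) + new_inv_bound w L k q c)"
      using c(1) by (intro dr_law(3)[OF P lw c(2)] inv_list_ins_at_le[OF _ assms(3) lw c(2,3)]) (simp_all add: good_def)
    then show "measure_pmf.expectation P (\<lambda>p. real (inv_list (ins_at q p c))) \<le> real (inv_list c) + new_inv_bound w L k q c"
      by simp
  qed (simp add: good_def, erule good_anti, simp)
  also have "\<dots> \<le> measure_pmf.expectation (J t) (\<lambda>\<sigma>. (I \<sigma> + lam / (real t + 1) * Z \<sigma>) + C)"
  proof (rule expectation_mono_finite[OF fin])
    fix \<sigma> assume \<sigma>: "\<sigma> \<in> set_pmf (J t)"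
    have "openleafsum (\<lambda>k c. \<Sum>q\<le>length c. new_inv_bound w L k q c) (pr \<sigma>) \<le>
        lam * leafsum weighted_sqdev (pr \<sigma>) + C * (real t + 1)"
      if g: "leafall (good M L) (pr \<sigma>)"
    proof -
      have "openleafsum (\<lambda>k c. \<Sum>q\<le>length c. new_inv_bound w L k q c) (pr \<sigma>) \<le>
          openleafsum (\<lambda>k c. lam * weighted_sqdev k c + C * (real (length c) + 1)) (pr \<sigma>)"
        unfolding weighted_sqdev_def C_def
        by (intro openleafsum_mono[OF g] sum_new_inv_bound assms(4)) (simp add: good_def)
      also have "\<dots> = lam * openleafsum weighted_sqdev (pr \<sigma>) + C * openleafsum (\<lambda>k c. real (length c) + 1) (pr \<sigma>)"
        by (simp only: openleafsum_add openleafsum_cmult)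
      also have "\<dots> \<le> lam * leafsum weighted_sqdev (pr \<sigma>) + C * (real t + 1)"
        using openleafsum_le_leafsum(1)[OF g weighted_sqdev_nonneg] openleafsum_gaps[of "pr \<sigma>"] C assms(4)
        unfolding psize_pr[OF \<sigma>] by (intro add_mono mult_left_mono) auto
      finally show ?thesis .
    qed
    then have "openleafsum (\<lambda>k c. \<Sum>q\<le>length c. new_inv_bound w L k q c) (pr \<sigma>) / (real t + 1) \<le>
        (lam * leafsum weighted_sqdev (pr \<sigma>) + C * (real t + 1)) / (real t + 1)"
      if "leafall (good M L) (pr \<sigma>)"
      using that by (intro divide_right_mono) auto
    then show "(if leafall (good M L) (pr \<sigma>) then leafsum (\<lambda>k c. real (inv_list c)) (pr \<sigma>)
       + openleafsum (\<lambda>k c. \<Sum>q\<le>length c. new_inv_bound w L k q c) (pr \<sigma>) / (real t + 1) else 0) \<le>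
       (I \<sigma> + lam / (real t + 1) * Z \<sigma>) + C"
      unfolding I_def Z_def using C by (auto simp: add_divide_distrib)
  qed
  also have "\<dots> = measure_pmf.expectation (J t) I + lam * measure_pmf.expectation (J t) Z / (real t + 1) + C"
    by (simp add: expectation_add_finite[OF fin])
  finally show ?thesis by (simp add: I_def Z_def C_def)
qed

lemma inversions_bound:
  assumes "t \<le> m" "M < w" "L \<ge> 1" "M \<ge> 1"
  shows "measure_pmf.expectation (J t) (\<lambda>\<sigma>. leafsum_on (good M L) (\<lambda>k c. real (inv_list c)) \<sigma>) \<le>
    real t * (sqrt (real M) * (9 * (1 + real L)\<^sup>2 * ln (real t + 1) + 1) + 4 + 4 * real L)"
  using assms(1)
proof (induction t)
  case 0
  have "leafsum (\<lambda>k c. real (inv_list c)) (profile pos (build w h 0)) \<le> 2 ^ h * 0" for pos :: "nat \<Rightarrow> nat"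
    by (rule leafsum_build) simp
  then show ?case by (simp add: J_0 prof_def)
next
  case (Suc t)
  let ?I = "\<lambda>t. measure_pmf.expectation (J t) (\<lambda>\<sigma>. leafsum_on (good M L) (\<lambda>k c. real (inv_list c)) \<sigma>)"
  define Z where "Z = measure_pmf.expectation (J t) (\<lambda>\<sigma>. leafsum_on (good M L) weighted_sqdev \<sigma>)"
  define B where "B = (\<lambda>t. sqrt (real M) * (9 * (1 + real L)\<^sup>2 * ln (real t + 1) + 1) + 4 + 4 * real L)"
  have M: "sqrt (real M) > 0" using assms(4) by simp
  have B_mono: "B t \<le> B (Suc t)"
    unfolding B_def by (intro add_mono mult_left_mono) auto
  have "Z \<le> 9 * (1 + real L)\<^sup>2 * ((real t + 1) * ln (real t + 1))"
    unfolding Z_def using Suc.prems by (intro weighted_sqdev_bound assms(2,3)) simp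
  then have "Z / (real t + 1) \<le> 9 * (1 + real L)\<^sup>2 * ln (real t + 1)"
    by (simp add: pos_divide_le_eq mult_ac)
  then have Z: "sqrt (real M) * (Z / (real t + 1)) \<le> sqrt (real M) * (9 * (1 + real L)\<^sup>2 * ln (real t + 1))"
    using M by (intro mult_left_mono) auto
  \<comment> \<open>Up to logarithmic factors a step costs \<open>lam + M / lam\<close>, which
    \<open>lam = sqrt M\<close> minimises.\<close>
  have "?I (Suc t) \<le> ?I t + sqrt (real M) * Z / (real t + 1) + (real M / sqrt (real M) + 4 + 4 * real L)"
    unfolding Z_def using Suc.prems by (intro inversions_step assms(2,3) M) simp
  also have "\<dots> \<le> real t * B t + B t"
    using Suc Z by (simp add: B_def real_div_sqrt distrib_left)
  also have "\<dots> = real (Suc t) * B t" by (simp add: distrib_right)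
  also have "\<dots> \<le> real (Suc t) * B (Suc t)" by (intro mult_left_mono B_mono) simp
  finally show ?case by (simp add: B_def)
qed

end

section \<open>Leaf sizes of a random search tree\<close>

text \<open>The first arrival becomes the root and splits the rest, so the tree can be replaced by
  recursion on the arrival order. The test \<open>\<not> y < x\<close> is that of
  \<open>descend\<close>, and 0 for the empty list is the value of \<open>0 powr s\<close>.\<close>

fun leaf_moment :: "real \<Rightarrow> nat \<Rightarrow> 'a::linorder list \<Rightarrow> real" where
  "leaf_moment s 0 xs = real (length xs) powr s"
| "leaf_moment s (Suc h) [] = 0"
| "leaf_moment s (Suc h) (x # xs) =
     leaf_moment s h (filter (\<lambda>y. y < x) xs) + leaf_moment s h (filter (\<lambda>y. \<not> y < x) xs)"

lemma grow_Block: "grow xs (Block k bs) = Block k (bs @ xs)"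
  by (induction xs arbitrary: bs) auto

lemma grow_Node_Some:
  "grow xs (Node l p (Some y) r) =
     Node (grow (filter (\<lambda>z. z < y) xs) l) p (Some y) (grow (filter (\<lambda>z. \<not> z < y) xs) r)"
  by (induction xs arbitrary: l r) (auto simp: case_prod_unfold)

lemma leaf_moment_eq_leafsum:
  assumes "distinct xs"
  shows "leaf_moment s h xs =
    leafsum (\<lambda>k c. real (length c) powr s) (profile pos (grow xs (build w h k)))"
  using assms
proof (induction s h xs arbitrary: k rule: leaf_moment.induct)
  case (1 s xs)
  then show ?case by (simp add: grow_Block distinct_card)
next
  case (2 s h)
  have "leafsum (\<lambda>k c. real (length c) powr s) (profile pos (build w h k)) = 0" for h k
    by (induction h arbitrary: k) auto
  from this[of "Suc h" k] show ?case by simp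
next
  case (3 s h x xs)
  then show ?case by (simp add: grow_Node_Some)
qed

text \<open>Comparison with the integral of \<open>x powr s\<close>, one unit interval at a time by
  the mean value theorem.\<close>

lemma sum_powr_le:
  fixes s :: real
  assumes "s > 0"
  shows "(\<Sum>i<n. real i powr s) \<le> real n powr (s + 1) / (s + 1)"
proof (induction n)
  case (Suc n)
  have "(s + 1) * real n powr s \<le> real (Suc n) powr (s + 1) - real n powr (s + 1)"
  proof (cases "n = 0")
    case False
    have "((\<lambda>x. x powr (s + 1)) has_real_derivative (s + 1) * x powr s) (at x)" if "x \<ge> real n" for x
      using that False by (auto intro!: derivative_eq_intros)
    then obtain z where z: "z > real n" "real (Suc n) powr (s + 1) - real n powr (s + 1) =
        (real (Suc n) - real n) * ((s + 1) * z powr s)"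
      using MVT2[of "real n" "real (Suc n)" "\<lambda>x. x powr (s + 1)" "\<lambda>x. (s + 1) * x powr s"] by auto
    have "real n powr s \<le> z powr s" using z(1) assms by (intro powr_mono2) auto
    then show ?thesis using z(2) assms by simp
  qed simp
  then have "real n powr s \<le> (real (Suc n) powr (s + 1) - real n powr (s + 1)) / (s + 1)"
    using assms by (simp add: pos_le_divide_eq mult.commute)
  then show ?case using Suc by (simp add: diff_divide_distrib)
qed simp

lemma bij_betw_card_less:
  fixes A :: "'a::linorder set"
  assumes "finite A"
  shows "bij_betw (\<lambda>x. card {y \<in> A. y < x}) A {..<card A}"
    and "bij_betw (\<lambda>x. card {y \<in> A. x < y}) A {..<card A}"
proof -
  let ?f = "\<lambda>x. card {y \<in> A. y < x}" and ?g = "\<lambda>x. card {y \<in> A. x < y}"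
  have f: "?f x < ?f y" and g: "?g y < ?g x" if "x \<in> A" "y \<in> A" "x < y" for x y
    using that assms by (auto intro!: psubset_card_mono)
  have injf: "inj_on ?f A" and injg: "inj_on ?g A"
    using f g by (metis (mono_tags, lifting) inj_onI less_irrefl linorder_neqE)+
  have "?f x < card A" "?g x < card A" if "x \<in> A" for x
    using that assms by (auto intro!: psubset_card_mono)
  then have "?f ` A \<subseteq> {..<card A}" "?g ` A \<subseteq> {..<card A}" by auto
  moreover have "card (?f ` A) = card A" "card (?g ` A) = card A"
    using injf injg by (simp_all add: card_image)
  ultimately have "?f ` A = {..<card A}" "?g ` A = {..<card A}"
    by (simp_all add: card_subset_eq)
  then show "bij_betw ?f A {..<card A}" "bij_betw ?g A {..<card A}"
    using injf injg by (simp_all add: bij_betw_def)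
qed

lemma filter_random_permutation:
  assumes "finite A"
  shows "map_pmf (filter P) (pmf_of_set (permutations_of_set A)) = pmf_of_set (permutations_of_set {x\<in>A. P x})"
proof -
  have "map_pmf (filter P) (pmf_of_set (permutations_of_set A)) =
      map_pmf fst (map_pmf (partition P) (pmf_of_set (permutations_of_set A)))"
    by (simp add: map_pmf_comp o_def)
  also have "\<dots> = pmf_of_set (permutations_of_set {x\<in>A. P x})"
    unfolding partition_random_permutations[OF assms] by (rule map_fst_pair_pmf)
  finally show ?thesis .
qed

text \<open>The root has uniform rank and both subsequences are again uniformly ordered, so each
  level contributes the factor \<open>2 / (s + 1)\<close>: twice the average of
  \<open>i powr s\<close> over \<open>i < n\<close> is at most
  \<open>2 / (s + 1) * n powr s\<close>.\<close>

lemma expectation_leaf_moment: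
  fixes A :: "'a::linorder set" and s :: real
  assumes "finite A" "s > 0"
  shows "measure_pmf.expectation (pmf_of_set (permutations_of_set A)) (leaf_moment s h)
    \<le> real (card A) powr s * (2 / (s + 1)) ^ h"
  using assms(1)
proof (induction h arbitrary: A)
  case 0
  have "measure_pmf.expectation (pmf_of_set (permutations_of_set A)) (leaf_moment s 0) =
      measure_pmf.expectation (pmf_of_set (permutations_of_set A)) (\<lambda>_. real (card A) powr s)"
    using 0 by (intro expectation_cong_pmf) (auto dest: length_finite_permutations_of_set)
  also have "\<dots> = real (card A) powr s" by simp
  finally show ?case by (simp only: power_0 mult_1_right order_refl)
next
  case (Suc h)
  show ?case
  proof (cases "A = {}")
    case True
    then show ?thesis by (simp add: pmf_of_set_singleton)
  next
    case False
    define \<rho> where "\<rho> = 2 / (s + 1)"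
    have \<rho>: "\<rho> > 0" using assms(2) by (simp add: \<rho>_def)
    define n where "n = card A"
    have n: "n > 0" using False Suc.prems by (simp add: n_def card_gt_0_iff)
    have fin: "finite (set_pmf (pmf_of_set (permutations_of_set B)))" if "finite B" for B :: "'a set"
      using that by simp
    have IH: "measure_pmf.expectation (pmf_of_set (permutations_of_set (A - {x}))) (\<lambda>xs. leaf_moment s h (filter P xs))
        \<le> real (card {y \<in> A - {x}. P y}) powr s * \<rho> ^ h" for x P
    proof -
      have "measure_pmf.expectation (pmf_of_set (permutations_of_set (A - {x}))) (\<lambda>xs. leaf_moment s h (filter P xs)) =
          measure_pmf.expectation (map_pmf (filter P) (pmf_of_set (permutations_of_set (A - {x})))) (leaf_moment s h)"
        by simp
      also have "\<dots> \<le> real (card {y \<in> A - {x}. P y}) powr s * \<rho> ^ h"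
        unfolding filter_random_permutation[OF finite_Diff[OF Suc.prems]] \<rho>_def
        using Suc.prems by (intro Suc.IH) auto
      finally show ?thesis .
    qed
    have "measure_pmf.expectation (pmf_of_set (permutations_of_set A)) (leaf_moment s (Suc h)) =
        (\<Sum>x\<in>A. measure_pmf.expectation (pmf_of_set (permutations_of_set (A - {x})) \<bind> (\<lambda>xs. return_pmf (x # xs)))
           (leaf_moment s (Suc h)) /\<^sub>R real n)"
      unfolding random_permutation_of_set[OF Suc.prems False] n_def
      by (rule pmf_expectation_bind_pmf_of_set[OF False Suc.prems]) (use Suc.prems in \<open>auto simp: set_bind_pmf\<close>)
    also have "\<dots> = (\<Sum>x\<in>A. measure_pmf.expectation (pmf_of_set (permutations_of_set (A - {x})))
        (\<lambda>xs. leaf_moment s h (filter (\<lambda>y. y < x) xs) + leaf_moment s h (filter (\<lambda>y. \<not> y < x) xs))) / real n"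
      using Suc.prems by (subst expectation_bind_finite) (auto simp: divide_inverse mult.commute sum_distrib_left)
    also have "\<dots> \<le> (\<Sum>x\<in>A. (real (card {y \<in> A. y < x}) powr s + real (card {y \<in> A. x < y}) powr s) * \<rho> ^ h) / real n"
    proof (intro divide_right_mono sum_mono)
      fix x assume "x \<in> A"
      have "{y \<in> A - {x}. y < x} = {y \<in> A. y < x}" "{y \<in> A - {x}. \<not> y < x} = {y \<in> A. x < y}" by auto
      then show "measure_pmf.expectation (pmf_of_set (permutations_of_set (A - {x})))
        (\<lambda>xs. leaf_moment s h (filter (\<lambda>y. y < x) xs) + leaf_moment s h (filter (\<lambda>y. \<not> y < x) xs))
        \<le> (real (card {y \<in> A. y < x}) powr s + real (card {y \<in> A. x < y}) powr s) * \<rho> ^ h"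
        using IH[of x "\<lambda>y. y < x"] IH[of x "\<lambda>y. \<not> y < x"] Suc.prems
        by (subst expectation_add_finite) (auto simp: distrib_right intro!: fin)
    qed simp
    also have "\<dots> = ((\<Sum>x\<in>A. real (card {y \<in> A. y < x}) powr s) + (\<Sum>x\<in>A. real (card {y \<in> A. x < y}) powr s)) * \<rho> ^ h / real n"
      by (simp only: sum.distrib sum_distrib_right[symmetric])
    also have "(\<Sum>x\<in>A. real (card {y \<in> A. y < x}) powr s) = (\<Sum>i<n. real i powr s)"
      unfolding n_def using sum.reindex_bij_betw[OF bij_betw_card_less(1)[OF Suc.prems], of "\<lambda>i. real i powr s"] .
    also have "(\<Sum>x\<in>A. real (card {y \<in> A. x < y}) powr s) = (\<Sum>i<n. real i powr s)"
      unfolding n_def using sum.reindex_bij_betw[OF bij_betw_card_less(2)[OF Suc.prems], of "\<lambda>i. real i powr s"] .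
    also have "((\<Sum>i<n. real i powr s) + (\<Sum>i<n. real i powr s)) * \<rho> ^ h / real n \<le>
        (real n powr (s + 1) / (s + 1) + real n powr (s + 1) / (s + 1)) * \<rho> ^ h / real n"
      using \<rho> by (intro divide_right_mono mult_right_mono add_mono sum_powr_le assms(2)) auto
    also have "\<dots> = real n powr s * \<rho> ^ Suc h"
      using n by (simp add: powr_add \<rho>_def)
    finally show ?thesis by (simp add: n_def \<rho>_def)
  qed
qed

context general_algorithm
begin

lemma map_fst_J: "map_pmf fst (J t) = pmf_of_set (permutations_of_set {0..<t})"
  by (simp add: joint_def map_bind_pmf bind_return_pmf')

text \<open>Markov's inequality, as a leaf exceeding \<open>M\<close> alone contributes
  \<open>(M + 1) powr s\<close> to the moment. The case \<open>M = 0\<close> bounds the probability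
  that any leaf is reached.\<close>

lemma prob_large_leaf:
  assumes "t \<le> m" "s > 0"
  shows "measure_pmf.prob (J t) {\<sigma>. \<not> leafall (short M) (pr \<sigma>)} \<le>
    real t powr s * (2 / (s + 1)) ^ h / (real M + 1) powr s"
proof -
  have fin: "finite (set_pmf (J t))" by (rule finite_J[OF assms(1)])
  have "measure_pmf.prob (J t) {\<sigma>. \<not> leafall (short M) (pr \<sigma>)} =
      measure_pmf.expectation (J t) (indicator {\<sigma>. \<not> leafall (short M) (pr \<sigma>)})"
    by simp
  also have "\<dots> \<le> measure_pmf.expectation (J t) (\<lambda>\<sigma>. leaf_moment s h (fst \<sigma>) / (real M + 1) powr s)"
  proof (rule expectation_mono_finite[OF fin])
    fix \<sigma> assume \<sigma>: "\<sigma> \<in> set_pmf (J t)"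
    interpret chain_state "fst \<sigma>" "snd \<sigma>" t by (rule chain_state_J[OF \<sigma>])
    have eq: "leaf_moment s h (fst \<sigma>) = leafsum (\<lambda>k c. real (length c) powr s) (pr \<sigma>)"
      unfolding prof_def by (rule leaf_moment_eq_leafsum[OF dist])
    have "0 \<le> leafsum (\<lambda>k c. real (length c) powr s) T" for T by (induction T) auto
    then have nn: "0 \<le> leaf_moment s h (fst \<sigma>)" unfolding eq .
    have "(real M + 1) powr s \<le> leaf_moment s h (fst \<sigma>)" if "\<not> leafall (short M) (pr \<sigma>)"
      unfolding eq
    proof (rule leafsum_ge_leaf[OF that])
      show "leafall (\<lambda>_ _. True) (pr \<sigma>)"
      proof -
        have "leafall (\<lambda>_ _. True) T" for T by (induction T) auto
        then show ?thesis .
      qed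
      fix k c assume "\<not> short M k c"
      then have "real M + 1 \<le> real (length c)" by (simp add: short_def)
      then show "(real M + 1) powr s \<le> real (length c) powr s"
        using assms(2) by (intro powr_mono2) auto
    qed simp
    then show "indicator {\<sigma>. \<not> leafall (short M) (pr \<sigma>)} \<sigma> \<le> leaf_moment s h (fst \<sigma>) / (real M + 1) powr s"
      using nn by (auto simp: indicator_def pos_le_divide_eq)
  qed
  also have "\<dots> = measure_pmf.expectation (map_pmf fst (J t)) (leaf_moment s h) / (real M + 1) powr s"
    by simp
  also have "\<dots> \<le> real t powr s * (2 / (s + 1)) ^ h / (real M + 1) powr s"
    unfolding map_fst_J using expectation_leaf_moment[OF finite_atLeastLessThan assms(2), of 0 t h]
    by (intro divide_right_mono) auto
  finally show ?thesis .
qed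

lemma inversions_le_square: "inversions xs ps \<le> length xs * length xs"
proof -
  have "inversions xs ps \<le> card ({..<length xs} \<times> {..<length xs})"
    unfolding inversions_def by (intro card_mono) auto
  then show ?thesis by (simp add: card_cartesian_product)
qed

text \<open>When \<open>Q\<close> fails, placements may have been arbitrary, so only the trivial
  bound \<open>n ^ 2\<close> is used there.\<close>

lemma expected_inversions_split:
  fixes V :: "'a::linorder set"
  assumes "finite V" "card V = n" "n \<le> m" "M \<le> w" "\<And>k c. Q k c \<Longrightarrow> length c \<le> M"
  shows "expected_inversions ch m h V \<le>
    real n ^ 2 * measure_pmf.prob (J n) {\<sigma>. \<not> leafall Q (pr \<sigma>)} +
    measure_pmf.expectation (J n) (\<lambda>\<sigma>. leafsum_on Q (\<lambda>k c. real (inv_list c)) \<sigma>)"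
proof -
  have fin: "finite (set_pmf (J n))" by (rule finite_J[OF assms(3)])
  let ?I = "\<lambda>\<sigma>. leafsum_on Q (\<lambda>k c. real (inv_list c)) \<sigma>"
  have "expected_inversions ch m h V = measure_pmf.expectation (J n) (\<lambda>\<sigma>. real (inversions (fst \<sigma>) (snd \<sigma>)))"
    unfolding expected_inversions_joint[OF assms(1,2)] by (simp add: case_prod_unfold)
  also have "\<dots> \<le> measure_pmf.expectation (J n)
      (\<lambda>\<sigma>. real n ^ 2 * indicator {\<sigma>. \<not> leafall Q (pr \<sigma>)} \<sigma> + ?I \<sigma>)"
  proof (rule expectation_mono_finite[OF fin])
    fix \<sigma> assume \<sigma>: "\<sigma> \<in> set_pmf (J n)"
    interpret chain_state "fst \<sigma>" "snd \<sigma>" n by (rule chain_state_J[OF \<sigma>])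
    show "real (inversions (fst \<sigma>) (snd \<sigma>)) \<le> real n ^ 2 * indicator {\<sigma>. \<not> leafall Q (pr \<sigma>)} \<sigma> + ?I \<sigma>"
    proof (cases "leafall Q (pr \<sigma>)")
      case True
      then have "leafall (\<lambda>k c. length c \<le> M) (pr \<sigma>)" by (rule leafall_mono) (rule assms(5))
      then show ?thesis using inversions_eq_leafsum[OF assms(4) \<sigma>] True by simp
    next
      case False
      have "real (inversions (fst \<sigma>) (snd \<sigma>)) \<le> real (n * n)"
        using inversions_le_square[of "fst \<sigma>" "snd \<sigma>"] length_xs by (intro of_nat_mono) simp
      then show ?thesis using False by (simp add: power2_eq_square)
    qed
  qed
  also have "\<dots> = real n ^ 2 * measure_pmf.prob (J n) {\<sigma>. \<not> leafall Q (pr \<sigma>)} + measure_pmf.expectation (J n) ?I"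
    by (subst expectation_add_finite[OF fin]) simp
  finally show ?thesis .
qed

lemma expected_inversions_leafless:
  fixes V :: "'a::linorder set"
  assumes "finite V" "card V = n" "n \<le> m" "s > 0"
  shows "expected_inversions ch m h V \<le> real n ^ 2 * (real n powr s * (2 / (s + 1)) ^ h)"
proof -
  let ?I = "\<lambda>\<sigma>. leafsum_on (short 0) (\<lambda>k c. real (inv_list c)) \<sigma>"
  have "leafsum (\<lambda>k c. real (inv_list c)) T = 0" if "leafall (short 0) T" for T
    using that by (induction T) (auto simp: short_def)
  then have "?I = (\<lambda>\<sigma>. 0)" by auto
  then have "measure_pmf.expectation (J n) ?I = 0" by simp
  then have "expected_inversions ch m h V \<le> real n ^ 2 * measure_pmf.prob (J n) {\<sigma>. \<not> leafall (short 0) (pr \<sigma>)}"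
    using expected_inversions_split[OF assms(1-3), of 0 "short 0"] by (simp add: short_def)
  also have "\<dots> \<le> real n ^ 2 * (real n powr s * (2 / (s + 1)) ^ h)"
    using prob_large_leaf[OF assms(3,4), of 0] by (intro mult_left_mono) auto
  finally show ?thesis .
qed

lemma expected_inversions_le:
  fixes V :: "'a::linorder set"
  assumes "finite V" "card V = n" "n \<le> m" "s > 0" "1 \<le> M" "7 * M \<le> w" "1 \<le> L"
  shows "expected_inversions ch m h V \<le>
    real n ^ 2 * (real n powr s * (2 / (s + 1)) ^ h / (real M + 1) powr s) +
    real n ^ 2 * (2 ^ h * ((real w + 1)\<^sup>2 * exp (- real L))) +
    real n * (sqrt (real M) * (9 * (1 + real L)\<^sup>2 * ln (real n + 1) + 1) + 4 + 4 * real L)"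
proof -
  let ?A = "{\<sigma>. \<not> leafall (short M) (pr \<sigma>)}"
    and ?B = "{\<sigma>. leafall (short M) (pr \<sigma>) \<and> \<not> leafall (good M L) (pr \<sigma>)}"
  have "{\<sigma>. \<not> leafall (good M L) (pr \<sigma>)} \<subseteq> ?A \<union> ?B" by auto
  then have "measure_pmf.prob (J n) {\<sigma>. \<not> leafall (good M L) (pr \<sigma>)} \<le> measure_pmf.prob (J n) (?A \<union> ?B)"
    by (intro measure_pmf.finite_measure_mono) auto
  also have "\<dots> \<le> measure_pmf.prob (J n) ?A + measure_pmf.prob (J n) ?B"
    by (intro measure_subadditive) auto
  also have "\<dots> \<le> real n powr s * (2 / (s + 1)) ^ h / (real M + 1) powr s + 2 ^ h * ((real w + 1)\<^sup>2 * exp (- real L))"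
    using assms by (intro add_mono prob_large_leaf prob_long_run) auto
  finally have bad: "real n ^ 2 * measure_pmf.prob (J n) {\<sigma>. \<not> leafall (good M L) (pr \<sigma>)} \<le>
      real n ^ 2 * (real n powr s * (2 / (s + 1)) ^ h / (real M + 1) powr s + 2 ^ h * ((real w + 1)\<^sup>2 * exp (- real L)))"
    by (rule mult_left_mono) simp
  have "expected_inversions ch m h V \<le>
    real n ^ 2 * measure_pmf.prob (J n) {\<sigma>. \<not> leafall (good M L) (pr \<sigma>)} +
    measure_pmf.expectation (J n) (\<lambda>\<sigma>. leafsum_on (good M L) (\<lambda>k c. real (inv_list c)) \<sigma>)"
    using assms by (intro expected_inversions_split[where M = M]) (auto simp: good_def)
  also have "\<dots> \<le> real n ^ 2 * (real n powr s * (2 / (s + 1)) ^ h / (real M + 1) powr s + 2 ^ h * ((real w + 1)\<^sup>2 * exp (- real L))) +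
    real n * (sqrt (real M) * (9 * (1 + real L)\<^sup>2 * ln (real n + 1) + 1) + 4 + 4 * real L)"
    using assms by (intro add_mono bad inversions_bound) auto
  finally show ?thesis by (simp only: distrib_left)
qed

end

section \<open>The exponents\<close>

text \<open>The derivative of \<open>x * ln (2 * exp 1 / x)\<close> is \<open>ln (2 / x)\<close>,
  negative beyond 2.\<close>

lemma entropy_decreasing:
  fixes a c :: real
  assumes "2 < a" "a < c"
  shows "c * ln (2 * exp 1 / c) < a * ln (2 * exp 1 / a)"
proof -
  have ln: "ln (2 * exp 1 / x) = ln 2 + 1 - ln x" if "x > 0" for x :: real
    using that by (simp add: ln_div ln_mult)
  have "ln (a / c) \<le> a / c - 1" using assms by (intro ln_le_minus_one) auto
  then have "ln a - ln c \<le> a / c - 1" using assms by (simp add: ln_div)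
  then have "c * (ln a - ln c) \<le> c * (a / c - 1)" using assms by (intro mult_left_mono) auto
  also have "\<dots> = a - c" using assms by (simp add: right_diff_distrib)
  finally have 1: "c * (ln a - ln c) \<le> a - c" .
  have "ln 2 < ln a" using assms by simp
  then have "0 < (c - a) * (ln a - ln 2)" using assms by (intro mult_pos_pos) auto
  then have "c * (ln 2 + 1 - ln c) < a * (ln 2 + 1 - ln a)"
    using 1 by (simp add: algebra_simps)
  then show ?thesis using ln[of a] ln[of c] assms by simp
qed

text \<open>At \<open>exp 1\<close> the decreasing function still has the value
  \<open>exp 1 * ln 2\<close>, more than \<open>1 / 2\<close>, so the root lies further
  right.\<close>

lemma alpha0: "alpha0 > exp 1" "alpha0 * ln (2 * exp 1 / alpha0) = 1 / 2"
proof -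
  have a: "alpha0 > 2" "1 - 2 * alpha0 * ln (2 * exp 1 / alpha0) = 0"
    using theI'[OF alpha0_ex1] unfolding alpha0_def by blast+
  then show half: "alpha0 * ln (2 * exp 1 / alpha0) = 1 / 2" by simp
  have e: "exp 1 \<ge> (2::real)" using exp_ge_add_one_self[of 1] by simp
  have "exp 1 * ln (2 * exp 1 / exp 1) = exp 1 * ln (2::real)" by simp
  moreover have "exp 1 * ln (2::real) \<ge> 2 * (2 / 3)"
    using e ln2_ge_two_thirds by (intro mult_mono) auto
  ultimately have gt: "exp 1 * ln (2 * exp 1 / exp 1 :: real) > alpha0 * ln (2 * exp 1 / alpha0)"
    using half by simp
  then have "alpha0 \<noteq> exp 1" by (metis less_irrefl)
  moreover have "\<not> alpha0 < exp 1"
    using gt entropy_decreasing[OF a(1), of "exp 1"] by (metis less_asym)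
  ultimately
  show "alpha0 > exp 1" by simp
qed

lemma exponents:
  assumes "\<alpha> > alpha0"
  shows "\<alpha> > exp 1" "g_exp \<alpha> > 0" "f_exp \<alpha> = (\<alpha> * ln 2 - 1) * g_exp \<alpha>"
    and "\<alpha> * ln (2 * exp 1 / \<alpha>) = (1 - 1 / g_exp \<alpha>) / 2"
proof -
  show "\<alpha> > exp 1" using assms alpha0(1) by simp
  have "alpha0 > 2" using alpha0(1) exp_ge_add_one_self[of 1] by simp
  from entropy_decreasing[OF this assms] have "\<alpha> * ln (2 * exp 1 / \<alpha>) < 1 / 2"
    using alpha0(2) by simp
  then have pos: "1 - 2 * \<alpha> * ln (2 * exp 1 / \<alpha>) > 0" by simp
  then show "g_exp \<alpha> > 0" by (simp add: g_exp_def)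
  show "f_exp \<alpha> = (\<alpha> * ln 2 - 1) * g_exp \<alpha>" by (simp add: f_exp_def g_exp_def)
  show "\<alpha> * ln (2 * exp 1 / \<alpha>) = (1 - 1 / g_exp \<alpha>) / 2"
    using pos by (simp add: g_exp_def)
qed

lemma ln_2_bounds: "2 / 3 \<le> ln (2::real)" "ln (2::real) \<le> 1"
  using ln2_ge_two_thirds ln_le_minus_one[of 2] by simp_all

text \<open>\<open>n^2 * n^(2e-1) * e^(-h)\<close> reaches the claimed bound, up to a constant, once
  \<open>h\<close> is about \<open>(2e + (g-1)/2) * ln n\<close>. As the height is a minimum, this
  is needed both for the prescribed height and for the cap \<open>log 2 m\<close>.\<close>

lemma exponent_large_m:
  assumes "\<alpha> > alpha0" "g_exp \<alpha> > 1"
  shows "2 * exp 1 + (g_exp \<alpha> - 1) / 2 \<le> \<alpha> * g_exp \<alpha>"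
    and "2 * exp 1 + (g_exp \<alpha> - 1) / 2 \<le> (1 + f_exp \<alpha>) / ln 2"
proof -
  define g where "g = g_exp \<alpha>"
  define e where "e = (exp 1 :: real)"
  note ex = exponents[OF assms(1), folded g_def e_def]
  have e: "e \<ge> 2" unfolding e_def using exp_ge_add_one_self[of 1] by simp
  have g: "g > 1" using assms(2) by (simp add: g_def)
  have \<alpha>: "\<alpha> > 0" using ex(1) e by simp
  have "ln (\<alpha> / (2 * e)) \<le> \<alpha> / (2 * e) - 1" using \<alpha> e by (intro ln_le_minus_one) auto
  then have l: "1 - \<alpha> / (2 * e) \<le> ln (2 * e / \<alpha>)" using \<alpha> e by (simp add: ln_div)
  have "1 / g < 1" using g by simp
  then have "0 < \<alpha> * ln (2 * e / \<alpha>)" using ex(4) by simp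
  then have "ln (2 * e / \<alpha>) > 0" using \<alpha> by (simp add: zero_less_mult_iff)
  then have lt: "\<alpha> < 2 * e" using \<alpha> e by (simp add: ln_div)
  \<comment> \<open>The right side is \<open>(\<alpha> / (2 * e)) * (2 * e - \<alpha>)\<close>, and
    \<open>\<alpha> > e\<close>.\<close>
  have "(2 * e - \<alpha>) / 2 \<le> \<alpha> * (1 - \<alpha> / (2 * e))"
  proof -
    have "e * (2 * e - \<alpha>) \<le> \<alpha> * (2 * e - \<alpha>)" using ex(1) lt by (intro mult_right_mono) auto
    then show ?thesis using e by (simp add: field_simps)
  qed
  also have "\<dots> \<le> \<alpha> * ln (2 * e / \<alpha>)" using l \<alpha> by (intro mult_left_mono) auto
  finally have "2 * e - \<alpha> \<le> 1 - 1 / g" using ex(4) by simp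
  then have "(2 * e - \<alpha>) * g \<le> (1 - 1 / g) * g" using g by (intro mult_right_mono) auto
  then have *: "2 * e * g - \<alpha> * g \<le> g - 1" using g by (simp add: left_diff_distrib)
  \<comment> \<open>This gives slope 3 in \<open>g - 1\<close>, enough to subtract
    \<open>(g - 1) / ln 2\<close>, at most \<open>3/2 * (g - 1)\<close>, for the capped
    height.\<close>
  have "4 * (g - 1) \<le> 2 * e * (g - 1)" using e g by (intro mult_right_mono) auto
  then have **: "2 * e + 3 * (g - 1) \<le> \<alpha> * g" using * by (simp add: algebra_simps)
  show "2 * exp 1 + (g_exp \<alpha> - 1) / 2 \<le> \<alpha> * g_exp \<alpha>"
  proof -
    have "2 * e + (g - 1) / 2 \<le> 2 * e + 3 * (g - 1)" using g by simp
    from order_trans[OF this **] show ?thesis by (simp only: e_def g_def)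
  qed
  have "(g - 1) / ln 2 \<le> (g - 1) / (2 / 3)" using ln_2_bounds g by (intro divide_left_mono) auto
  moreover have "2 * e + (g - 1) / 2 \<le> P - Q"
    if "2 * e + 3 * (g - 1) \<le> P" "Q \<le> (g - 1) / (2 / 3)" for P Q :: real
    using that g by argo
  ultimately have "2 * e + (g - 1) / 2 \<le> \<alpha> * g - (g - 1) / ln 2" using ** by blast
  moreover have "(1 + f_exp \<alpha>) / ln 2 = \<alpha> * g - (g - 1) / ln 2"
    unfolding ex(3) using ln_2_bounds by (simp add: field_simps)
  ultimately show "2 * exp 1 + (g_exp \<alpha> - 1) / 2 \<le> (1 + f_exp \<alpha>) / ln 2"
    by (simp only: e_def g_def)
qed

text \<open>The bound on \<open>f_exp \<alpha>\<close> keeps \<open>m\<close> polynomial in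
  \<open>n\<close>, so that a logarithmic run length suffices. The last inequality says that the cap
  \<open>log 2 m\<close> on the height is inactive.\<close>

lemma exponent_small_m:
  assumes "\<alpha> > alpha0" "g_exp \<alpha> \<le> 1"
  shows "\<alpha> \<ge> 2 * exp 1" "f_exp \<alpha> \<le> 5" "\<alpha> * g_exp \<alpha> * ln 2 \<le> 1 + f_exp \<alpha>"
proof -
  define g where "g = g_exp \<alpha>"
  define e where "e = (exp 1 :: real)"
  note ex = exponents[OF assms(1), folded g_def e_def]
  have e: "e \<ge> 2" unfolding e_def using exp_ge_add_one_self[of 1] by simp
  have e3: "e \<le> 3" unfolding e_def by (rule exp_le)
  have g: "g > 0" "g \<le> 1" using assms(2) ex(2) by (auto simp: g_def)
  have \<alpha>: "\<alpha> > 0" using ex(1) e by simp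
  have "1 / g \<ge> 1" using g by simp
  then have "\<alpha> * ln (2 * e / \<alpha>) \<le> 0" using ex(4) by simp
  then have "ln (2 * e / \<alpha>) \<le> 0" using \<alpha> by (simp add: mult_le_0_iff)
  then show ge: "\<alpha> \<ge> 2 * exp 1" using \<alpha> e by (simp add: ln_div e_def)
  have "ln (2 * e / \<alpha>) \<le> 2 * e / \<alpha> - 1" using \<alpha> e by (intro ln_le_minus_one) auto
  then have "\<alpha> * ln (2 * e / \<alpha>) \<le> \<alpha> * (2 * e / \<alpha> - 1)" using \<alpha> by (intro mult_left_mono) auto
  also have "\<dots> = 2 * e - \<alpha>" using \<alpha> by (simp add: right_diff_distrib)
  finally have 1: "1 + 2 * (\<alpha> - 2 * e) \<le> 1 / g" using ex(4) by simp
  have "\<alpha> * ln 2 \<le> \<alpha> * 1" using \<alpha> ln_2_bounds by (intro mult_left_mono) auto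
  then have "\<alpha> * ln 2 - 1 \<le> 5 * (1 + 2 * (\<alpha> - 2 * e))"
    using ge e3 unfolding e_def[symmetric] by simp
  also have "\<dots> \<le> 5 * (1 / g)" using 1 by simp
  finally have "(\<alpha> * ln 2 - 1) * g \<le> 5 * (1 / g) * g" using g by (intro mult_right_mono) auto
  then show "f_exp \<alpha> \<le> 5" unfolding ex(3) using g by simp
  show "\<alpha> * g_exp \<alpha> * ln 2 \<le> 1 + f_exp \<alpha>"
    unfolding ex(3) g_def[symmetric] using g by (simp add: algebra_simps)
qed

section \<open>Estimates for fixed \<open>n\<close> and \<open>m\<close>\<close>

locale parameters =
  fixes n m :: nat and \<alpha> lg :: real
  assumes n: "ln (real n) \<ge> 3" "n \<ge> 18"
    and lg: "ln (real n) \<le> lg" "lg \<le> 2 * ln (real n)"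
    and \<alpha>: "\<alpha> > alpha0"
    and m_eq: "real m = 9 * real n * lg * real n powr f_exp \<alpha>"
begin

abbreviation "g \<equiv> g_exp \<alpha>"
abbreviation "f \<equiv> f_exp \<alpha>"
abbreviation "h \<equiv> tree_height n m \<alpha>"

lemmas ex = exponents[OF \<alpha>]

lemma n_pos: "real n > 0" "real n \<ge> 1"
  using n by auto

lemma e_bounds: "2 \<le> exp (1::real)" "exp (1::real) \<le> 3"
  using exp_ge_add_one_self[of "1::real"] exp_le by simp_all

lemma m_ge: "real n powr (1 + f) \<le> real m"
proof -
  have "1 * (real n * real n powr f) \<le> (9 * lg) * (real n * real n powr f)"
    using n lg by (intro mult_right_mono) auto
  then show ?thesis using n_pos by (simp add: m_eq powr_add mult_ac)
qed

lemma log_m: "(1 + f) * ln (real n) / ln 2 \<le> log 2 (real m)"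
proof -
  have "ln (real n powr (1 + f)) \<le> ln (real m)" using n_pos m_ge
    by (intro ln_mono) (auto intro: less_le_trans[of 0 "real n powr (1 + f)"])
  then show ?thesis using n_pos by (simp add: log_def ln_powr divide_right_mono)
qed

lemma h_eq: "h = min (nat \<lfloor>\<alpha> * g * ln (real n)\<rfloor>) (nat \<lfloor>log 2 (real m)\<rfloor>)"
  using n_pos by (simp add: tree_height_def ln_powr mult.assoc)

lemma n_powr: "real n powr x = exp (x * ln (real n))"
  using n_pos by (simp add: powr_def)

lemma leafless_bound:
  assumes "g > 1"
  shows "real n ^ 2 * (real n powr (2 * exp 1 - 1) * (2 / ((2 * exp 1 - 1) + 1)) ^ h)
    \<le> 3 * real n powr (1.5 - 0.5 * g)"
proof -
  define y where "y = ln (real n)"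
  define B where "B = 2 * exp 1 + (g - 1) / 2"
  have y: "y \<ge> 3" using n by (simp add: y_def)
  have "B * y \<le> \<alpha> * g * y"
    unfolding B_def using exponent_large_m(1)[OF \<alpha> assms] y by (intro mult_right_mono) auto
  moreover have "B * y \<le> log 2 (real m)"
  proof -
    have "B * y \<le> (1 + f) / ln 2 * y"
      unfolding B_def using exponent_large_m(2)[OF \<alpha> assms] y by (intro mult_right_mono) auto
    then show ?thesis using log_m by (simp add: y_def)
  qed
  moreover have "x - 1 \<le> real (nat \<lfloor>x\<rfloor>)" for x :: real by linarith
  ultimately have h: "B * y - 1 \<le> real h"
    unfolding h_eq y_def[symmetric] of_nat_min by (smt (verit))
  \<comment> \<open>The exponent \<open>2 * exp 1 - 1\<close> makes the factor per level exactly
    \<open>1 / exp 1\<close>. Rounding the height down then costs a single factor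
    \<open>exp 1 \<le> 3\<close>.\<close>
  have "(2 / ((2 * exp 1 - 1) + 1)) ^ h = exp (- real h)"
    by (simp add: exp_minus power_inverse inverse_eq_divide[symmetric] flip: exp_of_nat_mult)
  also have "\<dots> \<le> exp (1 - B * y)" using h by simp
  finally have "real n ^ 2 * (real n powr (2 * exp 1 - 1) * (2 / ((2 * exp 1 - 1) + 1)) ^ h) \<le>
      real n ^ 2 * (real n powr (2 * exp 1 - 1) * exp (1 - B * y))"
    by (intro mult_left_mono) auto
  also have "\<dots> = real n powr 2 * (real n powr (2 * exp 1 - 1) * exp (1 - B * y))"
    using n_pos by simp
  also have "real n powr 2 * (real n powr (2 * exp 1 - 1) * exp (1 - B * y)) =
      exp (1 + (2 + (2 * exp 1 - 1) - B) * y)"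
    unfolding n_powr y_def[symmetric] by (simp add: algebra_simps flip: exp_add)
  also have "2 + (2 * exp 1 - 1) - B = 1.5 - 0.5 * g"
    by (simp add: B_def diff_divide_distrib)
  also have "exp (1 + (1.5 - 0.5 * g) * y) = exp 1 * real n powr (1.5 - 0.5 * g)"
    unfolding n_powr y_def[symmetric] by (simp only: exp_add)
  also have "\<dots> \<le> 3 * real n powr (1.5 - 0.5 * g)"
    using e_bounds by (intro mult_right_mono) auto
  finally show ?thesis .
qed

lemma h_small:
  assumes "g \<le> 1"
  shows "real h \<le> \<alpha> * g * ln (real n)" "\<alpha> * g * ln (real n) < real h + 1"
proof -
  have "\<alpha> * g * ln (real n) \<le> log 2 (real m)"
  proof -
    have "\<alpha> * g * ln 2 * ln (real n) \<le> (1 + f) * ln (real n)"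
      using exponent_small_m(3)[OF \<alpha> assms] n by (intro mult_right_mono) auto
    then have "\<alpha> * g * ln (real n) \<le> (1 + f) * ln (real n) / ln 2"
      by (simp add: pos_le_divide_eq mult_ac)
    then show ?thesis using log_m by simp
  qed
  then have h: "h = nat \<lfloor>\<alpha> * g * ln (real n)\<rfloor>"
    unfolding h_eq by (intro min_absorb1 nat_mono floor_mono)
  have "\<alpha> * g * ln (real n) \<ge> 0"
    using ex(1,2) e_bounds n by (intro mult_nonneg_nonneg) auto
  then show "real h \<le> \<alpha> * g * ln (real n)" "\<alpha> * g * ln (real n) < real h + 1"
    unfolding h by linarith+
qed

definition A :: real where
  "A = real n powr (1 - g) * lg"

lemma A_ge_1:
  assumes "g \<le> 1"
  shows "A \<ge> 1"
proof -
  have "1 * 1 \<le> real n powr (1 - g) * lg"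
    using assms n lg n_pos by (intro mult_mono ge_one_powr_ge_zero) auto
  then show ?thesis by (simp add: A_def)
qed

text \<open>The definitions of \<open>f\<close> and \<open>g\<close> give
  \<open>m = 9 * A * 2 powr x\<close> at the unrounded height \<open>x\<close>, and rounding it down
  at most doubles the block.\<close>

lemma block_size:
  assumes "g \<le> 1"
  shows "9 * A \<le> real m / 2 ^ h" "real m / 2 ^ h \<le> 18 * A"
proof -
  define x where "x = \<alpha> * g * ln (real n)"
  have x: "real h \<le> x" "x < real h + 1" using h_small[OF assms] by (auto simp: x_def)
  have "real n * real n powr f = real n powr (1 - g) * 2 powr x"
  proof -
    have "1 + f = (1 - g) + \<alpha> * g * ln 2" by (simp add: ex(3) algebra_simps)
    then have "real n powr (1 + f) = real n powr (1 - g) * real n powr (\<alpha> * g * ln 2)"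
      by (simp only: powr_add)
    moreover have "real n powr (\<alpha> * g * ln 2) = 2 powr x"
      using n_pos by (simp add: powr_def x_def mult_ac)
    ultimately show ?thesis using n_pos by (simp add: powr_add)
  qed
  then have m: "real m = 9 * A * 2 powr x"
    by (simp add: m_eq A_def mult_ac)
  have p: "2 powr real h \<le> 2 powr x" "2 powr x \<le> 2 powr (real h + 1)"
    using x by (intro powr_mono; simp)+
  then have p': "2 ^ h \<le> 2 powr x" "2 powr x \<le> 2 * 2 ^ h"
    by (simp_all add: powr_realpow powr_add)
  have "A \<ge> 0" using A_ge_1[OF assms] by simp
  then have "9 * A * 2 ^ h \<le> real m" "real m \<le> 9 * A * (2 * 2 ^ h)"
    unfolding m using p' by (intro mult_left_mono; simp)+
  then show "9 * A \<le> real m / 2 ^ h" "real m / 2 ^ h \<le> 18 * A"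
    by (simp_all add: pos_le_divide_eq pos_divide_le_eq mult_ac)
qed

text \<open>Rounding the quotient and removing one position cost at most 2, hence at most
  \<open>2 * A\<close> of the available \<open>9 * A\<close>.\<close>

lemma width_bounds:
  assumes "g \<le> 1"
  defines "w \<equiv> m div 2 ^ h - 1"
  shows "7 * A \<le> real w" "real w + 1 \<le> real m / 2 ^ h"
proof -
  have "real (m div 2 ^ h) = real_of_int \<lfloor>real m / 2 ^ h\<rfloor>"
    by (metis floor_divide_of_nat_eq of_int_of_nat_eq of_nat_numeral of_nat_power)
  then have d: "real m / 2 ^ h - 1 < real (m div 2 ^ h)" "real (m div 2 ^ h) \<le> real m / 2 ^ h"
    by linarith+
  have "real (m div 2 ^ h) > 8 * A" using d block_size[OF assms(1)] A_ge_1[OF assms(1)] by linarith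
  then have "m div 2 ^ h \<ge> 1" using A_ge_1[OF assms(1)] by linarith
  then have w: "real w = real (m div 2 ^ h) - 1" unfolding w_def by (simp add: of_nat_diff)
  show "7 * A \<le> real w" "real w + 1 \<le> real m / 2 ^ h"
    using w d block_size[OF assms(1)] A_ge_1[OF assms(1)] by linarith+
qed

text \<open>Rounding the height down costs the factor \<open>\<alpha> / 2\<close>, which depends on
  \<open>m\<close>. The logarithm in \<open>A\<close> absorbs it: \<open>lg \<ge> exp 1\<close>, so
  \<open>lg powr s \<ge> exp s \<ge> 1 + s = \<alpha>\<close>.\<close>

lemma overflow_bound:
  assumes "g \<le> 1" "A \<le> real M + 1"
  shows "real n ^ 2 * (real n powr (\<alpha> - 1) * (2 / ((\<alpha> - 1) + 1)) ^ h / (real M + 1) powr (\<alpha> - 1))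
    \<le> real n powr (1.5 - 0.5 * g)"
proof -
  define y where "y = ln (real n)"
  define s where "s = \<alpha> - 1"
  have \<alpha>2: "\<alpha> \<ge> 2 * exp 1" by (rule exponent_small_m(1)[OF \<alpha> assms(1)])
  then have \<alpha>4: "\<alpha> \<ge> 4" using e_bounds by simp
  have s: "s > 0" using \<alpha>4 by (simp add: s_def)
  have A: "A > 0" using A_ge_1[OF assms(1)] by simp
  have "exp 1 \<le> lg" using e_bounds n lg by linarith
  then have "exp 1 powr s \<le> lg powr s" using s by (intro powr_mono2) auto
  then have "exp s \<le> lg powr s" by (simp add: powr_def)
  moreover have "\<alpha> / 2 \<le> exp s" using exp_ge_add_one_self[of s] \<alpha>4 by (simp add: s_def)
  ultimately have lgs: "\<alpha> / 2 \<le> lg powr s" by simp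
  have lg0: "lg > 0" using n lg by simp
  have As: "A powr s = exp ((1 - g) * s * y) * lg powr s"
  proof -
    have "A powr s = real n powr ((1 - g) * s) * lg powr s"
      unfolding A_def using lg0 n_pos by (simp add: powr_mult powr_powr)
    then show ?thesis by (simp only: n_powr y_def)
  qed
  have "(2 / \<alpha>) ^ h = (2 / \<alpha>) powr real h" using \<alpha>4 by (simp add: powr_realpow)
  also have "\<dots> \<le> (2 / \<alpha>) powr (\<alpha> * g * y - 1)"
    using h_small(2)[OF assms(1)] \<alpha>4 by (intro powr_mono') (auto simp: y_def)
  also have "\<dots> = (2 / \<alpha>) powr (\<alpha> * g * y) * (\<alpha> / 2)"
    using \<alpha>4 by (simp add: powr_diff)
  also have "\<dots> = \<alpha> / 2 * exp (\<alpha> * g * y * ln (2 / \<alpha>))"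
    using \<alpha>4 by (simp add: powr_def)
  finally have h: "(2 / \<alpha>) ^ h \<le> \<alpha> / 2 * exp (\<alpha> * g * y * ln (2 / \<alpha>))" .
  have "real n ^ 2 * (real n powr s * (2 / \<alpha>) ^ h / (real M + 1) powr s) \<le>
      real n ^ 2 * (real n powr s * (2 / \<alpha>) ^ h / A powr s)"
    using assms(2) A s \<alpha>4 by (intro mult_left_mono divide_left_mono powr_mono2 mult_pos_pos) auto
  also have "\<dots> \<le> real n ^ 2 * (real n powr s * (\<alpha> / 2 * exp (\<alpha> * g * y * ln (2 / \<alpha>))) / A powr s)"
    using h by (intro mult_left_mono divide_right_mono) auto
  also have "\<dots> \<le> real n ^ 2 * (real n powr s * (lg powr s * exp (\<alpha> * g * y * ln (2 / \<alpha>))) / A powr s)"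
    using lgs by (intro mult_left_mono divide_right_mono mult_right_mono) auto
  also have "\<dots> = real n powr 2 * (real n powr s * exp (\<alpha> * g * y * ln (2 / \<alpha>)) / exp ((1 - g) * s * y))"
    unfolding As using lg0 n_pos by simp
  also have "\<dots> = exp ((2 + s + \<alpha> * g * ln (2 / \<alpha>) - (1 - g) * s) * y)"
    unfolding n_powr y_def[symmetric] by (simp add: algebra_simps exp_diff flip: exp_add) (simp add: algebra_simps flip: exp_add exp_diff)
  also have "2 + s + \<alpha> * g * ln (2 / \<alpha>) - (1 - g) * s = 1.5 - 0.5 * g"
  proof -
    have "ln (2 * exp 1 / \<alpha>) = ln (2 / \<alpha>) + 1" using \<alpha>4 by (simp add: ln_div ln_mult)
    then have "\<alpha> * ln (2 * exp 1 / \<alpha>) = \<alpha> * ln (2 / \<alpha>) + \<alpha>" by (simp add: distrib_left)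
    then have "\<alpha> * ln (2 / \<alpha>) = (1 - 1 / g) / 2 - \<alpha>" using ex(4) by (simp only: eq_diff_eq)
    then have "g * (\<alpha> * ln (2 / \<alpha>)) = g * ((1 - 1 / g) / 2 - \<alpha>)" by simp
    also have "\<dots> = (g - 1) / 2 - g * \<alpha>" using ex(2) by (simp add: field_simps)
    finally show ?thesis by (simp add: s_def algebra_simps)
  qed
  finally show ?thesis by (simp add: s_def n_powr y_def)
qed

lemma m_le:
  assumes "g \<le> 1"
  shows "real m \<le> real n powr 8"
proof -
  have "ln (real n) \<le> real n" using n_pos ln_le_minus_one[of "real n"] by simp
  then have "9 * lg \<le> 18 * real n" using lg by simp
  also have "\<dots> \<le> real n * real n" using n by (intro mult_right_mono) auto
  finally have "9 * lg \<le> real n powr 2" using n_pos by (simp add: power2_eq_square)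
  moreover have "real n powr (1 + f) \<le> real n powr 6"
    using exponent_small_m(2)[OF \<alpha> assms] n_pos by (intro powr_mono) auto
  ultimately have "9 * lg * real n powr (1 + f) \<le> real n powr 2 * real n powr 6"
    by (intro mult_mono) auto
  also have "\<dots> = real n powr 8" by (simp flip: powr_add)
  finally show ?thesis using n_pos by (simp add: m_eq powr_add mult_ac)
qed

text \<open>The union over leaves and intervals costs
  \<open>2 ^ h * (w + 1)^2 \<le> m^2 \<le> n^16\<close> and the trivial bound on inversions
  \<open>n^2\<close>; the constant 20 brings the product down to \<open>n^(-2)\<close>.\<close>

definition L :: nat where
  "L = nat \<lceil>20 * ln (real n)\<rceil>"

lemma L_bounds: "20 * ln (real n) \<le> real L" "real L \<le> 21 * ln (real n)" "1 \<le> L"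
  using n unfolding L_def by linarith+

lemma long_run_bound:
  assumes "g \<le> 1"
  defines "w \<equiv> m div 2 ^ h - 1"
  shows "real n ^ 2 * (2 ^ h * ((real w + 1)\<^sup>2 * exp (- real L))) \<le> real n powr (1.5 - 0.5 * g)"
proof -
  have "real w + 1 \<le> real m / 2 ^ h" unfolding w_def by (rule width_bounds(2)[OF assms(1)])
  then have 1: "2 ^ h * (real w + 1) \<le> real m" by (simp add: pos_le_divide_eq mult.commute)
  have "1 * (real w + 1) \<le> 2 ^ h * (real w + 1)" by (intro mult_right_mono) auto
  from order_trans[OF this 1] have 2: "real w + 1 \<le> real m" by simp
  have "2 ^ h * (real w + 1)\<^sup>2 = (2 ^ h * (real w + 1)) * (real w + 1)" by (simp add: power2_eq_square)
  also have "\<dots> \<le> real m * real m" using 1 2 by (intro mult_mono) auto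
  also have "\<dots> \<le> real n powr 8 * real n powr 8" using m_le[OF assms(1)] by (intro mult_mono) auto
  finally have 3: "2 ^ h * (real w + 1)\<^sup>2 \<le> real n powr 8 * real n powr 8" .
  have "exp (- real L) \<le> real n powr (- 20)" using L_bounds(1) by (simp add: n_powr)
  then have "(2 ^ h * (real w + 1)\<^sup>2) * exp (- real L) \<le> (real n powr 8 * real n powr 8) * real n powr (- 20)"
    by (rule mult_mono[OF 3]) auto
  then have "real n ^ 2 * ((2 ^ h * (real w + 1)\<^sup>2) * exp (- real L)) \<le>
      real n powr 2 * ((real n powr 8 * real n powr 8) * real n powr (- 20))"
    using n_pos by (simp only: powr_numeral mult_left_mono zero_le_power of_nat_0_le_iff)
  also have "\<dots> = real n powr (- 2)" by (simp only: powr_add[symmetric]) simp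
  also have "\<dots> \<le> real n powr (1.5 - 0.5 * g)" using n_pos assms(1) by (intro powr_mono) auto
  finally show ?thesis by (simp add: mult_ac)
qed

text \<open>The four logarithms: one for the factor \<open>lg\<close> in \<open>M\<close>, whose
  root is estimated crudely, two from \<open>(1 + L)\<^sup>2\<close>, and one from
  \<open>ln (n + 1)\<close>.\<close>

lemma block_inversions_bound:
  assumes "g \<le> 1" "real M \<le> 3 * A"
  shows "real n * (sqrt (real M) * (9 * (1 + real L)\<^sup>2 * ln (real n + 1) + 1) + 4 + 4 * real L)
    \<le> 59000 * real n powr (1.5 - 0.5 * g) * ln (real n) ^ 4"
proof -
  define y where "y = ln (real n)"
  define p where "p = real n powr ((1 - g) / 2)"
  have y: "y \<ge> 3" using n by (simp add: y_def)
  have p: "p \<ge> 1" unfolding p_def using n_pos assms(1) by (intro ge_one_powr_ge_zero) auto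
  have "real M \<le> 3 * (p\<^sup>2 * lg)"
    using assms(2) n_pos by (simp add: A_def p_def power2_eq_square flip: powr_add)
  also have "\<dots> \<le> 6 * (p\<^sup>2 * y)"
  proof -
    have "p\<^sup>2 * lg \<le> p\<^sup>2 * (2 * y)" using lg by (intro mult_left_mono) (auto simp: y_def)
    then have "3 * (p\<^sup>2 * lg) \<le> 3 * (p\<^sup>2 * (2 * y))" by (rule mult_left_mono) simp
    also have "\<dots> = 6 * (p\<^sup>2 * y)" by simp
    finally show ?thesis .
  qed
  also have "\<dots> \<le> (6 * y * p)\<^sup>2"
  proof -
    have "1 \<le> 6 * y" using y by simp
    then have "6 * y * p\<^sup>2 * 1 \<le> 6 * y * p\<^sup>2 * (6 * y)" using y by (intro mult_left_mono) auto
    then show ?thesis by (simp add: power_mult_distrib power2_eq_square mult_ac)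
  qed
  finally have "sqrt (real M) \<le> sqrt ((6 * y * p)\<^sup>2)" by (rule real_sqrt_le_mono)
  then have M: "sqrt (real M) \<le> 6 * y * p" using y p by simp
  have l1: "ln (real n + 1) \<le> 2 * y"
  proof -
    have "ln (real n + 1) \<le> ln (real n * real n)"
    proof (rule ln_mono)
      have "2 * real n \<le> real n * real n" using n by (intro mult_right_mono) auto
      then show "real n + 1 \<le> real n * real n" using n_pos by linarith
    qed (use n_pos in auto)
    then show ?thesis using n_pos by (simp add: ln_mult y_def)
  qed
  have L: "1 + real L \<le> 22 * y" using L_bounds y by (simp add: y_def)
  have "9 * (1 + real L)\<^sup>2 * ln (real n + 1) + 1 \<le> 9 * (22 * y)\<^sup>2 * (2 * y) + y ^ 3"
    using L l1 y n_pos by (intro add_mono mult_mono power_mono one_le_power) auto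
  \<comment> \<open>\<open>8713 = 9 * 22^2 * 2 + 1\<close>; the later \<open>52278\<close> is six
    times this.\<close>
  also have "\<dots> = 8713 * y ^ 3" by (simp add: power2_eq_square power3_eq_cube)
  finally have q: "9 * (1 + real L)\<^sup>2 * ln (real n + 1) + 1 \<le> 8713 * y ^ 3" .
  have "sqrt (real M) * (9 * (1 + real L)\<^sup>2 * ln (real n + 1) + 1) \<le> (6 * y * p) * (8713 * y ^ 3)"
    using M q y p n_pos by (intro mult_mono add_nonneg_nonneg mult_nonneg_nonneg) auto
  also have "\<dots> = 52278 * (p * y ^ 4)" by (simp add: power4_eq_xxxx power3_eq_cube)
  finally have 1: "sqrt (real M) * (9 * (1 + real L)\<^sup>2 * ln (real n + 1) + 1) \<le> 52278 * (p * y ^ 4)" .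
  have "4 + 4 * real L \<le> 88 * y" using L by simp
  also have "\<dots> \<le> 88 * (p * y ^ 4)"
  proof -
    have "1 * y \<le> p * y ^ 4" using y p self_le_power[of y 4] by (intro mult_mono) auto
    then show ?thesis by simp
  qed
  finally have "sqrt (real M) * (9 * (1 + real L)\<^sup>2 * ln (real n + 1) + 1) + 4 + 4 * real L \<le> 59000 * (p * y ^ 4)"
    using 1 y p by (smt (verit) mult_nonneg_nonneg zero_le_power)
  then have "real n * (sqrt (real M) * (9 * (1 + real L)\<^sup>2 * ln (real n + 1) + 1) + 4 + 4 * real L) \<le>
      real n * (59000 * (p * y ^ 4))"
    by (intro mult_left_mono) auto
  also have "\<dots> = 59000 * (real n powr 1 * p) * y ^ 4" using n_pos by simp
  also have "real n powr 1 * p = real n powr (1.5 - 0.5 * g)"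
    unfolding p_def powr_add[symmetric] by (simp add: diff_divide_distrib)
  finally show ?thesis by (simp add: y_def)
qed

lemma expected_inversions_bound:
  fixes V :: "'a::linorder set"
  assumes "finite V" "card V = n" "choice_rule_ok ch"
  shows "expected_inversions ch m h V \<le> 60000 * real n powr (1.5 - 0.5 * g) * ln (real n) ^ 4"
proof -
  define w where "w = m div 2 ^ h - 1"
  define X where "X = real n powr (1.5 - 0.5 * g)"
  interpret general_algorithm ch m h w
    by standard (simp_all add: assms(3) w_def)
  have X: "X \<ge> 0" by (simp add: X_def)
  have ln4: "1 \<le> ln (real n) ^ 4" using n by (intro one_le_power) auto
  have X4: "X \<le> X * ln (real n) ^ 4" using mult_left_mono[OF ln4 X] by simp
  have f0: "f \<ge> 0"
  proof -
    have "2 * (2 / 3) \<le> \<alpha> * ln 2" using ex(1) e_bounds ln_2_bounds by (intro mult_mono) auto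
    then show ?thesis unfolding ex(3) using ex(2) by simp
  qed
  have "real n powr 1 \<le> real n powr (1 + f)" using n_pos f0 by (intro powr_mono) auto
  then have nm: "n \<le> m" using m_ge n_pos by simp
  show ?thesis
  proof (cases "g > 1")
    case True
    have "expected_inversions ch m h V \<le>
        real n ^ 2 * (real n powr (2 * exp 1 - 1) * (2 / ((2 * exp 1 - 1) + 1)) ^ h)"
      using e_bounds by (intro expected_inversions_leafless[OF assms(1,2) nm]) simp
    also have "\<dots> \<le> 3 * X" unfolding X_def by (rule leafless_bound[OF True])
    also have "\<dots> \<le> 60000 * (X * ln (real n) ^ 4)" using X X4 by linarith
    finally show ?thesis by (simp add: X_def)
  next
    case False
    then have g: "g \<le> 1" by simp
    \<comment> \<open>Small enough for the run estimate, \<open>7 * M \<le> w\<close>, and large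
      enough for the overflow estimate: \<open>7 * A \<le> w < 7 * M + 7\<close> gives
      \<open>A \<le> M + 1\<close>.\<close>
    define M where "M = w div 7"
    have w: "7 * A \<le> real w" "real w + 1 \<le> 18 * A"
      using width_bounds[OF g] block_size(2)[OF g] unfolding w_def by linarith+
    have M: "7 * M \<le> w" "real w < 7 * real M + 7" unfolding M_def by linarith+
    have "w \<ge> 7" using w(1) A_ge_1[OF g] by linarith
    then have M1: "1 \<le> M" unfolding M_def by linarith
    have MA: "A \<le> real M + 1" "real M \<le> 3 * A" using M w A_ge_1[OF g] by linarith+
    have "expected_inversions ch m h V \<le>
      real n ^ 2 * (real n powr (\<alpha> - 1) * (2 / ((\<alpha> - 1) + 1)) ^ h / (real M + 1) powr (\<alpha> - 1)) +
      real n ^ 2 * (2 ^ h * ((real w + 1)\<^sup>2 * exp (- real L))) +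
      real n * (sqrt (real M) * (9 * (1 + real L)\<^sup>2 * ln (real n + 1) + 1) + 4 + 4 * real L)"
      using ex(1) e_bounds by (intro expected_inversions_le[OF assms(1,2) nm _ M1 M(1) L_bounds(3)]) simp
    also have "\<dots> \<le> X + X + 59000 * X * ln (real n) ^ 4"
      unfolding X_def w_def
      by (intro add_mono overflow_bound[OF g MA(1)] long_run_bound[OF g] block_inversions_bound[OF g MA(2)])
    also have "\<dots> \<le> 60000 * (X * ln (real n) ^ 4)" using X X4 by linarith
    finally show ?thesis by (simp add: X_def)
  qed
qed

end

text \<open>The base of the logarithm is left open: either reading lies between \<open>ln n\<close>
  and \<open>2 * ln n\<close>, which is what \<open>parameters\<close> assumes of
  \<open>lg\<close>.\<close>

theorem theorem5p1:
  fixes b :: real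
  assumes "b = 2 \<or> b = exp 1"
  shows "\<exists>(C::real) (k::nat). \<forall>\<^sub>F n::nat in sequentially.
           \<forall>(m::nat) (\<alpha>::real) (V::'a::linorder set) (ch::choice_rule).
             real m \<ge> 10 * real n * log b (real n) \<longrightarrow>
             \<alpha> > alpha0 \<longrightarrow>
             real m / (9 * real n * log b (real n)) = real n powr f_exp \<alpha> \<longrightarrow>
             finite V \<longrightarrow> card V = n \<longrightarrow>
             choice_rule_ok ch \<longrightarrow>
             expected_inversions ch m (tree_height n m \<alpha>) V
               \<le> C * real n powr (1.5 - 0.5 * g_exp \<alpha>) * ln (real n) ^ k"
proof (intro exI)
  have "filterlim (\<lambda>n. ln (real n)) at_top sequentially"
    by (rule filterlim_compose[OF ln_at_top filterlim_real_sequentially])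
  then have "\<forall>\<^sub>F n in sequentially. ln (real n) \<ge> 3"
    unfolding filterlim_at_top by blast
  then show "\<forall>\<^sub>F n::nat in sequentially.
           \<forall>(m::nat) (\<alpha>::real) (V::'a::linorder set) (ch::choice_rule).
             real m \<ge> 10 * real n * log b (real n) \<longrightarrow>
             \<alpha> > alpha0 \<longrightarrow>
             real m / (9 * real n * log b (real n)) = real n powr f_exp \<alpha> \<longrightarrow>
             finite V \<longrightarrow> card V = n \<longrightarrow>
             choice_rule_ok ch \<longrightarrow>
             expected_inversions ch m (tree_height n m \<alpha>) V
               \<le> 60000 * real n powr (1.5 - 0.5 * g_exp \<alpha>) * ln (real n) ^ 4"
    using eventually_ge_at_top[of 18]
  proof eventually_elim
    case (elim n)
    have lg: "ln (real n) \<le> log b (real n)" "log b (real n) \<le> 2 * ln (real n)"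
    proof -
      have "1 * ln (real n) \<le> 1 / ln 2 * ln (real n)" "1 / ln 2 * ln (real n) \<le> 2 * ln (real n)"
        using elim(1) ln_2_bounds by (intro mult_right_mono; simp add: field_simps)+
      then show "ln (real n) \<le> log b (real n)" "log b (real n) \<le> 2 * ln (real n)"
        using assms elim(1) by (auto simp: log_def)
    qed
    show ?case
    proof (intro allI impI)
      fix m :: nat and \<alpha> :: real and V :: "'a set" and ch :: choice_rule
      assume \<alpha>: "\<alpha> > alpha0" and V: "finite V" "card V = n" and ok: "choice_rule_ok ch"
        and m: "real m / (9 * real n * log b (real n)) = real n powr f_exp \<alpha>"
      have "9 * real n * log b (real n) > 0" using elim lg by (intro mult_pos_pos) auto
      then have "real m = real n powr f_exp \<alpha> * (9 * real n * log b (real n))"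
        using m by (metis less_irrefl nonzero_divide_eq_eq)
      then have "real m = 9 * real n * log b (real n) * real n powr f_exp \<alpha>"
        by (simp only: mult.commute)
      then interpret parameters n m \<alpha> "log b (real n)"
        using elim lg \<alpha> by unfold_locales
      show "expected_inversions ch m (tree_height n m \<alpha>) V
               \<le> 60000 * real n powr (1.5 - 0.5 * g_exp \<alpha>) * ln (real n) ^ 4"
        by (rule expected_inversions_bound[OF V ok])
    qed
  qed
qed

end
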